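(* Consider the decentralized finite-sum variational inequality of the context, where each $F_m$ is $L$-Lipschitz and $\mu$-strongly monotone ($\mu>0$) and for each $m$ the collection $\{F_{m,i}\}_{i=1}^n$ is $\overline L$-average Lipschitz, over a fixed connected network with gossip matrix $\mathbf W$. Let $\{\mathbf z^k\}$ be the sequence generated by Algorithm 1 (described in the context) with the Chebyshev polynomial $P(\mathbf W)$ (described in the context) used in place of the gossip matrix, with batch size $b\in\{1,\dots,n\}$, probability $p\in(0,1)$ and parameters satisfying, with $\hat\chi=\chi(P(\mathbf W))\le4$, $$\gamma=p\le\tfrac18,\quad \eta=\min\Big\{\tfrac{\sqrt{\gamma b}}{4\overline L},\tfrac1{16L\sqrt{\hat\chi}}\Big\},\quad \beta=\min\Big\{\tfrac{\mu}{4L^2},\tfrac{b\gamma}{4\eta\overline L^2}\Big\},\quad \theta=\min\Big\{\tfrac1{2\beta},\tfrac1{16\eta}\Big\},$$ $$\alpha=\max\Big\{1-\tfrac{\mu\eta}4,\ 1-\beta\theta\hat\chi^{-1},\ 1-\tfrac{p\eta\mu}{2\gamma+\eta\mu}\Big\}.$$ Then, given $\varepsilon>0$, the number of iterations sufficient for $\mathbb E[\|\mathbf z^k-\mathbf z^*\|^2]\le\varepsilon$ is $$\mathcal O\left(\left[\frac1p+\frac1{\sqrt{pb}}\frac{\overline L}{\mu}+\frac L\mu\right]\log\frac1\varepsilon\right).$$ That is, there are an absolute constant $C>0$ and a constant $C_0>0$ depending on the problem, the parameters and the initial point but not on $\varepsilon$ or $k$, such that $\mathbb E[\|\mathbf z^k-\mathbf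 z^*\|^2]\le\varepsilon$ for every integer $k\ge0$ with $k\ge C\big[\frac1p+\frac1{\sqrt{pb}}\frac{\overline L}{\mu}+\frac L\mu\big]\log\frac{C_0}\varepsilon$.
   Context: **Problem.** $F_m=\frac1n\sum_{i=1}^nF_{m,i}$ with $F_{m,i}:\mathbb R^d\to\mathbb R^d$, $m=1,\dots,M$, and $g:\mathbb R^d\to\mathbb R\cup\{+\infty\}$ is proper, lower semicontinuous and convex. Find $z^*\in\mathbb R^d$ with $\langle\sum_mF_m(z^* ),z-z^*\rangle+g(z)-g(z^* )\ge0$ for all $z\in\mathbb R^d$. Lifted form: for $\mathbf z=(z_1,\dots,z_M)\in(\mathbb R^d)^M$ (Euclidean norm) put $\mathbf F(\mathbf z)=(F_1(z_1),\dots,F_M(z_M))$, $\mathbf g(\mathbf z)=\frac1M\sum_mg(z_m)$, $\mathcal L=\{\mathbf z: z_1=\dots=z_M\}$; find $\mathbf z^*\in\mathcal L$ with $\langle\mathbf F(\mathbf z^* ),\mathbf z-\mathbf z^*\rangle+\mathbf g(\mathbf z)-\mathbf g(\mathbf z^* )\ge0$ for all $\mathbf z\in\mathcal L$; thus $\mathbf z^*=(z^*,\dots,z^* )$. **Regularity.** $L$-Lipschitz: $\|F_m(u)-F_m(v)\|\le L\|u-v\|$. $\overline L$-average Lipschitz: $\frac1n\sum_{i}\|F_{m,i}(u)-F_{m,i}(v)\|^2\le\overline L^2\|u-v\|^2$. $\mu$-strongly monotone: $\langle F_m(u)-F_m(v),u-v\rangle\ge\mu\|u-v\|^2$. All hold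 for all $u,v\in\mathbb R^d$. **Network.** $\mathcal G=(\{1,\dots,M\},\mathcal E)$ is an undirected connected graph; the gossip matrix $\mathbf W\in\mathbb R^{M\times M}$ is symmetric positive semidefinite, $\ker\mathbf W$ is the span of the all-ones vector (so $\ker(\mathbf W\otimes\mathbf I_d)=\mathcal L$), $w_{i,j}\ne0$ iff $i=j$ or $(i,j)\in\mathcal E$, and $\lambda_{\max}(\mathbf W)=1$. For a symmetric positive semidefinite nonzero matrix $\mathbf A$, $\chi(\mathbf A)=\lambda_{\max}(\mathbf A)/\lambda^+_{\min}(\mathbf A)$, with $\lambda^+_{\min}$ the smallest positive eigenvalue; $\chi=\chi(\mathbf W)$. **Chebyshev polynomial.** For $\chi>1$ let $c_2=\frac{\chi+1}{\chi-1}$, $c_3=\frac2{\lambda_{\max}(\mathbf W)+\lambda^+_{\min}(\mathbf W)}$, $K=\lfloor\sqrt\chi\rfloor$, $T_K$ the degree-$K$ Chebyshev polynomial of the first kind, and $P(\lambda)=1-T_K(c_2(1-c_3\lambda))/T_K(c_2)$, rescaled by a positive constant so that $\lambda_{\max}(P(\mathbf W))=1$ (for $\chi=1$ take $P(\lambda)=\lambda$). The matrix $P(\mathbf W)$ is symmetric positive semidefinite with the same kernel as $\mathbf W$, multiplication by $P(\mathbf W)\otimes\mathbf I_d$ takes $\lfloor\sqrt\chi\rfloor$ multiplications by $\mathbf W\otimes\mathbf I_d$, and $\chi(P(\mathbf W))\le4$. **Algorithm 1 (with $P(\mathbf W)$ as gossip matrix).** Parameters: stepsizes $\eta,\theta>0$,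 momentums $\alpha,\beta,\gamma$, batch size $b$, probability $p$. Initialization: $\mathbf z^0=\mathbf w^0\in(\mathrm{dom}\,g)^M$, $\mathbf y^0\in\mathcal L^\perp$, $\mathbf z^{-1}=\mathbf z^0$, $\mathbf w^{-1}=\mathbf w^0$, $\mathbf y^{-1}=\mathbf y^0$. For $k=0,1,2,\dots$: each worker $m$ samples indices $j^k_{m,1},\dots,j^k_{m,b}$ and $j^{k+1/2}_{m,1},\dots,j^{k+1/2}_{m,b}$, all independent and uniform on $\{1,\dots,n\}$ (independent of the past and across workers). For $l=1,\dots,b$ let $\mathbf F_l^{k}(\mathbf z)=(F_{1,j^k_{1,l}}(z_1),\dots,F_{M,j^k_{M,l}}(z_M))$ and define $\mathbf F_l^{k+1/2}$ analogously. Then - $\delta^k=\frac1b\sum_{l=1}^b\big(\mathbf F^k_l(\mathbf z^k)-\mathbf F^k_l(\mathbf w^{k-1})+\alpha[\mathbf F^k_l(\mathbf z^k)-\mathbf F^k_l(\mathbf z^{k-1})]\big)+\mathbf F(\mathbf w^{k-1})$; - $\Delta^k=\delta^k-(\mathbf y^k+\alpha(\mathbf y^k-\mathbf y^{k-1}))$; - $\mathbf z^{k+1}=\mathrm{prox}_{\eta\mathbf g}(\mathbf z^k+\gamma(\mathbf w^k-\mathbf z^k)-\eta\Delta^k)$, where $\mathrm{prox}_{\eta\mathbf g}(\mathbf v)=\arg\min_{\mathbf u}\{\eta\mathbf g(\mathbf u)+\frac12\|\mathbf u-\mathbf v\|^2\}$; - $\Delta^{k+1/2}=\frac1b\sum_{l=1}^b\big(\mathbf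 F^{k+1/2}_l(\mathbf z^{k+1})-\mathbf F^{k+1/2}_l(\mathbf w^k)\big)+\mathbf F(\mathbf w^k)$; - $\mathbf y^{k+1}=\mathbf y^k-\theta(P(\mathbf W)\otimes\mathbf I_d)(\mathbf z^{k+1}-\beta(\Delta^{k+1/2}-\mathbf y^k))$; - $\mathbf w^{k+1}=\mathbf z^k$ with probability $p$ and $\mathbf w^{k+1}=\mathbf w^k$ with probability $1-p$ (independent of everything else). *)

theory Defs
  imports "HOL-Probability.Product_PMF" "Jordan_Normal_Form.Matrix_Kernel" "Jordan_Normal_Form.Char_Poly"
begin

unbundle no vec_syntax
unbundle no inner_syntax
hide_const (open) Finite_Cartesian_Product.row Finite_Cartesian_Product.mat
  Finite_Cartesian_Product.vec

text \<open>
  The dimension \<open>d\<close>, the number of workers \<open>M\<close> and the number of summands \<open>n\<close> are values and not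
  types, because the constant of the theorem has to be uniform in them. A point of \<open>R^d\<close> is an
  element of \<^term>\<open>carrier_vec d :: real vec set\<close>. A lifted point \<open>(z_1, ..., z_M)\<close> is the
  \<open>M \<times> d\<close> matrix whose rows are \<open>z_1, ..., z_M\<close>, so that the action of \<open>A \<otimes> I_d\<close> on
  it is the matrix product with \<open>A\<close> from the left. Workers, summands and batch positions are
  numbered from 0.
\<close>

subsection \<open>Euclidean structure\<close>

definition vnorm :: "real vec \<Rightarrow> real" where
  "vnorm v = sqrt (v \<bullet> v)"

definition mat_inner :: "real mat \<Rightarrow> real mat \<Rightarrow> real" where
  "mat_inner A B = (\<Sum>m<dim_row A. row A m \<bullet> row B m)"

definition mnorm :: "real mat \<Rightarrow> real" where
  "mnorm A = sqrt (mat_inner A A)"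

definition mat_sum :: "nat \<Rightarrow> nat \<Rightarrow> ('i \<Rightarrow> real mat) \<Rightarrow> 'i set \<Rightarrow> real mat" where
  "mat_sum nr nc A I = mat nr nc (\<lambda>ij. \<Sum>k\<in>I. A k $$ ij)"

definition consensus :: "nat \<Rightarrow> nat \<Rightarrow> real mat set" where
  "consensus M d = {Z \<in> carrier_mat M d. \<forall>i<M. \<forall>j<M. row Z i = row Z j}"

definition orth_complement :: "nat \<Rightarrow> nat \<Rightarrow> real mat set \<Rightarrow> real mat set" where
  "orth_complement M d S = {Y \<in> carrier_mat M d. \<forall>Z\<in>S. mat_inner Y Z = 0}"

subsection \<open>The variational inequality\<close>

definition proper_fun :: "nat \<Rightarrow> (real vec \<Rightarrow> ereal) \<Rightarrow> bool" where
  "proper_fun d g \<longleftrightarrow> (\<forall>x\<in>carrier_vec d. g x \<noteq> -\<infinity>) \<and> (\<exists>x\<in>carrier_vec d. g x \<noteq> \<infinity>)"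

definition lsc_fun :: "nat \<Rightarrow> (real vec \<Rightarrow> ereal) \<Rightarrow> bool" where
  "lsc_fun d g \<longleftrightarrow> (\<forall>x\<in>carrier_vec d. \<forall>c. c < g x \<longrightarrow>
     (\<exists>r>0. \<forall>y\<in>carrier_vec d. vnorm (y - x) < r \<longrightarrow> c < g y))"

definition convex_fun :: "nat \<Rightarrow> (real vec \<Rightarrow> ereal) \<Rightarrow> bool" where
  "convex_fun d g \<longleftrightarrow> (\<forall>x\<in>carrier_vec d. \<forall>y\<in>carrier_vec d. \<forall>t. 0 < t \<and> t < 1 \<longrightarrow>
     g ((1 - t) \<cdot>\<^sub>v x + t \<cdot>\<^sub>v y) \<le> ereal (1 - t) * g x + ereal t * g y)"

definition dom_fun :: "nat \<Rightarrow> (real vec \<Rightarrow> ereal) \<Rightarrow> real vec set" where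
  "dom_fun d g = {x \<in> carrier_vec d. g x < \<infinity>}"

definition avg_op :: "nat \<Rightarrow> nat \<Rightarrow> (nat \<Rightarrow> real vec \<Rightarrow> real vec) \<Rightarrow> real vec \<Rightarrow> real vec" where
  "avg_op d n f x = vec d (\<lambda>j. (1 / real n) * (\<Sum>i<n. f i x $ j))"

definition lipschitz_op :: "nat \<Rightarrow> real \<Rightarrow> (real vec \<Rightarrow> real vec) \<Rightarrow> bool" where
  "lipschitz_op d L f \<longleftrightarrow>
     (\<forall>u\<in>carrier_vec d. \<forall>v\<in>carrier_vec d. vnorm (f u - f v) \<le> L * vnorm (u - v))"

definition avg_lipschitz_op :: "nat \<Rightarrow> nat \<Rightarrow> real \<Rightarrow> (nat \<Rightarrow> real vec \<Rightarrow> real vec) \<Rightarrow> bool" where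
  "avg_lipschitz_op d n Lb f \<longleftrightarrow>
     (\<forall>u\<in>carrier_vec d. \<forall>v\<in>carrier_vec d.
        (1 / real n) * (\<Sum>i<n. (vnorm (f i u - f i v))\<^sup>2) \<le> Lb\<^sup>2 * (vnorm (u - v))\<^sup>2)"

definition strongly_monotone_op :: "nat \<Rightarrow> real \<Rightarrow> (real vec \<Rightarrow> real vec) \<Rightarrow> bool" where
  "strongly_monotone_op d \<mu> f \<longleftrightarrow>
     (\<forall>u\<in>carrier_vec d. \<forall>v\<in>carrier_vec d. (f u - f v) \<bullet> (u - v) \<ge> \<mu> * (vnorm (u - v))\<^sup>2)"

text \<open>
  \<open>F m i\<close> is the \<open>i\<close>-th summand of worker \<open>m\<close>. Since \<open>g\<close> is proper, a solution has
  \<open>g zs < \<infinity>\<close> (test with a point of the domain), so the convention \<open>\<infinity> - \<infinity> = \<infinity>\<close> of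
  \<^typ>\<open>ereal\<close> is harmless here.
\<close>
definition vi_solution :: "nat \<Rightarrow> nat \<Rightarrow> nat \<Rightarrow> (nat \<Rightarrow> nat \<Rightarrow> real vec \<Rightarrow> real vec) \<Rightarrow>
    (real vec \<Rightarrow> ereal) \<Rightarrow> real vec \<Rightarrow> bool" where
  "vi_solution d M n F g zs \<longleftrightarrow> zs \<in> carrier_vec d \<and>
     (\<forall>z\<in>carrier_vec d.
        ereal (vec d (\<lambda>j. \<Sum>m<M. avg_op d n (F m) zs $ j) \<bullet> (z - zs)) + g z - g zs \<ge> 0)"

subsection \<open>Gossip matrix and its Chebyshev acceleration\<close>

definition undirected_connected :: "nat \<Rightarrow> (nat \<times> nat) set \<Rightarrow> bool" where
  "undirected_connected M E \<longleftrightarrow> E \<subseteq> {..<M} \<times> {..<M} \<and> sym E \<and> (\<forall>i<M. \<forall>j<M. (i, j) \<in> E\<^sup>*)"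

definition lam_max :: "real mat \<Rightarrow> real" where
  "lam_max A = Max {l. eigenvalue A l}"

definition lam_min_pos :: "real mat \<Rightarrow> real" where
  "lam_min_pos A = Min {l. eigenvalue A l \<and> 0 < l}"

definition cond_number :: "real mat \<Rightarrow> real" where
  "cond_number A = lam_max A / lam_min_pos A"

definition gossip_matrix :: "nat \<Rightarrow> (nat \<times> nat) set \<Rightarrow> real mat \<Rightarrow> bool" where
  "gossip_matrix M E W \<longleftrightarrow>
     W \<in> carrier_mat M M \<and>
     transpose_mat W = W \<and>
     (\<forall>v\<in>carrier_vec M. 0 \<le> v \<bullet> (W *\<^sub>v v)) \<and>
     mat_kernel W = range (\<lambda>c. c \<cdot>\<^sub>v vec M (\<lambda>_. 1)) \<and>
     (\<forall>i<M. \<forall>j<M. W $$ (i, j) \<noteq> 0 \<longleftrightarrow> i = j \<or> (i, j) \<in> E) \<and>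
     lam_max W = 1"

fun chebyshev_T :: "nat \<Rightarrow> real poly" where
  "chebyshev_T 0 = 1"
| "chebyshev_T (Suc 0) = [:0, 1:]"
| "chebyshev_T (Suc (Suc k)) = [:0, 2:] * chebyshev_T (Suc k) - chebyshev_T k"

definition mat_poly :: "real poly \<Rightarrow> real mat \<Rightarrow> real mat" where
  "mat_poly q A = mat_sum (dim_row A) (dim_row A) (\<lambda>i. Polynomial.coeff q i \<cdot>\<^sub>m (A ^\<^sub>m i)) {..degree q}"

definition gossip_poly_unscaled :: "real mat \<Rightarrow> real poly" where
  "gossip_poly_unscaled W =
     (let x = cond_number W;
          c2 = (x + 1) / (x - 1);
          c3 = 2 / (lam_max W + lam_min_pos W);
          T = chebyshev_T (nat \<lfloor>sqrt x\<rfloor>)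
      in 1 - Polynomial.smult (1 / poly T c2) (T \<circ>\<^sub>p [:c2, - (c2 * c3):]))"

definition gossip_poly :: "real mat \<Rightarrow> real poly" where
  "gossip_poly W =
     (if cond_number W > 1
      then Polynomial.smult (1 / lam_max (mat_poly (gossip_poly_unscaled W) W)) (gossip_poly_unscaled W)
      else [:0, 1:])"

definition cheb_gossip :: "real mat \<Rightarrow> real mat" where
  "cheb_gossip W = mat_poly (gossip_poly W) W"

subsection \<open>The algorithm\<close>

definition lifted_op :: "nat \<Rightarrow> nat \<Rightarrow> nat \<Rightarrow> (nat \<Rightarrow> nat \<Rightarrow> real vec \<Rightarrow> real vec) \<Rightarrow>
    real mat \<Rightarrow> real mat" where
  "lifted_op d M n F Z = mat\<^sub>r M d (\<lambda>m. avg_op d n (F m) (row Z m))"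

text \<open>\<open>J (m, l)\<close> is the \<open>l\<close>-th index sampled by worker \<open>m\<close>.\<close>
definition sampled_op :: "nat \<Rightarrow> nat \<Rightarrow> (nat \<Rightarrow> nat \<Rightarrow> real vec \<Rightarrow> real vec) \<Rightarrow>
    (nat \<times> nat \<Rightarrow> nat) \<Rightarrow> nat \<Rightarrow> real mat \<Rightarrow> real mat" where
  "sampled_op d M F J l Z = mat\<^sub>r M d (\<lambda>m. F m (J (m, l)) (row Z m))"

definition lifted_fun :: "nat \<Rightarrow> (real vec \<Rightarrow> ereal) \<Rightarrow> real mat \<Rightarrow> ereal" where
  "lifted_fun M g Z = ereal (1 / real M) * (\<Sum>m<M. g (row Z m))"

definition prox :: "nat \<Rightarrow> nat \<Rightarrow> real \<Rightarrow> (real mat \<Rightarrow> ereal) \<Rightarrow> real mat \<Rightarrow> real mat" where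
  "prox d M \<eta> G V =
     arg_min_on (\<lambda>U. ereal \<eta> * G U + ereal ((mnorm (U - V))\<^sup>2 / 2)) (carrier_mat M d)"

text \<open>
  The state at time \<open>k\<close> consists of \<open>z^k, z^(k-1), w^k, w^(k-1), y^k, y^(k-1)\<close>.
\<close>
record alg_state =
  z_cur :: "real mat"
  z_prev :: "real mat"
  w_cur :: "real mat"
  w_prev :: "real mat"
  y_cur :: "real mat"
  y_prev :: "real mat"

record alg_params =
  par_eta :: real
  par_theta :: real
  par_alpha :: real
  par_beta :: real
  par_gamma :: real
  par_batch :: nat
  par_prob :: real

definition alg_delta :: "nat \<Rightarrow> nat \<Rightarrow> nat \<Rightarrow> (nat \<Rightarrow> nat \<Rightarrow> real vec \<Rightarrow> real vec) \<Rightarrow>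
    alg_params \<Rightarrow> (nat \<times> nat \<Rightarrow> nat) \<Rightarrow> alg_state \<Rightarrow> real mat" where
  "alg_delta d M n F par J s =
     (1 / real (par_batch par)) \<cdot>\<^sub>m
       mat_sum M d (\<lambda>l.
         (sampled_op d M F J l (z_cur s) - sampled_op d M F J l (w_prev s))
         + par_alpha par \<cdot>\<^sub>m (sampled_op d M F J l (z_cur s) - sampled_op d M F J l (z_prev s)))
         {..<par_batch par}
     + lifted_op d M n F (w_prev s)"

definition alg_Delta :: "nat \<Rightarrow> nat \<Rightarrow> nat \<Rightarrow> (nat \<Rightarrow> nat \<Rightarrow> real vec \<Rightarrow> real vec) \<Rightarrow>
    alg_params \<Rightarrow> (nat \<times> nat \<Rightarrow> nat) \<Rightarrow> alg_state \<Rightarrow> real mat" where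
  "alg_Delta d M n F par J s =
     alg_delta d M n F par J s - (y_cur s + par_alpha par \<cdot>\<^sub>m (y_cur s - y_prev s))"

definition alg_z_next :: "nat \<Rightarrow> nat \<Rightarrow> nat \<Rightarrow> (nat \<Rightarrow> nat \<Rightarrow> real vec \<Rightarrow> real vec) \<Rightarrow>
    (real vec \<Rightarrow> ereal) \<Rightarrow> alg_params \<Rightarrow> (nat \<times> nat \<Rightarrow> nat) \<Rightarrow> alg_state \<Rightarrow> real mat" where
  "alg_z_next d M n F g par J s =
     prox d M (par_eta par) (lifted_fun M g)
       (z_cur s + par_gamma par \<cdot>\<^sub>m (w_cur s - z_cur s)
        - par_eta par \<cdot>\<^sub>m alg_Delta d M n F par J s)"

definition alg_Delta_half :: "nat \<Rightarrow> nat \<Rightarrow> nat \<Rightarrow> (nat \<Rightarrow> nat \<Rightarrow> real vec \<Rightarrow> real vec) \<Rightarrow>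
    alg_params \<Rightarrow> (nat \<times> nat \<Rightarrow> nat) \<Rightarrow> real mat \<Rightarrow> alg_state \<Rightarrow> real mat" where
  "alg_Delta_half d M n F par J' z' s =
     (1 / real (par_batch par)) \<cdot>\<^sub>m
       mat_sum M d (\<lambda>l. sampled_op d M F J' l z' - sampled_op d M F J' l (w_cur s))
         {..<par_batch par}
     + lifted_op d M n F (w_cur s)"

text \<open>
  \<open>A\<close> is the matrix used for communication; \<open>J\<close> and \<open>J'\<close> are the samples of the half steps
  \<open>k\<close> and \<open>k + 1/2\<close>, and \<open>c\<close> tells whether \<open>w\<close> is refreshed.
\<close>
definition alg_update :: "nat \<Rightarrow> nat \<Rightarrow> nat \<Rightarrow> (nat \<Rightarrow> nat \<Rightarrow> real vec \<Rightarrow> real vec) \<Rightarrow>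
    (real vec \<Rightarrow> ereal) \<Rightarrow> real mat \<Rightarrow> alg_params \<Rightarrow>
    (nat \<times> nat \<Rightarrow> nat) \<Rightarrow> (nat \<times> nat \<Rightarrow> nat) \<Rightarrow> bool \<Rightarrow> alg_state \<Rightarrow> alg_state" where
  "alg_update d M n F g A par J J' c s =
     (let z' = alg_z_next d M n F g par J s;
          D' = alg_Delta_half d M n F par J' z' s;
          y' = y_cur s - par_theta par \<cdot>\<^sub>m (A * (z' - par_beta par \<cdot>\<^sub>m (D' - y_cur s)))
      in \<lparr> z_cur = z', z_prev = z_cur s,
           w_cur = (if c then z_cur s else w_cur s), w_prev = w_cur s,
           y_cur = y', y_prev = y_cur s \<rparr>)"

definition index_pmf :: "nat \<Rightarrow> nat \<Rightarrow> nat \<Rightarrow> (nat \<times> nat \<Rightarrow> nat) pmf" where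
  "index_pmf M n b = Pi_pmf ({..<M} \<times> {..<b}) 0 (\<lambda>_. pmf_of_set {..<n})"

definition alg_step :: "nat \<Rightarrow> nat \<Rightarrow> nat \<Rightarrow> (nat \<Rightarrow> nat \<Rightarrow> real vec \<Rightarrow> real vec) \<Rightarrow>
    (real vec \<Rightarrow> ereal) \<Rightarrow> real mat \<Rightarrow> alg_params \<Rightarrow> alg_state \<Rightarrow> alg_state pmf" where
  "alg_step d M n F g A par s =
     bind_pmf (index_pmf M n (par_batch par)) (\<lambda>J.
     bind_pmf (index_pmf M n (par_batch par)) (\<lambda>J'.
     bind_pmf (bernoulli_pmf (par_prob par)) (\<lambda>c.
     return_pmf (alg_update d M n F g A par J J' c s))))"

definition alg_init :: "real mat \<Rightarrow> real mat \<Rightarrow> alg_state" where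
  "alg_init z0 y0 = \<lparr> z_cur = z0, z_prev = z0, w_cur = z0, w_prev = z0, y_cur = y0, y_prev = y0 \<rparr>"

text \<open>The law of the state at time \<open>k\<close>, the iterates being a Markov chain.\<close>
primrec alg_law :: "nat \<Rightarrow> nat \<Rightarrow> nat \<Rightarrow> (nat \<Rightarrow> nat \<Rightarrow> real vec \<Rightarrow> real vec) \<Rightarrow>
    (real vec \<Rightarrow> ereal) \<Rightarrow> real mat \<Rightarrow> alg_params \<Rightarrow> alg_state \<Rightarrow> nat \<Rightarrow> alg_state pmf" where
  "alg_law d M n F g A par s 0 = return_pmf s"
| "alg_law d M n F g A par s (Suc k) =
     bind_pmf (alg_law d M n F g A par s k) (alg_step d M n F g A par)"

end

theory Submission
  imports Defs
begin

text \<open>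
  The step from \<open>k\<close> to \<open>k + 1\<close> contracts, in expectation and by the factor \<open>\<alpha>\<close>, the function
    \<open>(1 + \<eta>\<mu>) |z - z*|\<^sup>2 + ((\<gamma> + \<eta>\<mu>/2)/p) |w - z*|\<^sup>2 + (3\<gamma>/4) |z - w'|\<^sup>2 + (5/16) |z - z'|\<^sup>2
     + (\<eta>/2\<theta>) |y - y'|\<^sub>B\<^sup>2 + (\<eta>/\<theta>) |y - y*|\<^sub>B\<^sup>2 - 2\<eta> (F(z) - F(z')) \<bullet> (z - z*) + 2\<eta> (y - y') \<bullet> (z - z*)\<close>,
  where primes denote the previous iterates, \<open>B\<close> is the pseudo-inverse of the gossip operator and
  \<open>y*\<close> is the projection of \<open>F(z*)\<close> onto the orthogonal complement of the consensus space. The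
  extrapolation terms of the algorithm make the two inner products telescope with momentum \<open>\<alpha>\<close>;
  strong monotonicity pays for the contraction in \<open>z\<close>, and the term \<open>\<beta>y\<close> in the dual update,
  together with \<open>|v|\<^sup>2 \<le> |v|\<^sub>B\<^sup>2 \<le> \<chi>|v|\<^sup>2\<close> on the complement, for the contraction in \<open>y\<close>. The variances of
  the two sampling steps are bounded by \<open>|z - w'|\<^sup>2\<close>, \<open>|z - z'|\<^sup>2\<close> and \<open>|z - w|\<^sup>2\<close>, which the loopless
  variance reduction controls. Finally \<open>1/(1 - \<alpha>)\<close> is of the order of the claimed bound, because
  the Chebyshev polynomial gives \<open>\<chi> \<le> 5\<close>.
\<close>

section \<open>Lifted points as finitely supported functions\<close>

text \<open>By the variational inequality, minus the sum of the F_m at zs is a subgradient of g at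
  zs. The lifted problem charges each worker 1/M of it, and what is left of the lifted operator at
  zs sums to zero over the workers. The dual iterate has to find this remainder, which is why it
  stays orthogonal to the consensus space and is measured by the inverse of the gossip operator. The
  inner products make the Lyapunov function indefinite term by term; it still dominates half the
  squared distance of z, because \<eta> L and \<eta> \<theta> are at most 1/16. Two ingredients are
  not free. The proximal operator is a choice of minimiser, so nothing is known about it before a
  minimiser is shown to exist. The pseudo-inverse needs a spectral theorem, which is obtained
  algebraically: a self-adjoint operator of finite rank is annihilated by a product of distinct
  linear factors, and Lagrange interpolation yields its spectral projections. The 5 is the ratio of
  1 + 2/3 to 1 - 2/3, where 2/3 comes from the tangent bound T_K(c2) \<ge> 3/2.\<close>

text \<open>
  Since \<open>M\<close> and \<open>d\<close> are values, all lifted spaces are embedded into one inner product space, in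
  which the operator inequalities can be stated without carrier sets. It is not complete.
\<close>
typedef fin_fun = "{f :: nat \<times> nat \<Rightarrow> real. finite {a. f a \<noteq> 0}}"
  morphisms fcoord Abs_fin_fun
  by (rule exI[of _ "\<lambda>_. 0"]) simp

setup_lifting type_definition_fin_fun

lemma finite_fcoord: "finite {a. fcoord x a \<noteq> 0}"
  using fcoord by auto

lemma fin_fun_eqI: "(\<And>a. fcoord x a = fcoord y a) \<Longrightarrow> x = y"
  by (metis ext fcoord_inject)

instantiation fin_fun :: real_vector
begin

lift_definition zero_fin_fun :: fin_fun is "\<lambda>_. 0" by simp

lift_definition plus_fin_fun :: "fin_fun \<Rightarrow> fin_fun \<Rightarrow> fin_fun" is "\<lambda>f g a. f a + g a"
proof -
  fix f g :: "nat \<times> nat \<Rightarrow> real"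
  assume "finite {a. f a \<noteq> 0}" "finite {a. g a \<noteq> 0}"
  then show "finite {a. f a + g a \<noteq> 0}"
    by (auto intro: finite_subset[of _ "{a. f a \<noteq> 0} \<union> {a. g a \<noteq> 0}"])
qed

lift_definition uminus_fin_fun :: "fin_fun \<Rightarrow> fin_fun" is "\<lambda>f a. - f a" by simp

lift_definition minus_fin_fun :: "fin_fun \<Rightarrow> fin_fun \<Rightarrow> fin_fun" is "\<lambda>f g a. f a - g a"
proof -
  fix f g :: "nat \<times> nat \<Rightarrow> real"
  assume "finite {a. f a \<noteq> 0}" "finite {a. g a \<noteq> 0}"
  then show "finite {a. f a - g a \<noteq> 0}"
    by (auto intro: finite_subset[of _ "{a. f a \<noteq> 0} \<union> {a. g a \<noteq> 0}"])
qed

lift_definition scaleR_fin_fun :: "real \<Rightarrow> fin_fun \<Rightarrow> fin_fun" is "\<lambda>c f a. c * f a"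
  by (auto elim: rev_finite_subset)

instance
  by standard (transfer; simp add: algebra_simps fun_eq_iff)+

end

lemma fcoord_simps [simp]:
  "fcoord 0 a = 0" "fcoord (x + y) a = fcoord x a + fcoord y a" "fcoord (- x) a = - fcoord x a"
  "fcoord (x - y) a = fcoord x a - fcoord y a" "fcoord (c *\<^sub>R x) a = c * fcoord x a"
  by (transfer; simp)+

lemma fcoord_sum [simp]: "fcoord (\<Sum>i\<in>I. x i) a = (\<Sum>i\<in>I. fcoord (x i) a)"
  by (induction I rule: infinite_finite_induct) auto

instantiation fin_fun :: real_inner
begin

definition inner_fin_fun :: "fin_fun \<Rightarrow> fin_fun \<Rightarrow> real" where
  "inner_fin_fun x y = (\<Sum>a | fcoord x a \<noteq> 0. fcoord x a * fcoord y a)"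

definition norm_fin_fun :: "fin_fun \<Rightarrow> real" where
  "norm_fin_fun x = sqrt (inner x x)"

definition sgn_fin_fun :: "fin_fun \<Rightarrow> fin_fun" where
  "sgn_fin_fun x = x /\<^sub>R norm x"

definition dist_fin_fun :: "fin_fun \<Rightarrow> fin_fun \<Rightarrow> real" where
  "dist_fin_fun x y = norm (x - y)"

definition uniformity_fin_fun :: "(fin_fun \<times> fin_fun) filter" where
  "uniformity_fin_fun = (INF e\<in>{0 <..}. principal {(x, y). dist x y < e})"

definition open_fin_fun :: "fin_fun set \<Rightarrow> bool" where
  "open_fin_fun U \<longleftrightarrow> (\<forall>x\<in>U. eventually (\<lambda>(x', y). x' = x \<longrightarrow> y \<in> U) uniformity)"

lemma inner_fin_fun_superset:
  assumes "finite S" "{a. fcoord x a \<noteq> 0} \<subseteq> S"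
  shows "inner x y = (\<Sum>a\<in>S. fcoord x a * fcoord y a)"
  unfolding inner_fin_fun_def using assms by (intro sum.mono_neutral_left) auto

instance
proof
  fix x y z :: fin_fun and r :: real
  let ?S = "{a. fcoord x a \<noteq> 0} \<union> {a. fcoord y a \<noteq> 0} \<union> {a. fcoord z a \<noteq> 0}"
  have fin: "finite ?S" by (simp add: finite_fcoord)
  have sup: "inner u v = (\<Sum>a\<in>?S. fcoord u a * fcoord v a)"
    if "u \<in> {x, y, z, x + y, r *\<^sub>R x}" for u v
    by (rule inner_fin_fun_superset[OF fin]) (use that in auto)
  show "inner x y = inner y x" by (simp add: sup mult.commute)
  show "inner (x + y) z = inner x z + inner y z"
    by (simp add: sup algebra_simps sum.distrib)
  show "inner (r *\<^sub>R x) y = r * inner x y"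
    by (simp add: sup algebra_simps sum_distrib_left)
  show "0 \<le> inner x x" by (simp add: sup sum_nonneg)
  show "(inner x x = 0) = (x = 0)"
  proof
    assume "inner x x = 0"
    then have "\<forall>a\<in>{a. fcoord x a \<noteq> 0}. fcoord x a * fcoord x a = 0"
      unfolding inner_fin_fun_def using finite_fcoord[of x]
      by (subst (asm) sum_nonneg_eq_0_iff) auto
    then show "x = 0" by (intro fin_fun_eqI) auto
  qed (simp add: inner_fin_fun_def)
qed (auto simp: norm_fin_fun_def sgn_fin_fun_def dist_fin_fun_def uniformity_fin_fun_def
    open_fin_fun_def)

end

section \<open>Embedding of vectors and matrices into the lifted space\<close>

definition remb :: "nat \<Rightarrow> real vec \<Rightarrow> fin_fun" where
  "remb m v = Abs_fin_fun (\<lambda>(i, j). if i = m \<and> j < dim_vec v then v $ j else 0)"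

text \<open>Built from rows because the images of \<open>remb m\<close> for distinct m are
  orthogonal, so inner products and norms of lifted points split into sums over the workers.\<close>

definition emb :: "real mat \<Rightarrow> fin_fun" where
  "emb Z = (\<Sum>m<dim_row Z. remb m (row Z m))"

lemma fcoord_remb:
  "fcoord (remb m v) a = (if fst a = m \<and> snd a < dim_vec v then v $ snd a else 0)"
proof -
  have "finite {a. (case a of (i, j) \<Rightarrow> if i = m \<and> j < dim_vec v then v $ j else 0) \<noteq> 0}"
    by (rule finite_subset[of _ "{m} \<times> {..<dim_vec v}"]) (auto split: if_splits)
  then show ?thesis
    unfolding remb_def by (subst Abs_fin_fun_inverse) (auto split: prod.splits)
qed

lemma fcoord_emb:
  "fcoord (emb Z) a = (if fst a < dim_row Z \<and> snd a < dim_col Z then Z $$ a else 0)"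
proof -
  have "fcoord (emb Z) a = (\<Sum>m<dim_row Z. if m = fst a then (if snd a < dim_col Z then row Z m $ snd a else 0) else 0)"
    unfolding emb_def by (auto simp: fcoord_remb intro!: sum.cong)
  then show ?thesis by (cases a) auto
qed

lemma remb_linear:
  assumes "u \<in> carrier_vec d" "v \<in> carrier_vec d"
  shows "remb m (u + v) = remb m u + remb m v" "remb m (u - v) = remb m u - remb m v"
  using assms by (auto intro!: fin_fun_eqI simp: fcoord_remb)

lemma remb_smult [simp]: "remb m (c \<cdot>\<^sub>v u) = c *\<^sub>R remb m u"
  by (auto intro!: fin_fun_eqI simp: fcoord_remb)

lemma emb_linear:
  assumes "A \<in> carrier_mat M d" "B \<in> carrier_mat M d"
  shows "emb (A + B) = emb A + emb B" "emb (A - B) = emb A - emb B"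
  using assms by (auto intro!: fin_fun_eqI simp: fcoord_emb)

lemma emb_smult [simp]: "emb (c \<cdot>\<^sub>m A) = c *\<^sub>R emb A"
  by (auto intro!: fin_fun_eqI simp: fcoord_emb)

lemma inner_remb:
  assumes "u \<in> carrier_vec d" "v \<in> carrier_vec d"
  shows "inner (remb m u) (remb m' v) = (if m = m' then u \<bullet> v else 0)"
proof -
  have "inner (remb m u) (remb m' v) = (\<Sum>a\<in>{m} \<times> {..<d}. fcoord (remb m u) a * fcoord (remb m' v) a)"
    by (rule inner_fin_fun_superset) (use assms in \<open>auto simp: fcoord_remb split: if_splits\<close>)
  also have "\<dots> = (\<Sum>i\<in>{m}. \<Sum>j<d. fcoord (remb m u) (i, j) * fcoord (remb m' v) (i, j))"
    by (simp only: sum.cartesian_product) (simp add: case_prod_beta)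
  also have "\<dots> = (\<Sum>j<d. u $ j * (if m = m' then v $ j else 0))"
    using assms by (auto simp: fcoord_remb intro!: sum.cong)
  finally show ?thesis
    using assms by (auto simp: scalar_prod_def lessThan_atLeast0)
qed

lemma norm_remb: "norm (remb m v) = vnorm v"
  by (simp add: norm_eq_sqrt_inner vnorm_def inner_remb[of v "dim_vec v"])

lemma inner_sum_remb:
  assumes "\<And>m. m < M \<Longrightarrow> u m \<in> carrier_vec d" "\<And>m. m < M \<Longrightarrow> v m \<in> carrier_vec d"
  shows "inner (\<Sum>m<M. remb m (u m)) (\<Sum>m<M. remb m (v m)) = (\<Sum>m<M. u m \<bullet> v m)"
proof -
  have "inner (\<Sum>m<M. remb m (u m)) (\<Sum>m<M. remb m (v m)) =
    (\<Sum>m<M. \<Sum>m'<M. if m = m' then u m \<bullet> v m' else 0)"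
    unfolding inner_sum_left inner_sum_right using assms
    by (subst sum.swap) (intro sum.cong refl, simp add: inner_remb[of _ d])
  then show ?thesis by simp
qed

lemma norm_sum_remb:
  assumes "\<And>m. m < M \<Longrightarrow> u m \<in> carrier_vec d"
  shows "(norm (\<Sum>m<M. remb m (u m)))\<^sup>2 = (\<Sum>m<M. (vnorm (u m))\<^sup>2)"
proof -
  have "0 \<le> u m \<bullet> u m" for m unfolding scalar_prod_def by (intro sum_nonneg) simp
  then show ?thesis
    unfolding power2_norm_eq_inner vnorm_def using inner_sum_remb[OF assms assms, of M] by simp
qed

lemma inner_emb:
  assumes "A \<in> carrier_mat M d" "B \<in> carrier_mat M d"
  shows "inner (emb A) (emb B) = mat_inner A B"
  using inner_sum_remb[of M "row A" d "row B"] assms by (auto simp: emb_def mat_inner_def)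

lemma norm_emb: "norm (emb A) = mnorm A"
  by (simp add: norm_eq_sqrt_inner mnorm_def inner_emb[of A "dim_row A" "dim_col A"])

lemma emb_mat_of_rows:
  assumes "\<And>m. m < M \<Longrightarrow> r m \<in> carrier_vec d"
  shows "emb (mat\<^sub>r M d r) = (\<Sum>m<M. remb m (r m))"
  using assms unfolding emb_def by (intro sum.cong) auto

lemma emb_mat_sum:
  assumes "\<And>i. i \<in> I \<Longrightarrow> A i \<in> carrier_mat M d"
  shows "emb (mat_sum M d A I) = (\<Sum>i\<in>I. emb (A i))"
proof (rule fin_fun_eqI)
  fix a
  have "dim_row (A i) = M" "dim_col (A i) = d" if "i \<in> I" for i using assms[OF that] by auto
  then show "fcoord (emb (mat_sum M d A I)) a = fcoord (\<Sum>i\<in>I. emb (A i)) a"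
    by (cases a) (auto simp: fcoord_emb mat_sum_def intro!: sum.neutral)
qed

section \<open>Spectral resolution of self-adjoint operators\<close>

definition poly_app :: "real poly \<Rightarrow> ('a::real_vector \<Rightarrow> 'a) \<Rightarrow> 'a \<Rightarrow> 'a" where
  "poly_app q T u = (\<Sum>i\<le>degree q. Polynomial.coeff q i *\<^sub>R (T ^^ i) u)"

lemma poly_app_le:
  assumes "degree q \<le> N"
  shows "poly_app q T u = (\<Sum>i\<le>N. Polynomial.coeff q i *\<^sub>R (T ^^ i) u)"
  unfolding poly_app_def using assms
  by (intro sum.mono_neutral_left) (auto simp: coeff_eq_0)

lemma poly_app_0 [simp]: "poly_app 0 T u = 0"
  by (simp add: poly_app_def)

lemma poly_app_add: "poly_app (p + q) T u = poly_app p T u + poly_app q T u"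
proof -
  let ?N = "max (degree p) (degree q)"
  have "degree (p + q) \<le> ?N" by (rule degree_add_le) auto
  then show ?thesis
    by (simp add: poly_app_le[of _ ?N] scaleR_left_distrib sum.distrib)
qed

lemma poly_app_smult: "poly_app (Polynomial.smult c p) T u = c *\<^sub>R poly_app p T u"
  by (simp add: poly_app_le[of _ "degree p"] degree_smult_le scaleR_sum_right)

lemma poly_app_diff: "poly_app (p - q) T u = poly_app p T u - poly_app q T u"
  using poly_app_add[of "p - q" q T u] by simp

lemma poly_app_sum: "poly_app (\<Sum>i\<in>I. p i) T u = (\<Sum>i\<in>I. poly_app (p i) T u)"
  by (induction I rule: infinite_finite_induct) (auto simp: poly_app_add)

lemma poly_app_pCons:
  assumes "linear T"
  shows "poly_app (pCons a p) T u = a *\<^sub>R u + T (poly_app p T u)"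
proof -
  have "poly_app (pCons a p) T u = (\<Sum>i\<le>Suc (degree p). Polynomial.coeff (pCons a p) i *\<^sub>R (T ^^ i) u)"
    by (intro poly_app_le degree_pCons_le)
  also have "\<dots> = a *\<^sub>R u + (\<Sum>i\<le>degree p. Polynomial.coeff p i *\<^sub>R (T ^^ Suc i) u)"
    by (subst sum.atMost_Suc_shift) simp
  also have "(\<Sum>i\<le>degree p. Polynomial.coeff p i *\<^sub>R (T ^^ Suc i) u) = T (poly_app p T u)"
    by (simp add: poly_app_def linear_sum[OF assms] linear_scale[OF assms])
  finally show ?thesis .
qed

lemma poly_app_1 [simp]: "poly_app 1 T u = u"
  by (simp add: poly_app_def)

lemma linear_poly_app:
  assumes "linear T"
  shows "linear (poly_app p T)"
proof (induction p)
  case 0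
  have "poly_app 0 T = (\<lambda>u. 0)" by (rule ext) simp
  then show ?case by (simp add: linear_zero)
next
  case (pCons a p)
  have "poly_app (pCons a p) T = (\<lambda>u. a *\<^sub>R u + T (poly_app p T u))"
    by (rule ext) (rule poly_app_pCons[OF assms])
  moreover have "linear (\<lambda>u. T (poly_app p T u))"
    using linear_compose[OF pCons(2) assms] by (simp add: o_def)
  ultimately show ?case by (simp add: linear_compose_add linear_compose_scale_right linear_ident)
qed

lemma poly_app_mult:
  assumes "linear T"
  shows "poly_app (p * q) T u = poly_app p T (poly_app q T u)"
proof (induction p)
  case (pCons a p)
  then show ?case by (simp add: poly_app_add poly_app_smult poly_app_pCons[OF assms])
qed simp

lemma poly_app_adjoint:
  assumes "linear T" "\<And>u v. inner (T u) v = inner u (T v)"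
  shows "inner (poly_app p T u) v = inner u (poly_app p T v)"
proof (induction p arbitrary: u v)
  case (pCons a p)
  have "T (poly_app p T v) = poly_app p T (T v)"
    using poly_app_mult[OF assms(1), of p "[:0, 1:]" v] poly_app_mult[OF assms(1), of "[:0, 1:]" p v]
    by (simp add: poly_app_pCons[OF assms(1)] linear_0[OF assms(1)] mult.commute)
  then show ?case
    by (simp add: poly_app_pCons[OF assms(1)] inner_add assms(2) pCons)
qed simp

lemma poly_app_eigenvector:
  assumes "linear T" "T u = l *\<^sub>R u"
  shows "poly_app p T u = poly p l *\<^sub>R u"
  by (induction p)
    (auto simp: poly_app_pCons[OF assms(1)] linear_scale[OF assms(1)] assms(2) algebra_simps)

section \<open>Minimal polynomial and spectral projections\<close>

lemma prod_linear_factors_dvd: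
  fixes q :: "real poly"
  assumes "finite S" "\<And>x. x \<in> S \<Longrightarrow> poly q x = 0"
  shows "(\<Prod>x\<in>S. [:- x, 1:]) dvd q"
  using assms
proof (induction S rule: finite_induct)
  case (insert a S)
  then obtain r where r: "q = (\<Prod>x\<in>S. [:- x, 1:]) * r" by blast
  have "poly (\<Prod>x\<in>S. [:- x, 1:]) a \<noteq> 0" using insert by (auto simp: poly_prod)
  then have "poly r a = 0" using insert(4)[of a] r by auto
  then obtain s where "r = [:- a, 1:] * s" by (auto simp: poly_eq_0_iff_dvd elim: dvdE)
  then have "q = (\<Prod>x\<in>insert a S. [:- x, 1:]) * s"
    using r insert(1,2) by (simp add: prod.insert mult_ac del: mult_pCons_left mult_pCons_right)
  then show ?case by (rule dvdI)
qed simp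

text \<open>A complex root c = a + ib exists and is not real. The remainder modulo the quadratic
  with roots c and its conjugate has degree at most 1 and vanishes at c; the imaginary part kills
  its leading coefficient and then the real part its constant one.\<close>

lemma real_poly_irreducible_cases:
  fixes r :: "real poly"
  assumes "0 < degree r" "\<And>x. poly r x \<noteq> 0"
  obtains a b s where "b \<noteq> 0" "r = [:a\<^sup>2 + b\<^sup>2, - 2 * a, 1:] * s"
proof -
  let ?R = "map_poly complex_of_real r"
  have "degree ?R = degree r" by (rule degree_map_poly) simp
  then have "\<not> constant (poly ?R)" using assms(1) by (simp add: constant_degree)
  then obtain c where c: "poly ?R c = 0" using fundamental_theorem_of_algebra by blast
  define a b where "a = Re c" and "b = Im c"
  define Q where "Q = [:a\<^sup>2 + b\<^sup>2, - 2 * a, 1:]"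
  have ev: "poly (map_poly complex_of_real (p * q)) x = poly (map_poly complex_of_real p) x * poly (map_poly complex_of_real q) x"
    "poly (map_poly complex_of_real (p + q)) x = poly (map_poly complex_of_real p) x + poly (map_poly complex_of_real q) x"
    for p q x
  proof -
    have "map_poly complex_of_real (p * q) = map_poly complex_of_real p * map_poly complex_of_real q"
      by (intro poly_eqI) (simp add: coeff_map_poly coeff_mult)
    moreover have "map_poly complex_of_real (p + q) = map_poly complex_of_real p + map_poly complex_of_real q"
      by (intro poly_eqI) (simp add: coeff_map_poly)
    ultimately show
      "poly (map_poly complex_of_real (p * q)) x = poly (map_poly complex_of_real p) x * poly (map_poly complex_of_real q) x"
      "poly (map_poly complex_of_real (p + q)) x = poly (map_poly complex_of_real p) x + poly (map_poly complex_of_real q) x"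
      by simp_all
  qed
  have b: "b \<noteq> 0"
  proof
    assume "b = 0"
    then have "c = complex_of_real a" by (simp add: a_def b_def complex_eq_iff)
    then show False using c assms(2)[of a] by simp
  qed
  have "degree Q = 2" by (simp add: Q_def)
  then have deg: "degree (r mod Q) < 2 \<or> r mod Q = 0"
    using degree_mod_less'[of Q r] by (cases "Q = 0") auto
  have Qc: "poly (map_poly complex_of_real Q) c = 0"
    by (simp add: Q_def a_def b_def complex_eq_iff power2_eq_square algebra_simps map_poly_pCons)
  have "poly (map_poly complex_of_real (r mod Q)) c = 0"
    using c Qc ev(1)[of "r div Q" Q c] ev(2)[of "r div Q * Q" "r mod Q" c] by simp
  moreover obtain t0 t1 where t: "r mod Q = [:t0, t1:]"
  proof -
    have "degree (r mod Q) \<le> 1" using deg by auto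
    then have "r mod Q = [:Polynomial.coeff (r mod Q) 0, Polynomial.coeff (r mod Q) 1:]"
      by (intro poly_eqI) (auto simp: coeff_pCons coeff_eq_0 split: nat.splits)
    then show ?thesis using that by blast
  qed
  ultimately have "t0 + t1 * a = 0" "t1 * b = 0"
    by (cases "t0 = 0"; cases "t1 = 0";
        simp add: map_poly_pCons a_def b_def complex_eq_iff algebra_simps)+
  then have "r mod Q = 0" using t b by simp
  then obtain s where "r = Q * s" by (auto dest!: mod_0_imp_dvd elim: dvdE)
  then show ?thesis using that[OF b] by (simp only: Q_def)
qed

text \<open>
  An annihilating polynomial of least degree has only simple real roots, because
  \<open>(T - a)\<^sup>2 + b\<^sup>2\<close> is injective for \<open>b \<noteq> 0\<close> and \<open>(T - x)\<^sup>2 v = 0\<close> implies \<open>(T - x) v = 0\<close>.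
\<close>
lemma selfadjoint_minimal_poly:
  fixes T :: "'a::real_inner \<Rightarrow> 'a"
  assumes lin: "linear T" and adj: "\<And>u v. inner (T u) v = inner u (T v)"
    and ann: "p \<noteq> 0" "\<And>u. poly_app p T u = 0"
  obtains \<Lambda> where "finite \<Lambda>" "\<And>u. poly_app (\<Prod>x\<in>\<Lambda>. [:- x, 1:]) T u = 0"
proof -
  define ok where "ok q \<longleftrightarrow> q \<noteq> 0 \<and> (\<forall>u. poly_app q T u = 0)" for q
  obtain q where q: "ok q" and min: "\<And>q'. ok q' \<Longrightarrow> degree q \<le> degree q'"
    using ex_has_least_nat[of ok p degree] ann by (auto simp: ok_def)
  have no_ann: "\<exists>u. poly_app q' T u \<noteq> 0" if "q' \<noteq> 0" "degree q' < degree q" for q'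
    using min[of q'] that by (auto simp: ok_def)
  have q0: "q \<noteq> 0" using q by (simp add: ok_def)
  define \<Lambda> where "\<Lambda> = {x. poly q x = 0}"
  have fin: "finite \<Lambda>" using q0 by (simp add: \<Lambda>_def poly_roots_finite)
  have simple: "poly r x \<noteq> 0" if r: "q = [:- x, 1:] * r" for r x
  proof
    assume "poly r x = 0"
    then obtain s where s: "r = [:- x, 1:] * s" by (auto simp: poly_eq_0_iff_dvd elim: dvdE)
    have "r \<noteq> 0" using q0 r by auto
    moreover from this have "degree q = degree [:- x, 1:] + degree r"
      unfolding r by (intro degree_mult_eq) simp_all
    ultimately obtain u where u: "poly_app r T u \<noteq> 0" using no_ann[of r] by auto
    define v where "v = poly_app s T u"
    have lv: "poly_app [:- x, 1:] T w = T w - x *\<^sub>R w" for w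
      by (simp add: poly_app_pCons[OF lin] linear_0[OF lin])
    have "poly_app q T u = poly_app [:- x, 1:] T (poly_app [:- x, 1:] T v)"
      unfolding r s v_def by (simp only: poly_app_mult[OF lin])
    then have "inner (poly_app [:- x, 1:] T (poly_app [:- x, 1:] T v)) v = 0"
      using q by (simp add: ok_def)
    then have "inner (poly_app [:- x, 1:] T v) (poly_app [:- x, 1:] T v) = 0"
      by (simp only: poly_app_adjoint[OF lin adj, of "[:- x, 1:]" "poly_app [:- x, 1:] T v" v])
    then have "poly_app [:- x, 1:] T v = 0" by (simp only: inner_eq_zero_iff)
    then show False using u unfolding s v_def by (simp only: poly_app_mult[OF lin] simp_thms)
  qed
  obtain r where r: "q = (\<Prod>x\<in>\<Lambda>. [:- x, 1:]) * r"
    using prod_linear_factors_dvd[OF fin, of q] by (auto simp: \<Lambda>_def elim: dvdE)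
  have r_root: "poly r x \<noteq> 0" for x
  proof
    assume x: "poly r x = 0"
    have "poly q x = 0" using x by (subst r) simp
    then have "x \<in> \<Lambda>" by (simp add: \<Lambda>_def)
    then have "q = [:- x, 1:] * ((\<Prod>x\<in>\<Lambda> - {x}. [:- x, 1:]) * r)"
      unfolding r by (simp only: prod.remove[OF fin \<open>x \<in> \<Lambda>\<close>] mult_ac)
    from simple[OF this] show False using x by simp
  qed
  have "degree r = 0"
  proof (rule ccontr)
    assume "degree r \<noteq> 0"
    then have "0 < degree r" by simp
    obtain b a s where b: "b \<noteq> 0" and s: "r = [:a\<^sup>2 + b\<^sup>2, - 2 * a, 1:] * s"
      by (rule real_poly_irreducible_cases[OF \<open>0 < degree r\<close> r_root])
    define q' where "q' = (\<Prod>x\<in>\<Lambda>. [:- x, 1:]) * s"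
    have q': "q = [:a\<^sup>2 + b\<^sup>2, - 2 * a, 1:] * q'" by (simp only: r s q'_def mult_ac)
    have "q' \<noteq> 0" using q0 q' by (metis mult_zero_right)
    moreover from this have "degree q = degree [:a\<^sup>2 + b\<^sup>2, - 2 * a, 1:] + degree q'"
      unfolding q' by (intro degree_mult_eq) simp_all
    ultimately obtain u where u: "poly_app q' T u \<noteq> 0" using no_ann[of q'] by auto
    define v where "v = poly_app q' T u"
    define t where "t = T v - a *\<^sub>R v"
    have "poly_app [:a\<^sup>2 + b\<^sup>2, - 2 * a, 1:] T v = 0"
      using q unfolding ok_def q' v_def by (simp only: poly_app_mult[OF lin])
    then have "inner ((a\<^sup>2 + b\<^sup>2) *\<^sub>R v + T (- (2 * a) *\<^sub>R v + T v)) v = 0"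
      by (simp add: poly_app_pCons[OF lin] linear_0[OF lin])
    then have "(a\<^sup>2 + b\<^sup>2) * inner v v + inner (- (2 * a) *\<^sub>R v + T v) (T v) = 0"
      by (simp only: inner_add_left[of _ "T (- (2 * a) *\<^sub>R v + T v)"] adj inner_scaleR_left)
    \<comment> \<open>Completing the square in t = T v - a v, after one T has been moved across the
      inner product.\<close>
    then have "inner t t + b\<^sup>2 * inner v v = 0"
      unfolding t_def by (simp add: inner_simps inner_commute power2_eq_square algebra_simps)
    moreover have "0 < b\<^sup>2 * inner v v" using b u by (simp add: v_def)
    moreover have "0 \<le> inner t t" by simp
    ultimately show False by linarith
  qed
  then obtain k where k: "r = [:k:]" by (meson degree_eq_zeroE)
  have "k \<noteq> 0" using q0 r k by auto
  have "k *\<^sub>R poly_app (\<Prod>x\<in>\<Lambda>. [:- x, 1:]) T u = 0" for u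
    using q r k unfolding ok_def by (auto simp: poly_app_smult)
  then show ?thesis using that[OF fin] \<open>k \<noteq> 0\<close> by simp
qed

text \<open>Both sides have degree below \<open>card \<Lambda>\<close> and agree at the points of
  \<Lambda>. Evaluated at an operator, the identity becomes the resolution of the identity into
  spectral projections.\<close>

lemma sum_lagrange_basis:
  fixes \<Lambda> :: "real set"
  assumes "finite \<Lambda>" "\<Lambda> \<noteq> {}"
  shows "(\<Sum>l\<in>\<Lambda>. Polynomial.smult (1 / (\<Prod>m\<in>\<Lambda> - {l}. l - m)) (\<Prod>m\<in>\<Lambda> - {l}. [:- m, 1:])) = 1"
    (is "(\<Sum>l\<in>\<Lambda>. ?e l) = 1")
proof (rule poly_eqI_degree[of \<Lambda>])
  fix x assume x: "x \<in> \<Lambda>"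
  have "poly (?e l) x = (if l = x then 1 else 0)" if "l \<in> \<Lambda>" for l
    using assms x by (auto simp: poly_prod prod_zero_iff)
  then show "poly (\<Sum>l\<in>\<Lambda>. ?e l) x = poly 1 x" using assms x by (simp add: poly_sum)
next
  have "degree (?e l) \<le> card \<Lambda> - 1" if "l \<in> \<Lambda>" for l
  proof -
    have "degree (?e l) \<le> degree (\<Prod>m\<in>\<Lambda> - {l}. [:- m, 1:])" by (rule degree_smult_le)
    also have "\<dots> \<le> (\<Sum>m\<in>\<Lambda> - {l}. degree [:- m, 1:])"
      using degree_prod_sum_le[of "\<Lambda> - {l}" "\<lambda>m. [:- m, 1:]"] assms by (simp add: o_def)
    finally show ?thesis using that assms by simp
  qed
  then have "degree (\<Sum>l\<in>\<Lambda>. ?e l) \<le> card \<Lambda> - 1" using assms by (intro degree_sum_le) auto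
  moreover have "card \<Lambda> > 0" using assms by (simp add: card_gt_0_iff)
  ultimately show "degree (\<Sum>l\<in>\<Lambda>. ?e l) < card \<Lambda>" by linarith
qed (use assms in \<open>simp add: card_gt_0_iff\<close>)

text \<open>The projections are the Lagrange basis polynomials of the annihilating product,
  evaluated at T. As polynomials in T they are self-adjoint; times X - l, the one for l is a
  multiple of the annihilating product, so T acts on its range as multiplication by l.\<close>

theorem selfadjoint_spectral_resolution:
  fixes T :: "'a::real_inner \<Rightarrow> 'a"
  assumes lin: "linear T" and adj: "\<And>u v. inner (T u) v = inner u (T v)"
    and ann: "p \<noteq> 0" "\<And>u. poly_app p T u = 0"
  obtains \<Lambda> P where "finite \<Lambda>" "\<And>l. linear (P l)"
    "\<And>l u v. inner (P l u) v = inner u (P l v)"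
    "\<And>l u. l \<in> \<Lambda> \<Longrightarrow> T (P l u) = l *\<^sub>R P l u"
    "\<And>u. (\<Sum>l\<in>\<Lambda>. P l u) = u"
proof -
  obtain \<Lambda> where fin: "finite \<Lambda>" and zero: "\<And>u. poly_app (\<Prod>x\<in>\<Lambda>. [:- x, 1:]) T u = 0"
    using selfadjoint_minimal_poly[OF assms] by blast
  define e where "e l = Polynomial.smult (1 / (\<Prod>m\<in>\<Lambda> - {l}. l - m)) (\<Prod>m\<in>\<Lambda> - {l}. [:- m, 1:])" for l
  have eig: "T (poly_app (e l) T u) = l *\<^sub>R poly_app (e l) T u" if "l \<in> \<Lambda>" for l u
  proof -
    have "[:- l, 1:] * e l = Polynomial.smult (1 / (\<Prod>m\<in>\<Lambda> - {l}. l - m)) (\<Prod>x\<in>\<Lambda>. [:- x, 1:])"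
      unfolding e_def mult_smult_right prod.remove[OF fin that] by (rule refl)
    then have "poly_app ([:- l, 1:] * e l) T u = 0" by (simp only: poly_app_smult zero scaleR_zero_right)
    then have "poly_app [:- l, 1:] T (poly_app (e l) T u) = 0" by (simp only: poly_app_mult[OF lin])
    then show ?thesis by (simp add: poly_app_pCons[OF lin] linear_0[OF lin])
  qed
  have "(\<Sum>l\<in>\<Lambda>. poly_app (e l) T u) = u" for u
  proof (cases "\<Lambda> = {}")
    \<comment> \<open>The empty product 1 annihilates, so u is zero.\<close>
    case True
    then show ?thesis using zero[of u] by simp
  next
    case False
    then have "poly_app (\<Sum>l\<in>\<Lambda>. e l) T u = u" unfolding e_def sum_lagrange_basis[OF fin False] by simp
    then show ?thesis by (simp only: poly_app_sum)
  qed
  then show ?thesis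
    using that[of \<Lambda> "\<lambda>l. poly_app (e l) T"] fin eig linear_poly_app[OF lin] poly_app_adjoint[OF lin adj]
    by blast
qed

text \<open>The first \<open>card B + 1\<close> iterates of v lie in the span of B and are therefore
  dependent; the coefficients of a dependence are those of the polynomial.\<close>

lemma finite_rank_annihilating_poly_vector:
  fixes T :: "'a::real_vector \<Rightarrow> 'a"
  assumes "finite B" "\<And>u. T u \<in> span B" "v \<in> span B"
  shows "\<exists>p. p \<noteq> 0 \<and> poly_app p T v = 0"
proof -
  let ?f = "\<lambda>i. (T ^^ i) v" and ?N = "card B"
  have sp: "?f i \<in> span B" for i using assms(2,3) by (cases i) auto
  show ?thesis
  proof (cases "inj_on ?f {..?N}")
    \<comment> \<open>Coinciding iterates are treated apart: a dependence is indexed by vectors and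
      would not determine a coefficient for each exponent. The difference of two monomials does
      it.\<close>
    case False
    then obtain i j where ij: "i \<noteq> j" "?f i = ?f j" by (auto simp: inj_on_def)
    let ?p = "Polynomial.monom 1 i - Polynomial.monom (1::real) j"
    have m: "poly_app (Polynomial.monom 1 k) T v = ?f k" for k
    proof -
      have "poly_app (Polynomial.monom 1 k) T v = (\<Sum>i\<le>k. Polynomial.coeff (Polynomial.monom 1 k) i *\<^sub>R ?f i)"
        by (rule poly_app_le) (rule degree_monom_le)
      also have "\<dots> = (\<Sum>i\<le>k. (if k = i then ?f i else 0))"
        by (rule sum.cong) simp_all
      finally have "poly_app (Polynomial.monom 1 k) T v = (\<Sum>i\<le>k. (if k = i then ?f i else 0))" .
      then show ?thesis by simp
    qed
    have "Polynomial.coeff ?p i = 1" using ij by simp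
    then have "?p \<noteq> 0" by (metis coeff_0 zero_neq_one)
    moreover have "poly_app ?p T v = 0" using ij by (simp add: poly_app_diff m)
    ultimately show ?thesis by blast
  next
    case True
    then have "card (?f ` {..?N}) = Suc ?N" by (simp add: card_image)
    then have "dependent (?f ` {..?N})"
      using independent_span_bound[OF assms(1), of "?f ` {..?N}"] sp by fastforce
    then obtain c where c: "\<exists>w\<in>?f ` {..?N}. c w \<noteq> 0" "(\<Sum>w\<in>?f ` {..?N}. c w *\<^sub>R w) = 0"
      by (auto simp: dependent_finite)
    define p where "p = (\<Sum>i\<le>?N. Polynomial.monom (c (?f i)) i)"
    have cp: "Polynomial.coeff p i = (if i \<le> ?N then c (?f i) else 0)" for i
      by (simp add: p_def coeff_sum)
    have "poly_app p T v = (\<Sum>i\<le>?N. c (?f i) *\<^sub>R ?f i)"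
      by (subst poly_app_le[of _ ?N]) (auto simp: cp intro!: degree_le)
    also have "\<dots> = 0" using c(2) by (simp add: sum.reindex[OF True])
    finally have "poly_app p T v = 0" .
    moreover have "p \<noteq> 0"
    proof
      assume "p = 0"
      then have "c (?f i) = 0" if "i \<le> ?N" for i using cp[of i] that by simp
      then show False using c(1) by auto
    qed
    ultimately show ?thesis by blast
  qed
qed

text \<open>The product of annihilators of the members of B kills \<open>span B\<close>. The extra
  factor X first moves an arbitrary vector into \<open>span B\<close>, which covers an operator of
  finite rank on an infinite-dimensional space.\<close>

lemma finite_rank_annihilating_poly:
  fixes T :: "'a::real_vector \<Rightarrow> 'a"
  assumes lin: "linear T" and B: "finite B" "\<And>u. T u \<in> span B"
  obtains p where "p \<noteq> 0" "\<And>u. poly_app p T u = 0"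
proof -
  have "\<forall>v\<in>B. \<exists>p. p \<noteq> 0 \<and> poly_app p T v = 0"
    by (intro ballI finite_rank_annihilating_poly_vector[OF B] span_base)
  then obtain q where q: "\<And>v. v \<in> B \<Longrightarrow> q v \<noteq> 0" "\<And>v. v \<in> B \<Longrightarrow> poly_app (q v) T v = 0"
    by metis
  define r where "r = (\<Prod>v\<in>B. q v)"
  have "poly_app r T v = 0" if "v \<in> B" for v
  proof -
    have "r = (\<Prod>v\<in>B - {v}. q v) * q v" by (simp only: r_def prod.remove[OF B(1) that] mult.commute)
    then show ?thesis using q(2)[OF that] linear_0[OF linear_poly_app[OF lin]] by (simp add: poly_app_mult[OF lin])
  qed
  then have "poly_app r T w = 0" if "w \<in> span B" for w
    using linear_eq_0_on_span[OF linear_poly_app[OF lin], of B r w] that by blast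
  then have "poly_app (r * [:0, 1:]) T u = 0" for u
  proof -
    have "poly_app [:0, 1:] T u = T u" by (simp add: poly_app_pCons[OF lin] linear_0[OF lin])
    then show ?thesis using B(2) \<open>\<And>w. w \<in> span B \<Longrightarrow> poly_app r T w = 0\<close> by (simp only: poly_app_mult[OF lin])
  qed
  moreover have "r * [:0, 1:] \<noteq> 0" using q B by (simp add: r_def)
  ultimately show ?thesis using that by blast
qed

section \<open>The accelerated gossip matrix\<close>

lemma chebyshev_T_cos: "poly (chebyshev_T k) (cos t) = cos (real k * t)"
proof (induction k rule: chebyshev_T.induct)
  case (3 k)
  have "cos (real (Suc (Suc k)) * t) = cos (real (Suc k) * t + t)"
    "cos (real k * t) = cos (real (Suc k) * t - t)"
    by (simp_all add: algebra_simps)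
  then have "cos (real (Suc (Suc k)) * t) + cos (real k * t) = 2 * cos t * cos (real (Suc k) * t)"
    unfolding cos_add cos_diff by simp
  with 3 show ?case by simp
qed simp_all

lemma chebyshev_T_abs_le_1:
  assumes "\<bar>x\<bar> \<le> 1"
  shows "\<bar>poly (chebyshev_T k) x\<bar> \<le> 1"
proof -
  have "poly (chebyshev_T k) x = cos (real k * arccos x)"
    using assms chebyshev_T_cos[of k "arccos x"] by (simp add: cos_arccos_abs)
  then show ?thesis by (simp add: abs_le_iff)
qed

text \<open>The left-hand side is the tangent of the Chebyshev polynomial at 1.\<close>
lemma chebyshev_T_ge:
  assumes "1 \<le> x"
  shows "1 + (real k)\<^sup>2 * (x - 1) \<le> poly (chebyshev_T k) x"
proof -
  let ?T = "\<lambda>k. poly (chebyshev_T k) x"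
  \<comment> \<open>The bound on the increments is carried along: by the recurrence the increment
    grows by 2 (x - 1) T(k+1) with T(k+1) \<ge> 1, and the odd numbers 2k + 1 add up to
    squares.\<close>
  have "1 + (real k)\<^sup>2 * (x - 1) \<le> ?T k \<and> (2 * real k + 1) * (x - 1) \<le> ?T (Suc k) - ?T k"
  proof (induction k)
    case (Suc k)
    have s: "?T (Suc (Suc k)) - ?T (Suc k) = (?T (Suc k) - ?T k) + 2 * (x - 1) * ?T (Suc k)"
      by (simp add: algebra_simps)
    have T: "1 + (real (Suc k))\<^sup>2 * (x - 1) \<le> ?T (Suc k)"
      using Suc by (simp add: algebra_simps power2_eq_square)
    then have "1 \<le> ?T (Suc k)"
      using assms by (smt (verit) mult_nonneg_nonneg zero_le_power2)
    then have "2 * (x - 1) \<le> 2 * (x - 1) * ?T (Suc k)"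
      using assms by (simp add: mult_le_cancel_left1)
    then show ?case using s T Suc by (simp add: algebra_simps)
  qed (use assms in simp)
  then show ?thesis by blast
qed

section \<open>Matrices acting on lifted points\<close>

text \<open>The tensor product of C and I_d on the M by d block, composed with truncation to the
  block. The truncation makes it an operator of finite rank on the whole space, self-adjoint when C
  is symmetric.\<close>

definition mat_op :: "nat \<Rightarrow> nat \<Rightarrow> real mat \<Rightarrow> fin_fun \<Rightarrow> fin_fun" where
  "mat_op M d C u = Abs_fin_fun (\<lambda>(i, j). if i < M \<and> j < d then \<Sum>k<M. C $$ (i, k) * fcoord u (k, j) else 0)"

definition supported :: "nat \<Rightarrow> nat \<Rightarrow> fin_fun \<Rightarrow> bool" where
  "supported M d u \<longleftrightarrow> (\<forall>i j. \<not> (i < M \<and> j < d) \<longrightarrow> fcoord u (i, j) = 0)"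

lemma fcoord_mat_op:
  "fcoord (mat_op M d C u) (i, j) = (if i < M \<and> j < d then \<Sum>k<M. C $$ (i, k) * fcoord u (k, j) else 0)"
proof -
  have "finite {a. (case a of (i, j) \<Rightarrow> if i < M \<and> j < d then \<Sum>k<M. C $$ (i, k) * fcoord u (k, j) else 0) \<noteq> 0}"
    by (rule finite_subset[of _ "{..<M} \<times> {..<d}"]) (auto split: if_splits)
  then show ?thesis unfolding mat_op_def by (subst Abs_fin_fun_inverse) auto
qed

lemma supported_mat_op: "supported M d (mat_op M d C u)"
  by (auto simp: supported_def fcoord_mat_op)

lemma supported_emb: "Z \<in> carrier_mat M d \<Longrightarrow> supported M d (emb Z)"
  by (auto simp: supported_def fcoord_emb)

lemma linear_mat_op: "linear (mat_op M d C)"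
proof (rule linearI)
  fix u v and r :: real
  show "mat_op M d C (u + v) = mat_op M d C u + mat_op M d C v"
    by (rule fin_fun_eqI, rename_tac a, case_tac a) (auto simp: fcoord_mat_op algebra_simps sum.distrib)
  show "mat_op M d C (r *\<^sub>R u) = r *\<^sub>R mat_op M d C u"
    by (rule fin_fun_eqI, rename_tac a, case_tac a) (auto simp: fcoord_mat_op algebra_simps sum_distrib_left)
qed

lemma emb_mult:
  assumes "C \<in> carrier_mat M M" "Z \<in> carrier_mat M d"
  shows "emb (C * Z) = mat_op M d C (emb Z)"
  by (rule fin_fun_eqI, rename_tac a, case_tac a)
    (use assms in \<open>auto simp: fcoord_mat_op fcoord_emb scalar_prod_def lessThan_atLeast0 intro!: sum.cong\<close>)

lemma inner_supported:
  assumes "supported M d u"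
  shows "inner u v = (\<Sum>j<d. \<Sum>i<M. fcoord u (i, j) * fcoord v (i, j))"
proof -
  have "inner u v = (\<Sum>a\<in>{..<M} \<times> {..<d}. fcoord u a * fcoord v a)"
    by (rule inner_fin_fun_superset) (use assms in \<open>auto simp: supported_def\<close>)
  also have "\<dots> = (\<Sum>i<M. \<Sum>j<d. fcoord u (i, j) * fcoord v (i, j))"
    by (simp only: sum.cartesian_product) (simp add: case_prod_beta)
  also have "\<dots> = (\<Sum>j<d. \<Sum>i<M. fcoord u (i, j) * fcoord v (i, j))" by (rule sum.swap)
  finally show ?thesis .
qed

lemma mat_op_adjoint:
  assumes "C \<in> carrier_mat M M" "transpose_mat C = C"
  shows "inner (mat_op M d C u) v = inner u (mat_op M d C v)"
proof -
  have sym: "C $$ (i, k) = C $$ (k, i)" if "i < M" "k < M" for i k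
    using assms that by (metis carrier_matD index_transpose_mat(1))
  have "inner (mat_op M d C u) v = (\<Sum>j<d. \<Sum>i<M. \<Sum>k<M. C $$ (i, k) * fcoord u (k, j) * fcoord v (i, j))"
    by (simp add: inner_supported[OF supported_mat_op] fcoord_mat_op sum_distrib_right)
  also have "\<dots> = (\<Sum>j<d. \<Sum>k<M. \<Sum>i<M. C $$ (k, i) * fcoord v (i, j) * fcoord u (k, j))"
    by (subst sum.swap) (auto intro!: sum.cong simp: sym)
  also have "\<dots> = inner (mat_op M d C v) u"
    by (simp add: inner_supported[OF supported_mat_op] fcoord_mat_op sum_distrib_right)
  finally show ?thesis by (simp add: inner_commute)
qed

lemma mat_op_mult:
  assumes "A \<in> carrier_mat M M" "B \<in> carrier_mat M M"
  shows "mat_op M d (A * B) u = mat_op M d A (mat_op M d B u)"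
proof (rule fin_fun_eqI)
  fix a :: "nat \<times> nat"
  obtain i j where a: "a = (i, j)" by (cases a)
  have "(\<Sum>k<M. (A * B) $$ (i, k) * fcoord u (k, j)) = (\<Sum>l<M. A $$ (i, l) * (\<Sum>k<M. B $$ (l, k) * fcoord u (k, j)))"
    if "i < M"
  proof -
    have "(\<Sum>k<M. (A * B) $$ (i, k) * fcoord u (k, j)) = (\<Sum>k<M. \<Sum>l<M. A $$ (i, l) * B $$ (l, k) * fcoord u (k, j))"
      using assms that
      by (intro sum.cong refl) (simp add: scalar_prod_def lessThan_atLeast0 sum_distrib_right)
    also have "\<dots> = (\<Sum>l<M. \<Sum>k<M. A $$ (i, l) * B $$ (l, k) * fcoord u (k, j))" by (rule sum.swap)
    finally show ?thesis by (simp add: sum_distrib_left mult.assoc)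
  qed
  then show "fcoord (mat_op M d (A * B) u) a = fcoord (mat_op M d A (mat_op M d B u)) a"
    by (simp add: a fcoord_mat_op)
qed

text \<open>The support condition matters for exponent 0: there the identity matrix acts as
  truncation to the block, the empty iterate as the identity.\<close>

lemma mat_op_pow:
  assumes "C \<in> carrier_mat M M" "supported M d u"
  shows "mat_op M d (C ^\<^sub>m i) u = (mat_op M d C ^^ i) u"
  using assms(2)
proof (induction i arbitrary: u)
  case 0
  show ?case
  proof (rule fin_fun_eqI)
    fix a :: "nat \<times> nat"
    obtain i j where a: "a = (i, j)" by (cases a)
    have "(\<Sum>k<M. 1\<^sub>m M $$ (i, k) * fcoord u (k, j)) = (\<Sum>k<M. if i = k then fcoord u (k, j) else 0)" if "i < M"
      using that by (intro sum.cong) auto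
    then show "fcoord (mat_op M d (C ^\<^sub>m 0) u) a = fcoord ((mat_op M d C ^^ 0) u) a"
      using 0 assms(1) by (auto simp: a fcoord_mat_op supported_def)
  qed
next
  case (Suc i)
  then show ?case
    using assms(1) by (simp add: mat_op_mult[of _ M] funpow_swap1 supported_mat_op del: funpow.simps(2))
      (simp add: funpow_Suc_right del: funpow.simps(2))
qed

text \<open>Without a constant term every summand contains a factor \<open>mat_op M d C\<close>,
  whose image is supported. This extends the formula to all vectors, and the gossip polynomial is of
  this kind.\<close>

lemma mat_op_mat_poly:
  assumes C: "C \<in> carrier_mat M M" and "supported M d u \<or> Polynomial.coeff q 0 = 0"
  shows "mat_op M d (mat_poly q C) u = poly_app q (mat_op M d C) u"
proof -
  have "mat_op M d (mat_poly q C) u = (\<Sum>i\<le>degree q. Polynomial.coeff q i *\<^sub>R mat_op M d (C ^\<^sub>m i) u)"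
  proof (rule fin_fun_eqI)
    fix a :: "nat \<times> nat"
    obtain i j where a: "a = (i, j)" by (cases a)
    have "(\<Sum>k<M. mat_poly q C $$ (i, k) * fcoord u (k, j))
        = (\<Sum>k<M. \<Sum>l\<le>degree q. Polynomial.coeff q l * (C ^\<^sub>m l) $$ (i, k) * fcoord u (k, j))" if "i < M"
      using C that pow_carrier_mat[OF C]
      by (intro sum.cong refl) (auto simp: mat_poly_def mat_sum_def sum_distrib_right)
    also have "(\<Sum>k<M. \<Sum>l\<le>degree q. Polynomial.coeff q l * (C ^\<^sub>m l) $$ (i, k) * fcoord u (k, j))
      = (\<Sum>l\<le>degree q. \<Sum>k<M. Polynomial.coeff q l * (C ^\<^sub>m l) $$ (i, k) * fcoord u (k, j))"
      by (rule sum.swap)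
    finally show "fcoord (mat_op M d (mat_poly q C) u) a
        = fcoord (\<Sum>i\<le>degree q. Polynomial.coeff q i *\<^sub>R mat_op M d (C ^\<^sub>m i) u) a"
      by (auto simp: a fcoord_mat_op sum_distrib_left mult.assoc)
  qed
  also have "\<dots> = poly_app q (mat_op M d C) u"
    unfolding poly_app_def
  proof (rule sum.cong)
    fix i
    show "Polynomial.coeff q i *\<^sub>R mat_op M d (C ^\<^sub>m i) u = Polynomial.coeff q i *\<^sub>R (mat_op M d C ^^ i) u"
    proof (cases "supported M d u")
      case False
      then have q0: "Polynomial.coeff q 0 = 0" using assms by simp
      show ?thesis
      proof (cases i)
        case (Suc l)
        have "mat_op M d (C ^\<^sub>m i) u = mat_op M d (C ^\<^sub>m l) (mat_op M d C u)"
          using C by (simp add: Suc mat_op_mult[of _ M])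
        also have "\<dots> = (mat_op M d C ^^ i) u"
          by (simp add: mat_op_pow[OF C supported_mat_op] Suc funpow_Suc_right del: funpow.simps(2))
        finally show ?thesis by simp
      qed (simp add: q0)
    qed (simp add: mat_op_pow[OF C])
  qed simp
  finally show ?thesis .
qed

definition unit_fun :: "nat \<times> nat \<Rightarrow> fin_fun" where
  "unit_fun a = Abs_fin_fun (\<lambda>x. if x = a then 1 else 0)"

lemma fcoord_unit_fun: "fcoord (unit_fun a) x = (if x = a then 1 else 0)"
  unfolding unit_fun_def by (subst Abs_fin_fun_inverse) auto

lemma supported_in_span:
  assumes "supported M d u"
  shows "u \<in> span (unit_fun ` ({..<M} \<times> {..<d}))"
proof -
  have "u = (\<Sum>a\<in>{..<M} \<times> {..<d}. fcoord u a *\<^sub>R unit_fun a)"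
  proof (rule fin_fun_eqI)
    fix x
    have "fcoord (\<Sum>a\<in>{..<M} \<times> {..<d}. fcoord u a *\<^sub>R unit_fun a) x
        = (\<Sum>a\<in>{..<M} \<times> {..<d}. if x = a then fcoord u a else 0)"
      unfolding fcoord_sum by (intro sum.cong) (auto simp: fcoord_unit_fun)
    then show "fcoord u x = fcoord (\<Sum>a\<in>{..<M} \<times> {..<d}. fcoord u a *\<^sub>R unit_fun a) x"
      using assms by (cases x) (auto simp: supported_def)
  qed
  also have "\<dots> \<in> span (unit_fun ` ({..<M} \<times> {..<d}))"
    by (intro span_sum span_scale span_base) auto
  finally show ?thesis .
qed

section \<open>Eigenvalues and spectral projections of a symmetric matrix\<close>

lemma eigenvalue_imp_mat_op:
  assumes "C \<in> carrier_mat M M" "eigenvalue C l" "0 < d"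
  obtains u where "u \<noteq> 0" "supported M d u" "mat_op M d C u = l *\<^sub>R u"
proof -
  obtain v where v: "v \<in> carrier_vec M" "v \<noteq> 0\<^sub>v M" "C *\<^sub>v v = l \<cdot>\<^sub>v v"
    using assms by (auto simp: eigenvalue_def eigenvector_def)
  \<comment> \<open>The eigenvector is placed in column 0, which exists because d is
    positive.\<close>
  define Z where "Z = mat M d (\<lambda>(i, j). if j = 0 then v $ i else 0)"
  have Z: "Z \<in> carrier_mat M d" by (simp add: Z_def)
  have row: "(\<Sum>k<M. C $$ (i, k) * v $ k) = l * v $ i" if "i < M" for i
  proof -
    have "(C *\<^sub>v v) $ i = (\<Sum>k<M. C $$ (i, k) * v $ k)"
      using assms(1) v(1) that by (simp add: scalar_prod_def lessThan_atLeast0)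
    then show ?thesis using v that by simp
  qed
  have f: "fcoord (emb Z) (i, j) = (if i < M \<and> j = 0 then v $ i else 0)" for i j
    using assms(3) by (simp add: fcoord_emb Z_def)
  have "emb Z \<noteq> 0"
  proof
    assume "emb Z = 0"
    then have "fcoord (emb Z) (i, 0) = 0" for i by simp
    then have "v $ i = 0" if "i < M" for i using f[of i 0] that by (metis)
    then show False using v by (auto intro: eq_vecI)
  qed
  moreover have "mat_op M d C (emb Z) = l *\<^sub>R emb Z"
    by (rule fin_fun_eqI, rename_tac a, case_tac a) (use assms(3) in \<open>auto simp: fcoord_mat_op f row\<close>)
  ultimately show ?thesis using that supported_emb[OF Z] by blast
qed

text \<open>\<open>mat_op\<close> acts on each column separately, so any nonzero column of u is an
  eigenvector of C.\<close>

lemma mat_op_imp_eigenvalue: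
  assumes "C \<in> carrier_mat M M" "u \<noteq> 0" "supported M d u" "mat_op M d C u = l *\<^sub>R u"
  shows "eigenvalue C l"
proof -
  obtain i j where ij: "fcoord u (i, j) \<noteq> 0"
    using assms(2) by (metis fcoord_simps(1) fin_fun_eqI surj_pair)
  then have ij': "i < M" "j < d" using assms(3) by (auto simp: supported_def)
  define v where "v = vec M (\<lambda>i. fcoord u (i, j))"
  have "C *\<^sub>v v = l \<cdot>\<^sub>v v"
  proof (rule eq_vecI)
    fix k assume k: "k < dim_vec (l \<cdot>\<^sub>v v)"
    have "(C *\<^sub>v v) $ k = (\<Sum>i<M. C $$ (k, i) * fcoord u (i, j))"
      using k assms(1) by (simp add: v_def scalar_prod_def lessThan_atLeast0)
    also have "\<dots> = fcoord (mat_op M d C u) (k, j)"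
      using k ij' by (simp add: fcoord_mat_op v_def)
    also have "\<dots> = (l \<cdot>\<^sub>v v) $ k" using k by (simp add: assms(4) v_def)
    finally show "(C *\<^sub>v v) $ k = (l \<cdot>\<^sub>v v) $ k" .
  qed (use assms in \<open>simp add: v_def\<close>)
  moreover have "v \<noteq> 0\<^sub>v M"
  proof
    assume "v = 0\<^sub>v M"
    then have "v $ i = 0" using ij' by simp
    then show False using ij ij' by (simp add: v_def)
  qed
  ultimately show ?thesis
    using assms(1) unfolding eigenvalue_def eigenvector_def by (auto simp: v_def[symmetric] intro!: exI[of _ v]) (simp add: v_def)
qed

lemma finite_eigenvalues:
  fixes C :: "real mat"
  assumes "C \<in> carrier_mat M M"
  shows "finite {l. eigenvalue C l}"
proof -
  have "char_poly C \<noteq> 0" using degree_monic_char_poly[OF assms] by auto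
  then show ?thesis using poly_roots_finite by (simp add: eigenvalue_root_char_poly[OF assms])
qed

text \<open>\<open>P l\<close> is the orthogonal projection onto the eigenspace of \<open>l\<close>.\<close>
locale spectral_mat =
  fixes M d :: nat and W :: "real mat" and \<Lambda> :: "real set" and P :: "real \<Rightarrow> fin_fun \<Rightarrow> fin_fun"
  assumes d: "0 < d" and W: "W \<in> carrier_mat M M" "transpose_mat W = W"
    and fin: "finite \<Lambda>" and lin: "\<And>l. linear (P l)"
    and adj: "\<And>l u v. inner (P l u) v = inner u (P l v)"
    and eig: "\<And>l u. l \<in> \<Lambda> \<Longrightarrow> mat_op M d W (P l u) = l *\<^sub>R P l u"
    and res: "\<And>u. (\<Sum>l\<in>\<Lambda>. P l u) = u"
begin

text \<open>Self-adjointness makes eigenspaces of different values orthogonal, which gives the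
  vanishing products; idempotence follows by applying the resolution of the identity to
  \<open>P l u\<close>.\<close>

lemma proj_proj:
  assumes "l \<in> \<Lambda>" "m \<in> \<Lambda>"
  shows "P l (P m u) = (if l = m then P l u else 0)"
proof -
  have 0: "P l (P m u) = 0" if "l \<noteq> m" "l \<in> \<Lambda>" "m \<in> \<Lambda>" for l m u
  proof -
    let ?w = "P l (P m u)"
    have "l * inner (P m u) (P l ?w) = inner (P m u) (mat_op M d W (P l ?w))"
      using that by (simp add: eig)
    also have "\<dots> = inner (mat_op M d W (P m u)) (P l ?w)" by (simp add: mat_op_adjoint[OF W])
    also have "\<dots> = m * inner (P m u) (P l ?w)" using that by (simp add: eig)
    finally have "inner (P m u) (P l ?w) = 0" using that by simp
    then have "inner ?w ?w = 0" by (simp only: adj[of l "P m u" ?w])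
    then show ?thesis by simp
  qed
  show ?thesis
  proof (cases "l = m")
    case True
    have "P l u = (\<Sum>m\<in>\<Lambda>. P m (P l u))" by (simp add: res)
    also have "\<dots> = (\<Sum>m\<in>\<Lambda>. if l = m then P m (P l u) else 0)"
      by (intro sum.cong) (auto intro: 0 assms)
    finally show ?thesis using True assms fin by simp
  qed (use 0 assms in auto)
qed

lemma proj_sum:
  assumes "S \<subseteq> \<Lambda>" "l \<in> \<Lambda>"
  shows "P l (\<Sum>m\<in>S. c m *\<^sub>R P m u) = (if l \<in> S then c l *\<^sub>R P l u else 0)"
proof -
  have fS: "finite S" using assms(1) fin by (rule finite_subset)
  have "P l (\<Sum>m\<in>S. c m *\<^sub>R P m u) = (\<Sum>m\<in>S. if l = m then c m *\<^sub>R P m u else 0)"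
    unfolding linear_sum[OF lin] linear_scale[OF lin]
    by (intro sum.cong) (use assms in \<open>auto simp: proj_proj subset_iff\<close>)
  then show ?thesis using fS by simp
qed

lemma poly_app_spectral: "poly_app q (mat_op M d W) u = (\<Sum>l\<in>\<Lambda>. poly q l *\<^sub>R P l u)"
proof -
  have "poly_app q (mat_op M d W) (\<Sum>l\<in>\<Lambda>. P l u) = (\<Sum>l\<in>\<Lambda>. poly q l *\<^sub>R P l u)"
    unfolding linear_sum[OF linear_poly_app[OF linear_mat_op]]
    by (intro sum.cong refl poly_app_eigenvector linear_mat_op eig)
  then show ?thesis by (simp add: res)
qed

text \<open>For l \<noteq> 0 the vector \<open>P l u\<close> is a multiple of an image under
  \<open>mat_op\<close>, hence lies in the block. The value 0 is excluded because the kernel of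
  \<open>mat_op\<close> contains everything outside the block, whatever the spectrum of W.\<close>

lemma eigenvalue_of_proj:
  assumes "l \<in> \<Lambda>" "l \<noteq> 0" "P l u \<noteq> 0"
  shows "eigenvalue W l"
proof -
  have "P l u = (1 / l) *\<^sub>R mat_op M d W (P l u)" using assms eig[of l u] by simp
  then have "supported M d (P l u)"
    using supported_mat_op[of M d W "P l u"] by (metis (no_types, lifting) fcoord_simps(5) mult_zero_right supported_def)
  then show ?thesis using mat_op_imp_eigenvalue W assms eig by blast
qed

text \<open>Spectral mapping. The assumption supplies the one value, 0, for which a nonzero
  projection does not witness an eigenvalue of W; gossip matrices satisfy it through the all-ones
  vector.\<close>

lemma eigenvalue_mat_poly:
  assumes "eigenvalue W 0"
  shows "{r. eigenvalue (mat_poly q W) r} = poly q ` {l. eigenvalue W l}"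
proof (intro equalityI subsetI)
  have Q: "mat_poly q W \<in> carrier_mat M M" using W by (simp add: mat_poly_def mat_sum_def)
  fix r
  {
    assume "r \<in> {r. eigenvalue (mat_poly q W) r}"
    then obtain u where u: "u \<noteq> 0" "supported M d u" "mat_op M d (mat_poly q W) u = r *\<^sub>R u"
      using eigenvalue_imp_mat_op[OF Q _ d] by blast
    obtain l where l: "l \<in> \<Lambda>" "P l u \<noteq> 0" using u(1) res[of u] by (metis sum.neutral)
    have "r *\<^sub>R u = (\<Sum>l\<in>\<Lambda>. poly q l *\<^sub>R P l u)"
      using u mat_op_mat_poly[OF W(1), of d u q] by (simp add: poly_app_spectral)
    then have "P l (r *\<^sub>R u) = poly q l *\<^sub>R P l u" using l by (simp add: proj_sum)
    then have "r *\<^sub>R P l u = poly q l *\<^sub>R P l u" by (simp add: linear_scale[OF lin])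
    then have "r = poly q l" using l by simp
    then show "r \<in> poly q ` {l. eigenvalue W l}"
      using eigenvalue_of_proj[OF l(1) _ l(2)] assms by (cases "l = 0") auto
  next
    assume "r \<in> poly q ` {l. eigenvalue W l}"
    then obtain l where l: "eigenvalue W l" "r = poly q l" by auto
    then obtain u where u: "u \<noteq> 0" "supported M d u" "mat_op M d W u = l *\<^sub>R u"
      using eigenvalue_imp_mat_op[OF W(1) _ d] by blast
    then have "mat_op M d (mat_poly q W) u = r *\<^sub>R u"
      using mat_op_mat_poly[OF W(1), of d u q] poly_app_eigenvector[OF linear_mat_op u(3)] l by simp
    then show "r \<in> {r. eigenvalue (mat_poly q W) r}"
      using mat_op_imp_eigenvalue[OF Q u(1,2)] by simp
  }
qed

end

lemma spectral_mat_exists: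
  assumes "0 < d" "W \<in> carrier_mat M M" "transpose_mat W = W"
  obtains \<Lambda> P where "spectral_mat M d W \<Lambda> P"
proof -
  obtain p where p: "p \<noteq> 0" "\<And>u. poly_app p (mat_op M d W) u = 0"
    by (rule finite_rank_annihilating_poly[OF linear_mat_op, of "unit_fun ` ({..<M} \<times> {..<d})" M d W])
      (auto intro: supported_in_span supported_mat_op)
  obtain \<Lambda> P where R: "finite \<Lambda>" "\<And>l. linear (P l)"
    "\<And>l u v. inner (P l u) v = inner u (P l v)"
    "\<And>l u. l \<in> \<Lambda> \<Longrightarrow> mat_op M d W (P l u) = l *\<^sub>R P l u"
    "\<And>u. (\<Sum>l\<in>\<Lambda>. P l u) = u"
    using selfadjoint_spectral_resolution[OF linear_mat_op mat_op_adjoint[OF assms(2,3)] p] by metis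
  show ?thesis by (rule that[of \<Lambda> P], rule spectral_mat.intro) (fact assms R)+
qed

section \<open>Spectrum of the Chebyshev polynomial of a gossip matrix\<close>

text \<open>The affine map c2 (1 - c3 l) in l sends [l0, 1] onto [-1, 1] and 0 to c2 = 1 + 2 / (x -
  1), where x is the condition number. By the tangent bound at 1 and K^2 \<ge> x / 4, the value at
  c2 is at least 1 + x / (2 (x - 1)) > 3/2.\<close>

lemma chebyshev_tail_bounds:
  fixes l0 :: real
  assumes l0: "0 < l0" "l0 < 1" and l: "l0 \<le> l" "l \<le> 1"
  defines "x \<equiv> 1 / l0"
  defines "c2 \<equiv> (x + 1) / (x - 1)" and "c3 \<equiv> 2 / (1 + l0)" and "T \<equiv> chebyshev_T (nat \<lfloor>sqrt x\<rfloor>)"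
  shows "3 / 2 \<le> poly T c2" "\<bar>poly T (c2 * (1 - c3 * l))\<bar> \<le> 1"
proof -
  have x: "1 < x" using l0 by (simp add: x_def)
  define K where "K = nat \<lfloor>sqrt x\<rfloor>"
  have "1 \<le> sqrt x" using x by simp
  then have "1 \<le> real K" by (simp add: K_def le_nat_floor)
  moreover have "sqrt x \<le> real K + 1" unfolding K_def using x by linarith
  \<comment> \<open>As K \<ge> 1, rounding down loses at most a factor 2.\<close>
  ultimately have "sqrt x \<le> 2 * real K" by linarith
  then have "(sqrt x)\<^sup>2 \<le> (2 * real K)\<^sup>2" using x by (intro power_mono) auto
  then have K: "x / 4 \<le> (real K)\<^sup>2" using x by (simp add: power_mult_distrib)
  have c2: "c2 - 1 = 2 / (x - 1)" using x by (simp add: c2_def field_simps)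
  have "1 / 2 \<le> (x / 4) * (2 / (x - 1))" using x by (simp add: field_simps)
  moreover have "(x / 4) * (2 / (x - 1)) \<le> (real K)\<^sup>2 * (2 / (x - 1))"
    using K x by (intro mult_right_mono) auto
  moreover have "1 + (real K)\<^sup>2 * (c2 - 1) \<le> poly T c2"
  proof -
    have "0 \<le> c2 - 1" unfolding c2 using x by simp
    then show ?thesis unfolding T_def K_def[symmetric] by (intro chebyshev_T_ge) simp
  qed
  ultimately show "3 / 2 \<le> poly T c2" unfolding c2 by linarith
  have "c2 = ((1 + l0) / l0) / ((1 - l0) / l0)"
    using l0 by (simp add: c2_def x_def add_divide_distrib diff_divide_distrib)
  then have c2': "c2 = (1 + l0) / (1 - l0)" using l0 by simp
  have "(1 + l0) * (1 - c3 * l) = 1 + l0 - 2 * l"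
    unfolding c3_def right_diff_distrib using l0 by simp
  then have "c2 * (1 - c3 * l) = (1 + l0 - 2 * l) / (1 - l0)"
    unfolding c2' by (simp only: times_divide_eq_left)
  moreover have "\<bar>1 + l0 - 2 * l\<bar> \<le> 1 - l0" using l by linarith
  ultimately have "\<bar>c2 * (1 - c3 * l)\<bar> \<le> 1" using l0 by (simp add: abs_divide divide_le_eq_1)
  then show "\<bar>poly T (c2 * (1 - c3 * l))\<bar> \<le> 1" unfolding T_def by (rule chebyshev_T_abs_le_1)
qed

lemma gossip_eigenvalues:
  assumes W: "gossip_matrix M E W" and M: "0 < M"
  defines "S \<equiv> {l. eigenvalue W l}"
  shows "finite S" "0 \<in> S" "\<And>l. l \<in> S \<Longrightarrow> 0 \<le> l" "\<And>l. l \<in> S \<Longrightarrow> l \<le> 1" "1 \<in> S"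
proof -
  have C: "W \<in> carrier_mat M M" and psd: "\<And>v. v \<in> carrier_vec M \<Longrightarrow> 0 \<le> v \<bullet> (W *\<^sub>v v)"
    and ker: "mat_kernel W = range (\<lambda>c. c \<cdot>\<^sub>v vec M (\<lambda>_. 1))" and max: "lam_max W = 1"
    using W by (auto simp: gossip_matrix_def)
  show fin: "finite S" unfolding S_def by (rule finite_eigenvalues[OF C])
  let ?one = "vec M (\<lambda>_. 1 :: real)"
  have "1 \<cdot>\<^sub>v ?one \<in> mat_kernel W" unfolding ker by blast
  then have "W *\<^sub>v ?one = 0\<^sub>v M" using C by (auto simp: mat_kernel_def)
  moreover have "?one \<noteq> 0\<^sub>v M"
  proof
    assume "?one = 0\<^sub>v M"
    then have "?one $ 0 = 0\<^sub>v M $ 0" by simp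
    then show False using M by simp
  qed
  ultimately show zero: "0 \<in> S"
    using C unfolding S_def eigenvalue_def eigenvector_def by (auto intro!: exI[of _ ?one])
  show "1 \<in> S" using Max_in[OF fin] zero max by (auto simp: S_def lam_max_def)
  show "l \<le> 1" if "l \<in> S" for l
    using Max_ge[OF fin that] max by (simp add: S_def lam_max_def)
  show "0 \<le> l" if lS: "l \<in> S" for l
  proof -
    obtain v where v: "v \<in> carrier_vec M" "v \<noteq> 0\<^sub>v M" "W *\<^sub>v v = l \<cdot>\<^sub>v v"
      using lS C by (auto simp: S_def eigenvalue_def eigenvector_def)
    have nz: "remb 0 v \<noteq> 0"
    proof
      assume "remb 0 v = 0"
      have "fcoord (remb 0 v) (0, i) = v $ i" if "i < M" for i using v(1) that by (simp add: fcoord_remb)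
      then have "v $ i = 0" if "i < M" for i using that \<open>remb 0 v = 0\<close> by simp
      then show False using v by (auto intro: eq_vecI)
    qed
    have "v \<bullet> v = inner (remb 0 v) (remb 0 v)" using v by (simp add: inner_remb)
    then have "0 < v \<bullet> v" using nz by simp
    moreover have "0 \<le> l * (v \<bullet> v)" using psd[OF v(1)] v by simp
    ultimately show ?thesis by (simp add: zero_le_mult_iff)
  qed
qed

text \<open>On positive eigenvalues the Chebyshev quotient is at most 1 / (3/2) = 2/3 in absolute
  value, so the unscaled polynomial lies between 1/3 and 5/3; rescaling preserves the ratio. Without
  acceleration the spectrum is {0, 1}.\<close>

lemma gossip_poly_bounds:
  assumes W: "gossip_matrix M E W" and M: "0 < M"
  defines "S \<equiv> {l. eigenvalue W l}" and "q \<equiv> gossip_poly W"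
  shows "poly q 0 = 0" "\<And>l. l \<in> S \<Longrightarrow> 0 < l \<Longrightarrow> 0 < poly q l"
    "\<And>l m. l \<in> S \<Longrightarrow> m \<in> S \<Longrightarrow> 0 < l \<Longrightarrow> poly q m \<le> 5 * poly q l" "Max (poly q ` S) = 1"
proof -
  note S = gossip_eigenvalues[OF W M, folded S_def]
  have C: "W \<in> carrier_mat M M" "transpose_mat W = W" and max: "lam_max W = 1"
    using W by (auto simp: gossip_matrix_def)
  define l0 where "l0 = lam_min_pos W"
  have pos: "finite {l \<in> S. 0 < l}" "{l \<in> S. 0 < l} \<noteq> {}" using S(1,5) by (auto intro!: exI[of _ 1])
  have l0: "l0 = Min {l \<in> S. 0 < l}" by (simp add: l0_def lam_min_pos_def S_def)
  have l0S: "l0 \<in> S" "0 < l0" using Min_in[OF pos] unfolding l0 by auto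
  have l0le: "l0 \<le> l" if "l \<in> S" "0 < l" for l
    unfolding l0 using that by (intro Min_le[OF pos(1)]) simp
  have cond: "cond_number W = 1 / l0" by (simp add: cond_number_def max l0_def)
  \<comment> \<open>Only the spectrum of W is at stake, so one column, d = 1, suffices.\<close>
  obtain \<Lambda> P where "spectral_mat M 1 W \<Lambda> P" by (rule spectral_mat_exists[OF _ C, of 1]) auto
  then interpret spectral_mat M 1 W \<Lambda> P .
  have "poly q 0 = 0 \<and> (\<forall>l\<in>S. 0 < l \<longrightarrow> 0 < poly q l)
    \<and> (\<forall>l\<in>S. \<forall>m\<in>S. 0 < l \<longrightarrow> poly q m \<le> 5 * poly q l) \<and> Max (poly q ` S) = 1"
  proof (cases "cond_number W > 1")
    case False
    then have q: "q = [:0, 1:]" by (simp add: q_def gossip_poly_def)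
    have "1 \<le> l0" using False l0S(2) unfolding cond by (simp add: not_less divide_le_eq_1)
    then have one: "l = 1" if "l \<in> S" "0 < l" for l using l0le[OF that] S(4)[OF that(1)] by simp
    have "poly q ` S = S" by (auto simp: q)
    moreover have "Max S = 1" using S by (intro Max_eqI) auto
    moreover have "l = 0 \<or> l = 1" if "l \<in> S" for l
      using one[OF that] S(3)[OF that] by (cases "l = 0") auto
    ultimately show ?thesis by (simp add: q) (metis less_irrefl mult_1_right one_le_numeral zero_le_numeral)
  next
    case True
    then have l01: "l0 < 1" using l0S(2) unfolding cond by (simp add: less_divide_eq_1)
    define x where "x = 1 / l0"
    define c2 where "c2 = (x + 1) / (x - 1)"
    define c3 where "c3 = 2 / (1 + l0)"
    define T where "T = chebyshev_T (nat \<lfloor>sqrt x\<rfloor>)"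
    define q0 where "q0 = gossip_poly_unscaled W"
    have q0: "q0 = 1 - Polynomial.smult (1 / poly T c2) (T \<circ>\<^sub>p [:c2, - (c2 * c3):])"
      unfolding q0_def gossip_poly_unscaled_def Let_def cond max l0_def[symmetric] T_def c2_def c3_def x_def ..
    have ev: "poly q0 l = 1 - poly T (c2 * (1 - c3 * l)) / poly T c2" for l
      by (simp add: q0 poly_pcompose algebra_simps)
    note cb = chebyshev_tail_bounds[OF l0S(2) l01, folded x_def, folded c2_def c3_def T_def]
    have T: "3 / 2 \<le> poly T c2" using cb(1)[of 1] l01 by simp
    have bd: "1 / 3 \<le> poly q0 l" "poly q0 l \<le> 5 / 3" if "l \<in> S" "0 < l" for l
    proof -
      have "\<bar>poly T (c2 * (1 - c3 * l))\<bar> \<le> 1" by (rule cb(2)[OF l0le[OF that] S(4)[OF that(1)]])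
      then have "\<bar>poly T (c2 * (1 - c3 * l)) / poly T c2\<bar> \<le> 1 / (3 / 2)"
        unfolding abs_divide using T by (intro frac_le) auto
      then have "poly T (c2 * (1 - c3 * l)) / poly T c2 \<le> 2 / 3" "- (2 / 3) \<le> poly T (c2 * (1 - c3 * l)) / poly T c2"
        unfolding abs_le_iff by simp_all
      then show "1 / 3 \<le> poly q0 l" "poly q0 l \<le> 5 / 3" unfolding ev by simp_all
    qed
    have q00: "poly q0 0 = 0" using T by (simp add: ev)
    define m where "m = Max (poly q0 ` S)"
    have m: "m = lam_max (mat_poly q0 W)"
    proof -
      have "{r. eigenvalue (mat_poly q0 W) r} = poly q0 ` S"
        using eigenvalue_mat_poly[of q0] S(2) unfolding S_def by blast
      then show ?thesis unfolding m_def lam_max_def by (simp only:)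
    qed
    have mge: "poly q0 l \<le> m" if "l \<in> S" for l unfolding m_def using S(1) that by (intro Max_ge) auto
    have mpos: "0 < m" using mge[OF S(5)] bd(1)[OF S(5)] by simp
    have q: "q = Polynomial.smult (1 / m) q0" using True by (simp add: q_def gossip_poly_def m q0_def)
    have qv: "poly q l = poly q0 l / m" for l by (simp add: q)
    have "m \<in> poly q0 ` S" unfolding m_def using S(1,2) by (intro Max_in) auto
    then obtain lm where lm: "lm \<in> S" "poly q0 lm = m" by blast
    have "poly q lm = 1" unfolding qv lm(2) using mpos by simp
    then have "1 \<in> poly q ` S" using lm(1) by (metis image_eqI)
    moreover have "poly q l \<le> 1" if "l \<in> S" for l using mge[OF that] mpos unfolding qv by simp
    ultimately have "Max (poly q ` S) = 1" using S(1) by (intro Max_eqI) auto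
    moreover have "poly q l' \<le> 5 * poly q l" if "l \<in> S" "l' \<in> S" "0 < l" for l l'
    proof -
      have "poly q0 l' \<le> 5 * poly q0 l"
        using bd(1)[OF that(1,3)] bd(2)[OF that(2)] S(3)[OF that(2)] q00 by (cases "l' = 0") auto
      then show ?thesis using mpos divide_right_mono[of "poly q0 l'" "5 * poly q0 l" m] unfolding qv by simp
    qed
    moreover have "0 < poly q l" if "l \<in> S" "0 < l" for l using bd(1)[OF that] mpos unfolding qv by simp
    moreover have "poly q 0 = 0" unfolding qv by (simp add: q00)
    ultimately show ?thesis by blast
  qed
  then show "poly q 0 = 0" "\<And>l. l \<in> S \<Longrightarrow> 0 < l \<Longrightarrow> 0 < poly q l"
    "\<And>l m. l \<in> S \<Longrightarrow> m \<in> S \<Longrightarrow> 0 < l \<Longrightarrow> poly q m \<le> 5 * poly q l" "Max (poly q ` S) = 1"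
    by auto
qed

lemma cheb_gossip_carrier: "W \<in> carrier_mat M M \<Longrightarrow> cheb_gossip W \<in> carrier_mat M M"
  by (simp add: cheb_gossip_def mat_poly_def mat_sum_def)

text \<open>1 / \<chi> is the smallest positive eigenvalue of the accelerated matrix, because the
  largest is normalised to 1. The bounds on \<open>poly q l\<close> are what compares the norm of
  the pseudo-inverse with the Euclidean one.\<close>

lemma cond_number_cheb_gossip:
  assumes W: "gossip_matrix M E W" and M: "0 < M"
  defines "S \<equiv> {l. eigenvalue W l}" and "q \<equiv> gossip_poly W" and "\<chi> \<equiv> cond_number (cheb_gossip W)"
  shows "1 \<le> \<chi>" "\<chi> \<le> 5" "\<And>l. l \<in> S \<Longrightarrow> 0 < l \<Longrightarrow> 1 / \<chi> \<le> poly q l \<and> poly q l \<le> 1"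
proof -
  note S = gossip_eigenvalues[OF W M, folded S_def]
  note q = gossip_poly_bounds[OF W M, folded S_def q_def]
  have C: "W \<in> carrier_mat M M" "transpose_mat W = W" using W by (auto simp: gossip_matrix_def)
  obtain \<Lambda> P where "spectral_mat M 1 W \<Lambda> P" by (rule spectral_mat_exists[OF _ C, of 1]) auto
  then interpret spectral_mat M 1 W \<Lambda> P .
  have ev: "{r. eigenvalue (cheb_gossip W) r} = poly q ` S"
    using eigenvalue_mat_poly[of q] S(2) unfolding cheb_gossip_def q_def S_def by blast
  have le1: "poly q l \<le> 1" if "l \<in> S" for l
    using Max_ge[of "poly q ` S" "poly q l"] S(1) that unfolding q(4) by simp
  let ?R = "{r \<in> poly q ` S. 0 < r}"
  have R: "finite ?R" "?R \<noteq> {}" using S(1,5) q(2)[OF S(5)] by auto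
  have \<chi>: "\<chi> = 1 / Min ?R"
  proof -
    have "{r. eigenvalue (cheb_gossip W) r \<and> 0 < r} = ?R" using ev by blast
    then show ?thesis unfolding \<chi>_def cond_number_def lam_max_def lam_min_pos_def ev q(4) by simp
  qed
  obtain l where l: "l \<in> S" "Min ?R = poly q l" "0 < poly q l" using Min_in[OF R] by force
  have lpos: "0 < l" using l(3) S(3)[OF l(1)] q(1) by (cases "l = 0") auto
  have "Max (poly q ` S) \<in> poly q ` S" using S(1,2) by (intro Max_in) auto
  then obtain m where "m \<in> S" "poly q m = 1" unfolding q(4) by force
  then have "1 \<le> 5 * poly q l" using q(3)[OF l(1) _ lpos, of m] by simp
  then show "\<chi> \<le> 5" unfolding \<chi> l(2) using l(3) by (simp add: field_simps)
  show "1 \<le> \<chi>" unfolding \<chi> l(2) using l(3) le1[OF l(1)] by simp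
  fix k assume k: "k \<in> S" "0 < k"
  then have "Min ?R \<le> poly q k" using R(1) q(2)[OF k] by (intro Min_le) auto
  then show "1 / \<chi> \<le> poly q k \<and> poly q k \<le> 1" using le1[OF k(1)] unfolding \<chi> by simp
qed

text \<open>\<open>B\<close> is the pseudo-inverse of \<open>A \<otimes> I_d\<close> and \<open>Y\<close> its range.\<close>
locale gossip_dual =
  fixes M d :: nat and A :: "real mat" and \<chi> :: real and B :: "fin_fun \<Rightarrow> fin_fun" and Y :: "fin_fun set"
  assumes linB: "linear B" and adjB: "\<And>u v. inner u (B v) = inner (B u) v"
    and subY: "Real_Vector_Spaces.subspace Y"
    and BA: "\<And>u v. v \<in> Y \<Longrightarrow> inner (B (mat_op M d A u)) v = inner u v" and AY: "\<And>u. mat_op M d A u \<in> Y"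
    and B_ge: "\<And>v. v \<in> Y \<Longrightarrow> (norm v)\<^sup>2 \<le> inner v (B v)"
    and B_le: "\<And>v. v \<in> Y \<Longrightarrow> inner v (B v) \<le> \<chi> * (norm v)\<^sup>2"
    and orthY: "\<And>Z. Z \<in> orth_complement M d (consensus M d) \<Longrightarrow> emb Z \<in> Y"
    and consY: "\<And>Z v. Z \<in> consensus M d \<Longrightarrow> v \<in> Y \<Longrightarrow> inner (emb Z) v = 0"

text \<open>B divides by \<open>poly q l\<close> on the spectral subspaces with l \<noteq> 0, and Y
  is their sum; there the eigenvalues lie between 1 / \<chi> and 1, which gives the two norm bounds.
  The link to the consensus space is that ker W is spanned by the all-ones vector, read column by
  column.\<close>

lemma gossip_dual_exists:
  assumes W: "gossip_matrix M E W" and M: "0 < M" and d: "0 < d"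
  obtains B Y where "gossip_dual M d (cheb_gossip W) (cond_number (cheb_gossip W)) B Y"
proof -
  define \<chi> where "\<chi> = cond_number (cheb_gossip W)"
  define A where "A = mat_op M d (cheb_gossip W)"
  define S where "S = {l. eigenvalue W l}"
  define q where "q = gossip_poly W"
  note S = gossip_eigenvalues[OF W M, folded S_def]
  note q = gossip_poly_bounds[OF W M, folded S_def q_def]
  note \<chi> = cond_number_cheb_gossip[OF W M, folded S_def q_def \<chi>_def]
  have C: "W \<in> carrier_mat M M" "transpose_mat W = W"
    and ker: "mat_kernel W = range (\<lambda>c. c \<cdot>\<^sub>v vec M (\<lambda>_. 1))"
    using W by (auto simp: gossip_matrix_def)
  obtain \<Lambda> P where "spectral_mat M d W \<Lambda> P" by (rule spectral_mat_exists[OF d C])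
  then interpret spectral_mat M d W \<Lambda> P .
  define \<Lambda>' where "\<Lambda>' = \<Lambda> - {0}"
  have sub: "\<Lambda>' \<subseteq> \<Lambda>" by (auto simp: \<Lambda>'_def)
  \<comment> \<open>An element of \<Lambda>' is known to be an eigenvalue of W only if its
    projection is not zero; hence the case splits on \<open>P l v = 0\<close> below.\<close>
  have inS: "l \<in> S \<and> 0 < l" if "l \<in> \<Lambda>'" "P l u \<noteq> 0" for l u
    using eigenvalue_of_proj[of l u] that S(3)[of l] by (auto simp: \<Lambda>'_def S_def less_le)
  define R where "R u = (\<Sum>l\<in>\<Lambda>'. P l u)" for u
  define B where "B u = (\<Sum>l\<in>\<Lambda>'. (1 / poly q l) *\<^sub>R P l u)" for u
  define Y where "Y = {u. R u = u}"
  have linR: "linear R" unfolding R_def by (intro linear_compose_sum ballI lin)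
  have linB: "linear B" unfolding B_def by (intro linear_compose_sum ballI linear_compose_scale_right lin)
  have adjR: "inner (R u) v = inner u (R v)" for u v
    by (simp add: R_def inner_sum_left inner_sum_right adj)
  have adjB: "inner u (B v) = inner (B u) v" for u v
    by (simp add: B_def inner_sum_left inner_sum_right adj)
  have A: "A u = (\<Sum>l\<in>\<Lambda>'. poly q l *\<^sub>R P l u)" for u
  proof -
    have "A u = (\<Sum>l\<in>\<Lambda>. poly q l *\<^sub>R P l u)"
      unfolding A_def cheb_gossip_def q_def[symmetric] using q(1)
      by (subst mat_op_mat_poly[OF C(1)]) (auto simp: poly_0_coeff_0 poly_app_spectral)
    also have "\<dots> = (\<Sum>l\<in>\<Lambda>'. poly q l *\<^sub>R P l u)"
      using fin q(1) sub by (intro sum.mono_neutral_right) (auto simp: \<Lambda>'_def)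
    finally show ?thesis .
  qed
  have PA: "P l (A u) = poly q l *\<^sub>R P l u" if "l \<in> \<Lambda>'" for l u
    using proj_sum[OF sub, of l "poly q" u] that sub by (auto simp: A)
  have RA: "R (A u) = A u" for u
  proof -
    have "R (A u) = (\<Sum>l\<in>\<Lambda>'. poly q l *\<^sub>R P l u)" unfolding R_def by (intro sum.cong refl PA)
    then show ?thesis by (simp only: A)
  qed
  have BA: "B (A u) = R u" for u
    unfolding B_def R_def
  proof (rule sum.cong)
    fix l assume l: "l \<in> \<Lambda>'"
    show "(1 / poly q l) *\<^sub>R P l (A u) = P l u"
      using q(2)[of l] inS[OF l, of u] by (cases "P l u = 0") (auto simp: PA[OF l])
  qed simp
  have normP: "inner v (P l v) = (norm (P l v))\<^sup>2" if "l \<in> \<Lambda>" for l v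
    using proj_proj[OF that that, of v] by (simp add: power2_norm_eq_inner adj)
  have norm_Y: "(norm v)\<^sup>2 = (\<Sum>l\<in>\<Lambda>'. (norm (P l v))\<^sup>2)" if "v \<in> Y" for v
  proof -
    have "(norm v)\<^sup>2 = inner v (R v)" using that by (simp add: Y_def power2_norm_eq_inner)
    then show ?thesis unfolding R_def inner_sum_right using sub by (auto intro!: sum.cong simp: normP)
  qed
  have NB: "inner v (B v) = (\<Sum>l\<in>\<Lambda>'. 1 / poly q l * (norm (P l v))\<^sup>2)" for v
    unfolding B_def inner_sum_right using sub by (auto intro!: sum.cong simp: normP)
  have kerP: "P l u = 0" if "mat_op M d W u = 0" "l \<in> \<Lambda>'" for l u
  proof -
    have "l * inner (P l u) u = inner (mat_op M d W (P l u)) u" using that sub by (auto simp: eig)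
    also have "\<dots> = 0" by (simp add: mat_op_adjoint[OF C] that)
    finally have "inner u (P l u) = 0" using that by (simp add: \<Lambda>'_def inner_commute)
    then show ?thesis using normP[of l u] that sub by auto
  qed
  show ?thesis
  proof (rule that[of B Y, folded \<chi>_def], rule gossip_dual.intro[OF linB adjB], fold A_def)
    show "Real_Vector_Spaces.subspace Y"
      unfolding Y_def real_vector.subspace_def by (auto simp: linear_0[OF linR] linear_add[OF linR] linear_scale[OF linR])
    show "inner (B (A u)) v = inner u v" if "v \<in> Y" for u v
      using that unfolding BA adjR by (simp add: Y_def)
    show "A u \<in> Y" for u by (simp add: Y_def RA)
    show "(norm v)\<^sup>2 \<le> inner v (B v)" if "v \<in> Y" for v
      unfolding norm_Y[OF that] NB
    proof (rule sum_mono)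
      fix l assume l: "l \<in> \<Lambda>'"
      show "(norm (P l v))\<^sup>2 \<le> 1 / poly q l * (norm (P l v))\<^sup>2"
      proof (cases "P l v = 0")
        case False
        note lS = inS[OF l False]
        have "1 \<le> 1 / poly q l" using \<chi>(3)[of l] q(2)[of l] lS by (simp add: field_simps)
        then show ?thesis using mult_right_mono[of 1 "1 / poly q l" "(norm (P l v))\<^sup>2"] by simp
      qed simp
    qed
    show "inner v (B v) \<le> \<chi> * (norm v)\<^sup>2" if "v \<in> Y" for v
      unfolding norm_Y[OF that] NB sum_distrib_left
    proof (rule sum_mono)
      fix l assume l: "l \<in> \<Lambda>'"
      show "1 / poly q l * (norm (P l v))\<^sup>2 \<le> \<chi> * (norm (P l v))\<^sup>2"
      proof (cases "P l v = 0")
        case False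
        note lS = inS[OF l False]
        have "1 / poly q l \<le> \<chi>" using \<chi>(1) \<chi>(3)[of l] q(2)[of l] lS by (simp add: field_simps)
        then show ?thesis by (rule mult_right_mono) simp
      qed simp
    qed
    show "emb Z \<in> Y" if Z: "Z \<in> orth_complement M d (consensus M d)" for Z
    proof -
      \<comment> \<open>The component of Z in the kernel of W. It turns out to be a consensus point,
        hence orthogonal to Z, hence zero.\<close>
      define w where "w = emb Z - R (emb Z)"
      have ZC: "Z \<in> carrier_mat M d" using Z by (simp add: orth_complement_def)
      have "w = (\<Sum>l\<in>\<Lambda> \<inter> {0}. P l (emb Z))"
        using res[of "emb Z"] sum.Int_Diff[OF fin, of "\<lambda>l. P l (emb Z)" "{0}"]
        unfolding w_def R_def \<Lambda>'_def by (simp add: algebra_simps)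
      then have Tw: "mat_op M d W w = 0"
        by (cases "0 \<in> \<Lambda>") (auto simp: eig linear_0[OF linear_mat_op])
      define Zw where "Zw = mat M d (fcoord w)"
      have col: "\<exists>c. \<forall>i<M. fcoord w (i, j) = c" if "j < d" for j
      proof -
        let ?v = "vec M (\<lambda>i. fcoord w (i, j))"
        have "W *\<^sub>v ?v = 0\<^sub>v M"
        proof (rule eq_vecI)
          fix i assume "i < dim_vec (0\<^sub>v M :: real vec)"
          then have "fcoord (mat_op M d W w) (i, j) = (W *\<^sub>v ?v) $ i"
            using C that by (simp add: fcoord_mat_op scalar_prod_def lessThan_atLeast0)
          then show "(W *\<^sub>v ?v) $ i = 0\<^sub>v M $ i" using \<open>i < dim_vec (0\<^sub>v M)\<close> Tw by simp
        qed (use C in simp)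
        then have "?v \<in> mat_kernel W" using C by (auto simp: mat_kernel_def)
        then obtain c where c: "?v = c \<cdot>\<^sub>v vec M (\<lambda>_. 1)" unfolding ker by auto
        have "fcoord w (i, j) = c" if "i < M" for i using arg_cong[OF c, of "\<lambda>v. v $ i"] that by simp
        then show ?thesis by blast
      qed
      have "Zw \<in> consensus M d"
      proof -
        have "row Zw i = row Zw k" if "i < M" "k < M" for i k
        proof (rule eq_vecI)
          fix j assume "j < dim_vec (row Zw k)"
          then have j: "j < d" by (simp add: Zw_def)
          then show "row Zw i $ j = row Zw k $ j" using col[OF j] that by (auto simp: Zw_def)
        qed (simp add: Zw_def)
        moreover have "Zw \<in> carrier_mat M d" by (simp add: Zw_def)
        ultimately show ?thesis unfolding consensus_def by blast
      qed
      \<comment> \<open>Outside the block \<open>emb Z\<close> vanishes, so restricting w to the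
        block does not change the product.\<close>
      moreover have "inner (emb Z) (emb Zw) = inner (emb Z) w"
        unfolding inner_supported[OF supported_emb[OF ZC]] by (simp add: fcoord_emb Zw_def)
      moreover have "inner (emb Z) (emb Zw) = mat_inner Z Zw"
        by (rule inner_emb[OF ZC]) (simp add: Zw_def)
      ultimately have "inner (emb Z) w = 0" using Z by (simp add: orth_complement_def)
      moreover have "R w = 0" using kerP[OF Tw] by (simp add: R_def)
      then have "inner (R (emb Z)) w = 0" by (simp add: adjR)
      ultimately have "inner w w = 0" by (simp add: w_def inner_diff_left)
      then have "w = 0" by simp
      then have "emb Z = R (emb Z)" unfolding w_def by (rule right_minus_eq[THEN iffD1])
      then show ?thesis unfolding Y_def mem_Collect_eq by (rule sym)
    qed
    show "inner (emb Z) v = 0" if Z: "Z \<in> consensus M d" and v: "v \<in> Y" for Z v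
    proof -
      have ZC: "Z \<in> carrier_mat M d" using Z unfolding consensus_def by blast
      have Z0: "Z $$ (k, j) = Z $$ (0, j)" if "k < M" "j < d" for k j
      proof -
        have "row Z k = row Z 0" using Z that M unfolding consensus_def by blast
        then have "row Z k $ j = row Z 0 $ j" by simp
        then show ?thesis using ZC that M by simp
      qed
      have row: "(\<Sum>k<M. W $$ (i, k)) = 0" if i: "i < M" for i
      proof -
        have "1 \<cdot>\<^sub>v vec M (\<lambda>_. 1 :: real) \<in> mat_kernel W" unfolding ker by blast
        then have "(W *\<^sub>v vec M (\<lambda>_. 1)) $ i = 0\<^sub>v M $ i" using C by (auto simp: mat_kernel_def)
        then show ?thesis using i C by (simp add: scalar_prod_def lessThan_atLeast0)
      qed
      have entry: "fcoord (emb Z) (k, j) = Z $$ (0, j)" if "k < M" "j < d" for k j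
        using ZC that Z0[OF that] by (auto simp: fcoord_emb)
      have "mat_op M d W (emb Z) = 0"
      proof (rule fin_fun_eqI)
        fix a :: "nat \<times> nat"
        obtain i j where a: "a = (i, j)" by (cases a)
        have "(\<Sum>k<M. W $$ (i, k) * fcoord (emb Z) (k, j)) = (\<Sum>k<M. W $$ (i, k)) * Z $$ (0, j)" if "j < d"
          unfolding sum_distrib_right by (intro sum.cong refl) (use that in \<open>simp add: entry\<close>)
        then show "fcoord (mat_op M d W (emb Z)) a = fcoord 0 a" by (auto simp: a fcoord_mat_op row)
      qed
      then have "R (emb Z) = 0" using kerP by (simp add: R_def)
      then show ?thesis using v adjR[of "emb Z" v] by (simp add: Y_def)
    qed
  qed
qed

section \<open>One step of the method\<close>

lemma young_inner:
  fixes x y :: "'a::real_inner"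
  assumes "0 < c"
  shows "2 * inner x y \<le> c * (norm x)\<^sup>2 + (norm y)\<^sup>2 / c"
proof -
  have "0 \<le> (norm (c *\<^sub>R x - y))\<^sup>2 / c" using assms by simp
  also have "\<dots> = c * (norm x)\<^sup>2 + (norm y)\<^sup>2 / c - 2 * inner x y"
    using assms
    by (simp add: power2_norm_eq_inner inner_diff_left inner_diff_right inner_commute field_simps)
  finally show ?thesis by simp
qed

lemma norm_add_sq_le:
  fixes x y :: "'a::real_inner"
  shows "(norm (x + y))\<^sup>2 \<le> 2 * (norm x)\<^sup>2 + 2 * (norm y)\<^sup>2"
  using young_inner[of 1 x y] by (simp add: power2_norm_eq_inner inner_add inner_commute)

lemma inner_le_of_norm_le:
  fixes u v x :: "'a::real_inner"
  assumes "norm u \<le> L * norm v" "0 \<le> L"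
  shows "2 * \<bar>inner u x\<bar> \<le> L * ((norm v)\<^sup>2 + (norm x)\<^sup>2)"
proof -
  have "\<bar>inner u x\<bar> \<le> norm u * norm x" by (rule Cauchy_Schwarz_ineq2)
  also have "\<dots> \<le> L * norm v * norm x" by (intro mult_right_mono assms) simp
  finally have "2 * \<bar>inner u x\<bar> \<le> L * (2 * norm v * norm x)" by simp
  also have "\<dots> \<le> L * ((norm v)\<^sup>2 + (norm x)\<^sup>2)"
    using assms(2) sum_squares_bound[of "norm v" "norm x"] by (intro mult_left_mono) auto
  finally show ?thesis .
qed

text \<open>\<open>\<xi>\<close> is the sampling error of the extrapolated operator value; its cross term has mean 0.\<close>
lemma primal_step:
  fixes z zm zp w y ym yp zs ys \<xi> Fz Fzm Fzp Fs :: "'a::real_inner"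
  assumes prox: "inner (zp - (z + \<gamma> *\<^sub>R (w - z)
      - \<eta> *\<^sub>R ((Fz + \<alpha> *\<^sub>R (Fz - Fzm) + \<xi>) - (y + \<alpha> *\<^sub>R (y - ym))))) (zp - zs)
      \<le> \<eta> * inner (Fs - ys) (zp - zs)"
    and mono: "\<mu> * (norm (zp - zs))\<^sup>2 \<le> inner (Fzp - Fs) (zp - zs)"
    and lip: "norm (Fz - Fzm) \<le> L * norm (z - zm)"
    and \<eta>: "0 < \<eta>" "\<eta> * L \<le> 1 / 16" "0 \<le> L" and \<alpha>: "0 \<le> \<alpha>" "\<alpha> \<le> 1"
  shows "(1 + 2 * \<eta> * \<mu>) * (norm (zp - zs))\<^sup>2 + \<gamma> * (norm (zp - w))\<^sup>2
      + (7 / 16 - \<gamma>) * (norm (zp - z))\<^sup>2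
      - 2 * \<eta> * inner (Fzp - Fz) (zp - zs) + 2 * \<eta> * inner (yp - y) (zp - zs)
    \<le> (1 - \<gamma>) * (norm (z - zs))\<^sup>2 + \<gamma> * (norm (w - zs))\<^sup>2 + (norm (z - zm))\<^sup>2 / 16
      + \<alpha> * (2 * \<eta> * inner (y - ym) (z - zs) - 2 * \<eta> * inner (Fz - Fzm) (z - zs))
      + 4 * \<eta>\<^sup>2 * (norm (y - ym))\<^sup>2
      + 4 * \<eta>\<^sup>2 * (norm \<xi>)\<^sup>2 - 2 * \<eta> * inner \<xi> (z - zs)
      + 2 * \<eta> * inner (yp - ys) (zp - zs)"
proof -
  \<comment> \<open>The extrapolation term is paired with zp - zs = (zp - z) + (z - zs). The second
    part is kept, with factor \<alpha>, for telescoping; the first is paid here by \<eta> L \<le>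
    1/16.\<close>
  have F: "2 * \<eta> * \<alpha> * (- inner (Fz - Fzm) (zp - z)) \<le> (norm (z - zm))\<^sup>2 / 16 + (norm (zp - z))\<^sup>2 / 16"
  proof -
    have "2 * \<bar>inner (Fz - Fzm) (zp - z)\<bar> \<le> L * ((norm (z - zm))\<^sup>2 + (norm (zp - z))\<^sup>2)"
      by (rule inner_le_of_norm_le[OF lip \<eta>(3)])
    then have "(\<eta> * \<alpha>) * (2 * (- inner (Fz - Fzm) (zp - z)))
        \<le> (\<eta> * \<alpha>) * (L * ((norm (z - zm))\<^sup>2 + (norm (zp - z))\<^sup>2))"
      using \<eta> \<alpha> by (intro mult_left_mono) auto
    also have "\<dots> = \<alpha> * (\<eta> * L) * ((norm (z - zm))\<^sup>2 + (norm (zp - z))\<^sup>2)" by simp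
    also have "\<dots> \<le> 1 * (1 / 16) * ((norm (z - zm))\<^sup>2 + (norm (zp - z))\<^sup>2)"
      using \<eta> \<alpha> by (intro mult_mono mult_right_mono) auto
    finally show ?thesis by simp
  qed
  \<comment> \<open>The weights 2 \<eta> and 1/2 leave 4 \<eta>^2 |y - ym|^2, which the dual term of
    the Lyapunov function absorbs through 16 \<eta> \<theta> \<le> 1.\<close>
  have Y: "2 * \<eta> * \<alpha> * inner (y - ym) (zp - z) \<le> 4 * \<eta>\<^sup>2 * (norm (y - ym))\<^sup>2 + (norm (zp - z))\<^sup>2 / 4"
  proof -
    have "2 * inner ((2 * \<eta> * \<alpha>) *\<^sub>R (y - ym)) ((1 / 2) *\<^sub>R (zp - z))
      \<le> 1 * (norm ((2 * \<eta> * \<alpha>) *\<^sub>R (y - ym)))\<^sup>2 + (norm ((1 / 2) *\<^sub>R (zp - z)))\<^sup>2 / 1"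
      by (rule young_inner) simp
    moreover have "(2 * \<eta> * \<alpha>)\<^sup>2 * (norm (y - ym))\<^sup>2 \<le> 4 * \<eta>\<^sup>2 * (norm (y - ym))\<^sup>2"
      using \<alpha> by (intro mult_right_mono) (auto simp: power_mult_distrib mult_le_cancel_left2 power_le_one)
    ultimately show ?thesis by (simp add: power_mult_distrib power_divide)
  qed
  \<comment> \<open>Only the noise along zp - z is estimated, because zp depends on the sample; the
    part along z - zs averages out.\<close>
  have X: "2 * \<eta> * (- inner \<xi> (zp - z)) \<le> 4 * \<eta>\<^sup>2 * (norm \<xi>)\<^sup>2 + (norm (zp - z))\<^sup>2 / 4"
  proof -
    have "2 * inner ((2 * \<eta>) *\<^sub>R \<xi>) (- ((1 / 2) *\<^sub>R (zp - z)))
      \<le> 1 * (norm ((2 * \<eta>) *\<^sub>R \<xi>))\<^sup>2 + (norm (- ((1 / 2) *\<^sub>R (zp - z))))\<^sup>2 / 1"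
      by (rule young_inner) simp
    then show ?thesis by (simp add: power_mult_distrib power_divide)
  qed
  \<comment> \<open>With the differences as independent vectors the claim is linear in their inner
    products. The coefficient 7/16 - \<gamma> is 1 - 1/16 - 1/4 - 1/4 - \<gamma>: the three
    estimates above, and the four-point identity for w - z against zp - zs.\<close>
  define a c x e f fp v vp s q where "a = zp - zs" and "c = zp - z" and "x = w - zs"
    and "e = Fz - Fzm" and "f = Fzp - Fz" and "fp = Fzp - Fs" and "v = y - ym" and "vp = yp - y"
    and "s = yp - ys" and "q = \<xi>"
  have z: "z - zs = a - c" "zp - w = a - x" "w - z = x - a + c" "zp - z = c"
    and d: "zp - (z + \<gamma> *\<^sub>R (w - z)
      - \<eta> *\<^sub>R ((Fz + \<alpha> *\<^sub>R (Fz - Fzm) + \<xi>) - (y + \<alpha> *\<^sub>R (y - ym))))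
      = c - \<gamma> *\<^sub>R (x - a + c) + \<eta> *\<^sub>R ((Fs - ys) + fp - f + \<alpha> *\<^sub>R e + q - \<alpha> *\<^sub>R v - s + vp)"
    by (simp_all add: a_def c_def x_def e_def f_def fp_def v_def vp_def s_def q_def algebra_simps)
  have P: "inner (c - \<gamma> *\<^sub>R (x - a + c) + \<eta> *\<^sub>R (fp - f + \<alpha> *\<^sub>R e + q - \<alpha> *\<^sub>R v - s + vp)) a \<le> 0"
    using prox unfolding d a_def[symmetric] by (simp add: inner_simps algebra_simps)
  have M: "\<eta> * (\<mu> * inner a a) \<le> \<eta> * inner fp a"
    using mono \<eta> unfolding a_def fp_def power2_norm_eq_inner by (intro mult_left_mono) auto
  show ?thesis
    using F Y X P M unfolding z a_def[symmetric] c_def[symmetric] x_def[symmetric] e_def[symmetric]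
      f_def[symmetric] fp_def[symmetric] v_def[symmetric] vp_def[symmetric] s_def[symmetric]
      q_def[symmetric] power2_norm_eq_inner
    by (simp add: inner_simps inner_commute algebra_simps)
qed

text \<open>\<open>A\<close> stands for the gossip operator, \<open>Y\<close> for its range and \<open>B\<close> for its pseudo-inverse.\<close>
lemma dual_step:
  fixes zp zs y ys yp D Fs :: "'a::real_inner" and A B :: "'a \<Rightarrow> 'a"
  defines "N \<equiv> \<lambda>v. inner v (B v)"
  assumes lin: "linear A" "linear B" and adj: "\<And>u v. inner u (B v) = inner (B u) v"
    and BA: "\<And>u v. v \<in> Y \<Longrightarrow> inner (B (A u)) v = inner u v"
    and Ns: "\<And>v. v \<in> Y \<Longrightarrow> (norm v)\<^sup>2 \<le> N v" "\<And>v. v \<in> Y \<Longrightarrow> N v \<le> \<chi> * (norm v)\<^sup>2"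
    and Y: "Real_Vector_Spaces.subspace Y" "y - ys \<in> Y" "yp - y \<in> Y" 
    and zs: "\<And>v. v \<in> Y \<Longrightarrow> inner zs v = 0" and ys: "\<And>v. v \<in> Y \<Longrightarrow> inner Fs v = inner ys v"
    and yp: "yp = y - \<theta> *\<^sub>R A (zp - \<beta> *\<^sub>R (D - y))"
    and pos: "0 < \<theta>" "0 < \<beta>" "\<theta> \<le> 1 / (2 * \<beta>)" "0 < \<chi>"
  shows "2 * inner (yp - ys) (zp - zs) + N (yp - ys) / \<theta> + N (yp - y) / (2 * \<theta>)
    \<le> (1 - \<beta> * \<theta> / \<chi>) / \<theta> * N (y - ys) + \<beta> * (norm (D - Fs))\<^sup>2"
proof -
  define a c where "a = yp - y" and "c = yp - ys"
  have cY: "c \<in> Y" "a \<in> Y" and ca: "y - ys = c - a"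
    using real_vector.subspace_add[OF Y(1,2,3)] Y by (auto simp: c_def a_def algebra_simps)
  have "a = (- \<theta>) *\<^sub>R A (zp - \<beta> *\<^sub>R (D - y))" by (simp add: a_def yp)
  \<comment> \<open>In the inner product given by B the operator A disappears, and the dual update
    becomes a plain gradient step.\<close>
  then have "inner (B a) c = - \<theta> * inner (zp - \<beta> *\<^sub>R (D - y)) c"
    using BA[OF cY(1)] by (simp add: linear_scale[OF lin(2)] linear_neg[OF lin(2)] inner_simps)
  moreover have "N (c - a) = N c + N a - 2 * inner (B a) c"
    unfolding N_def linear_diff[OF lin(2)] using adj[of c a] adj[of a c]
    by (simp add: inner_simps inner_commute)
  ultimately have "N (c - a) = N c + N a + 2 * \<theta> * inner (zp - \<beta> *\<^sub>R (D - y)) c" by simp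
  \<comment> \<open>Against c the point zs may be inserted, and D - y becomes (D - Fs) - (y - ys),
    as Fs and ys agree on Y. The second difference is the damping that contracts y.\<close>
  moreover have "inner (zp - \<beta> *\<^sub>R (D - y)) c = inner (zp - zs) c - \<beta> * (inner (D - Fs) c - inner (c - a) c)"
    using zs[OF cY(1)] ys[OF cY(1)] by (simp add: inner_simps ca[symmetric] algebra_simps)
  ultimately have "2 * inner c (zp - zs) = (N (c - a) - N c - N a) / \<theta>
      + 2 * \<beta> * inner (D - Fs) c - 2 * \<beta> * inner (c - a) c"
    using pos by (simp add: field_simps inner_commute)
  also have "2 * \<beta> * inner (D - Fs) c \<le> \<beta> * (norm (D - Fs))\<^sup>2 + \<beta> * (norm c)\<^sup>2"
    using mult_left_mono[OF young_inner[of 1 "D - Fs" c], of \<beta>] pos by (simp add: algebra_simps)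
  \<comment> \<open>|c|^2 cancels the one from Young's inequality, |c - a|^2 gives the contraction,
    and |a|^2 is absorbed by half of N a / \<theta>.\<close>
  also have "2 * \<beta> * inner (c - a) c = \<beta> * (norm (c - a))\<^sup>2 + \<beta> * (norm c)\<^sup>2 - \<beta> * (norm a)\<^sup>2"
    by (simp add: power2_norm_eq_inner inner_simps inner_commute algebra_simps)
  finally have 1: "2 * inner c (zp - zs) \<le> (N (c - a) - N c - N a) / \<theta> + \<beta> * (norm (D - Fs))\<^sup>2
      - \<beta> * (norm (c - a))\<^sup>2 + \<beta> * (norm a)\<^sup>2" by simp
  have "\<beta> * (norm a)\<^sup>2 \<le> \<beta> * N a" using Ns(1)[OF cY(2)] pos by (intro mult_left_mono) auto
  also have "\<dots> \<le> 1 / (2 * \<theta>) * N a"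
    using pos Ns(1)[OF cY(2)] by (intro mult_right_mono) (auto simp: field_simps order.trans[OF zero_le_power2])
  finally have 2: "\<beta> * (norm a)\<^sup>2 \<le> N a / (2 * \<theta>)" by simp
  have "N (c - a) / \<chi> \<le> (norm (c - a))\<^sup>2"
    using Ns(2)[OF Y(2)] pos unfolding ca by (simp add: field_simps)
  then have 3: "\<beta> * (N (c - a) / \<chi>) \<le> \<beta> * (norm (c - a))\<^sup>2" using pos by (intro mult_left_mono) auto
  have "2 * inner c (zp - zs) + N c / \<theta> + N a / (2 * \<theta>) \<le> N (c - a) / \<theta> - \<beta> * (N (c - a) / \<chi>) + \<beta> * (norm (D - Fs))\<^sup>2"
    using 1 2 3 by (simp add: diff_divide_distrib)
  also have "N (c - a) / \<theta> - \<beta> * (N (c - a) / \<chi>) = (1 - \<beta> * \<theta> / \<chi>) / \<theta> * N (c - a)"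
    using pos by (simp add: field_simps)
  finally show ?thesis unfolding ca c_def a_def by (simp add: algebra_simps)
qed

section \<open>Sampling\<close>

abbreviation expect :: "'a pmf \<Rightarrow> ('a \<Rightarrow> real) \<Rightarrow> real" where
  "expect p h \<equiv> measure_pmf.expectation p h"

text \<open>Every law in the algorithm has finite support; in this rule and its companions that
  settles integrability.\<close>

lemma expectation_mono_finite:
  fixes f g :: "'a \<Rightarrow> real"
  assumes "finite (set_pmf p)" "\<And>x. x \<in> set_pmf p \<Longrightarrow> f x \<le> g x"
  shows "expect p f \<le> expect p g"
  using assms
  by (intro integral_mono_AE integrable_measure_pmf_finite) (auto simp: AE_measure_pmf_iff)

lemma expectation_cong_set_pmf:
  fixes f g :: "'a \<Rightarrow> real"
  assumes "\<And>x. x \<in> set_pmf p \<Longrightarrow> f x = g x"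
  shows "expect p f = expect p g"
  using assms by (intro integral_cong_AE) (auto simp: AE_measure_pmf_iff)

lemma expectation_add_finite:
  fixes f g :: "'a \<Rightarrow> real"
  assumes "finite (set_pmf p)"
  shows "expect p (\<lambda>x. f x + g x) = expect p f + expect p g"
  by (intro Bochner_Integration.integral_add integrable_measure_pmf_finite assms)

lemma expectation_diff_finite:
  fixes f g :: "'a \<Rightarrow> real"
  assumes "finite (set_pmf p)"
  shows "expect p (\<lambda>x. f x - g x) = expect p f - expect p g"
  by (intro Bochner_Integration.integral_diff integrable_measure_pmf_finite assms)

lemma expectation_sum_finite:
  fixes f :: "'b \<Rightarrow> 'a \<Rightarrow> real"
  assumes "finite (set_pmf p)"
  shows "expect p (\<lambda>x. \<Sum>i\<in>I. f i x) = (\<Sum>i\<in>I. expect p (f i))"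
  by (intro Bochner_Integration.integral_sum integrable_measure_pmf_finite assms)

lemma expectation_bind_finite:
  fixes h :: "'b \<Rightarrow> real"
  assumes "finite (set_pmf p)" "\<And>x. x \<in> set_pmf p \<Longrightarrow> finite (set_pmf (f x))"
  shows "expect (bind_pmf p f) h = expect p (\<lambda>x. expect (f x) h)"
  using assms
  by (subst pmf_expectation_bind[of "set_pmf p"]) (auto simp: integral_measure_pmf[of "set_pmf p"])

lemma finite_set_Pi_pmf:
  assumes "finite A" "\<And>a. a \<in> A \<Longrightarrow> finite (set_pmf (q a))"
  shows "finite (set_pmf (Pi_pmf A d q))"
  using assms by (simp add: set_Pi_pmf finite_PiE_dflt)

lemma expectation_Pi_pmf_component:
  fixes h :: "'b \<Rightarrow> real"
  assumes "finite A" "a \<in> A"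
  shows "expect (Pi_pmf A d q) (\<lambda>J. h (J a)) = expect (q a) h"
  using Pi_pmf_component[of A a d q] assms integral_map_pmf[of "\<lambda>J. J a" "Pi_pmf A d q" h] by simp

text \<open>The integrals are real, as the Bochner integral is not available in an incomplete
  inner product space.\<close>
lemma expectation_norm_sum_Pi_pmf:
  fixes f :: "'a \<Rightarrow> 'b \<Rightarrow> 'c::real_inner"
  assumes "finite A" "\<And>a. a \<in> A \<Longrightarrow> finite (set_pmf (q a))"
    and "\<And>a v. a \<in> A \<Longrightarrow> expect (q a) (\<lambda>i. inner (f a i) v) = 0"
  shows "expect (Pi_pmf A d q) (\<lambda>J. (norm (\<Sum>a\<in>A. f a (J a)))\<^sup>2)
    = (\<Sum>a\<in>A. expect (q a) (\<lambda>i. (norm (f a i))\<^sup>2))"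
  using assms
proof (induction A rule: finite_induct)
  case (insert x A)
  let ?P = "Pi_pmf A d q" and ?S = "\<lambda>J. \<Sum>a\<in>A. f a (J a)"
  have fin: "finite (set_pmf ?P)" using insert by (intro finite_set_Pi_pmf) auto
  have upd: "(\<Sum>a\<in>insert x A. f a ((J(x := y)) a)) = f x y + ?S J" for J y
    using insert(1,2) by (auto intro!: sum.cong)
  \<comment> \<open>The new coordinate is independent of the others, so its term acts as a constant
    v, and centring removes the cross term.\<close>
  have cross: "expect ?P (\<lambda>J. inner (?S J) v) = 0" for v
  proof -
    have "expect ?P (\<lambda>J. inner (?S J) v)
        = (\<Sum>a\<in>A. expect ?P (\<lambda>J. inner (f a (J a)) v))"
      by (simp add: inner_sum_left expectation_sum_finite[OF fin])
    also have "\<dots> = (\<Sum>a\<in>A. expect (q a) (\<lambda>i. inner (f a i) v))"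
      by (intro sum.cong refl expectation_Pi_pmf_component[OF insert(1), where h = "\<lambda>i. inner (f _ i) v"])
    finally show ?thesis using insert(5) by simp
  qed
  have "expect (Pi_pmf (insert x A) d q) (\<lambda>J. (norm (\<Sum>a\<in>insert x A. f a (J a)))\<^sup>2)
      = expect (q x) (\<lambda>y. expect ?P (\<lambda>J. (norm (f x y + ?S J))\<^sup>2))"
    using insert fin
    by (subst Pi_pmf_insert') (simp_all add: expectation_bind_finite upd del: fun_upd_apply sum.insert)
  also have "\<dots> = expect (q x) (\<lambda>y. (norm (f x y))\<^sup>2 + expect ?P (\<lambda>J. (norm (?S J))\<^sup>2))"
  proof (rule expectation_cong_set_pmf)
    fix y
    have "(norm (f x y + ?S J))\<^sup>2 = (norm (f x y))\<^sup>2 + 2 * inner (?S J) (f x y) + (norm (?S J))\<^sup>2" for J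
      by (simp add: power2_norm_eq_inner inner_add inner_commute)
    then show "expect ?P (\<lambda>J. (norm (f x y + ?S J))\<^sup>2)
      = (norm (f x y))\<^sup>2 + expect ?P (\<lambda>J. (norm (?S J))\<^sup>2)"
      by (simp add: expectation_add_finite[OF fin] cross)
  qed
  also have "\<dots> = expect (q x) (\<lambda>y. (norm (f x y))\<^sup>2) + expect ?P (\<lambda>J. (norm (?S J))\<^sup>2)"
    using insert by (subst expectation_add_finite) auto
  finally show ?case using insert by simp
qed simp

lemma finite_set_index_pmf: "0 < n \<Longrightarrow> finite (set_pmf (index_pmf M n b))"
  unfolding index_pmf_def by (intro finite_set_Pi_pmf) (auto simp: set_pmf_of_set lessThan_empty_iff)

lemma index_pmf_bound:
  assumes "0 < n" "J \<in> set_pmf (index_pmf M n b)" "m < M" "l < b"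
  shows "J (m, l) < n"
  using assms unfolding index_pmf_def
  by (auto simp: set_Pi_pmf PiE_dflt_def set_pmf_of_set lessThan_empty_iff)

text \<open>The error is a sum of M b independent centred terms with weight 1 / b. Their variances
  add up, each is at most the second moment, and the b terms of one worker contribute b / b^2 = 1 /
  b.\<close>

lemma index_pmf_noise:
  fixes v :: "nat \<Rightarrow> nat \<Rightarrow> 'c::real_inner"
    and M n b :: nat
  assumes "0 < n" "0 < b"
  defines "mean \<equiv> \<lambda>m. (1 / real n) *\<^sub>R (\<Sum>i<n. v m i)"
  defines "\<xi> \<equiv> \<lambda>J. (1 / real b) *\<^sub>R (\<Sum>l<b. \<Sum>m<M. v m (J (m, l))) - (\<Sum>m<M. mean m)"
  shows "expect (index_pmf M n b) (\<lambda>J. inner (\<xi> J) u) = 0" (is ?unbiased)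
    and "expect (index_pmf M n b) (\<lambda>J. (norm (\<xi> J))\<^sup>2)
      \<le> (1 / real b) * (\<Sum>m<M. (1 / real n) * (\<Sum>i<n. (norm (v m i))\<^sup>2))" (is ?variance)
proof -
  let ?A = "{..<M} \<times> {..<b}" and ?U = "pmf_of_set {..<n}"
  define f where "f = (\<lambda>(a :: nat \<times> nat) i. (1 / real b) *\<^sub>R (v (fst a) i - mean (fst a)))"
  have ne: "{..<n} \<noteq> {}" using assms(1) by auto
  have E: "expect ?U h = (\<Sum>i<n. h i) / real n" for h :: "nat \<Rightarrow> real"
    using integral_pmf_of_set[OF ne] by simp
  have finU: "finite (set_pmf ?U)" using ne by simp
  have zero: "expect ?U (\<lambda>i. inner (f a i) w) = 0" for a w
  proof -
    have "(\<Sum>i<n. f a i) = 0"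
      using assms(1) by (simp add: f_def scaleR_sum_right[symmetric] sum_subtractf mean_def
          sum_constant_scaleR)
    then show ?thesis by (simp add: E inner_sum_left[symmetric])
  qed
  have "(\<Sum>a\<in>?A. f a (J a)) = (\<Sum>m<M. \<Sum>l<b. f (m, l) (J (m, l)))" for J
    by (subst sum.cartesian_product) (simp add: case_prod_unfold)
  moreover have "(\<Sum>m<M. \<Sum>l<b. f (m, l) (J (m, l))) = \<xi> J" for J
    using assms(2)
    by (subst sum.swap) (simp add: f_def \<xi>_def scaleR_sum_right[symmetric] sum_subtractf sum_constant_scaleR
        scaleR_diff_right)
  ultimately have \<xi>: "\<xi> J = (\<Sum>a\<in>?A. f a (J a))" for J by simp
  have fin: "finite (set_pmf (Pi_pmf ?A 0 (\<lambda>_. ?U)))" by (intro finite_set_Pi_pmf finU) auto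
  show ?unbiased
  proof -
    have "expect (index_pmf M n b) (\<lambda>J. inner (\<xi> J) u)
        = (\<Sum>a\<in>?A. expect (index_pmf M n b) (\<lambda>J. inner (f a (J a)) u))"
      unfolding \<xi> index_pmf_def by (simp only: inner_sum_left expectation_sum_finite[OF fin])
    also have "\<dots> = (\<Sum>a\<in>?A. expect ?U (\<lambda>i. inner (f a i) u))"
      unfolding index_pmf_def
      by (intro sum.cong refl expectation_Pi_pmf_component[where h = "\<lambda>i. inner (f _ i) u"]) auto
    finally show ?thesis by (simp add: zero)
  qed
  have var: "(\<Sum>i<n. (norm (f a i))\<^sup>2) \<le> (1 / (real b)\<^sup>2) * (\<Sum>i<n. (norm (v (fst a) i))\<^sup>2)" for a
  proof -
    let ?v = "v (fst a)" and ?m = "mean (fst a)"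
    have "(\<Sum>i<n. (norm (?v i - ?m))\<^sup>2) = (\<Sum>i<n. (norm (?v i))\<^sup>2) - 2 * inner (\<Sum>i<n. ?v i) ?m + real n * (norm ?m)\<^sup>2"
      by (simp add: power2_norm_eq_inner inner_diff inner_commute sum.distrib sum_subtractf
          inner_sum_left inner_sum_right sum_distrib_left algebra_simps)
    also have "(\<Sum>i<n. ?v i) = real n *\<^sub>R ?m" using assms(1) by (simp add: mean_def)
    finally have "(\<Sum>i<n. (norm (?v i - ?m))\<^sup>2) \<le> (\<Sum>i<n. (norm (?v i))\<^sup>2)"
      by (simp add: power2_norm_eq_inner)
    then show ?thesis
      by (simp add: f_def power_divide sum_divide_distrib[symmetric] divide_right_mono)
  qed
  have "expect (index_pmf M n b) (\<lambda>J. (norm (\<xi> J))\<^sup>2)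
      = (\<Sum>a\<in>?A. expect ?U (\<lambda>i. (norm (f a i))\<^sup>2))"
    unfolding \<xi> index_pmf_def
    by (rule expectation_norm_sum_Pi_pmf) (simp, rule finU, rule zero)
  also have "\<dots> \<le> (\<Sum>a\<in>?A. (1 / (real b)\<^sup>2) * ((1 / real n) * (\<Sum>i<n. (norm (v (fst a) i))\<^sup>2)))"
    using divide_right_mono[OF var, of "real n"] by (intro sum_mono) (simp add: E)
  also have "\<dots> = (\<Sum>m<M. \<Sum>l<b. (1 / (real b)\<^sup>2) * ((1 / real n) * (\<Sum>i<n. (norm (v m i))\<^sup>2)))"
    by (subst sum.cartesian_product) (simp add: case_prod_unfold)
  also have "\<dots> = (1 / real b) * (\<Sum>m<M. (1 / real n) * (\<Sum>i<n. (norm (v m i))\<^sup>2))"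
    using assms(2) by (simp add: sum_distrib_left power2_eq_square)
  finally show ?variance .
qed

section \<open>The proximal operator\<close>

lemma vnorm_remb: "vnorm v = norm (remb 0 v)"
  by (simp add: norm_remb)

section \<open>Existence of a proximal point in a single block\<close>

text \<open>Completeness is taken from the reals, coordinate by coordinate, since the embedding
  space offers none.\<close>

lemma cauchy_vec_converges:
  fixes X :: "nat \<Rightarrow> real vec"
  assumes "\<And>k. X k \<in> carrier_vec d" and "\<And>e. 0 < e \<Longrightarrow> \<exists>N. \<forall>j\<ge>N. \<forall>k\<ge>N. vnorm (X j - X k) < e"
  obtains u where "u \<in> carrier_vec d" "(\<lambda>k. vnorm (X k - u)) \<longlonglongrightarrow> 0"
proof -
  have sq: "(vnorm v)\<^sup>2 = (\<Sum>i<d. (v $ i)\<^sup>2)" if "v \<in> carrier_vec d" for v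
    using norm_sum_remb[of 1 "\<lambda>_. v" d] that
    by (simp add: vnorm_def scalar_prod_def lessThan_atLeast0 sum_nonneg power2_eq_square)
  have le: "\<bar>v $ i\<bar> \<le> vnorm v" if "v \<in> carrier_vec d" "i < d" for v i
  proof -
    have "(v $ i)\<^sup>2 \<le> (vnorm v)\<^sup>2" unfolding sq[OF that(1)] by (rule member_le_sum) (use that in auto)
    moreover have "0 \<le> vnorm v" by (simp add: vnorm_remb)
    ultimately show ?thesis by (simp add: abs_le_square_iff[symmetric])
  qed
  have "\<exists>l. (\<lambda>k. X k $ i) \<longlonglongrightarrow> l" if "i < d" for i
  proof -
    have "Cauchy (\<lambda>k. X k $ i)"
    proof (rule metric_CauchyI)
      fix e :: real assume "0 < e"
      then obtain N where N: "\<And>j k. j \<ge> N \<Longrightarrow> k \<ge> N \<Longrightarrow> vnorm (X j - X k) < e" using assms(2) by blast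
      have "dist (X j $ i) (X k $ i) < e" if "j \<ge> N" "k \<ge> N" for j k
      proof -
        have "dist (X j $ i) (X k $ i) = \<bar>(X j - X k) $ i\<bar>"
          using assms(1)[of j] assms(1)[of k] \<open>i < d\<close> by (simp add: dist_real_def)
        also have "\<dots> \<le> vnorm (X j - X k)" using assms(1) \<open>i < d\<close> by (intro le) auto
        finally show ?thesis using N[OF that] by simp
      qed
      then show "\<exists>N. \<forall>j\<ge>N. \<forall>k\<ge>N. dist (X j $ i) (X k $ i) < e" by blast
    qed
    then show ?thesis by (simp add: Cauchy_convergent_iff convergent_def)
  qed
  then obtain l where l: "\<And>i. i < d \<Longrightarrow> (\<lambda>k. X k $ i) \<longlonglongrightarrow> l i" by metis
  define u where "u = vec d l"
  have u: "u \<in> carrier_vec d" by (simp add: u_def)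
  have "vnorm (X k - u) = sqrt (\<Sum>i<d. (X k $ i - l i)\<^sup>2)" for k
  proof -
    have C: "X k - u \<in> carrier_vec d" using assms(1) u by simp
    have "(vnorm (X k - u))\<^sup>2 = (\<Sum>i<d. (X k $ i - l i)\<^sup>2)"
      unfolding sq[OF C] using assms(1)[of k] by (intro sum.cong) (simp_all add: u_def)
    then show ?thesis by (simp add: real_sqrt_unique vnorm_remb)
  qed
  moreover have "(\<lambda>k. sqrt (\<Sum>i<d. (X k $ i - l i)\<^sup>2)) \<longlonglongrightarrow> sqrt (\<Sum>i<d. (l i - l i)\<^sup>2)"
    by (intro tendsto_real_sqrt tendsto_sum tendsto_power tendsto_diff tendsto_const l) auto
  ultimately have "(\<lambda>k. vnorm (X k - u)) \<longlonglongrightarrow> 0" by simp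
  then show ?thesis using that u by blast
qed

text \<open>A subgradient at one point bounds the objective from below; then strong convexity makes
  minimising sequences Cauchy.\<close>
lemma vec_prox_exists:
  assumes g: "proper_fun d g" "lsc_fun d g" "convex_fun d g"
    and zs: "zs \<in> carrier_vec d" "g zs = ereal r"
    and s: "s \<in> carrier_vec d" "\<And>z. z \<in> carrier_vec d \<Longrightarrow> g z \<ge> ereal (r + s \<bullet> (z - zs))"
    and c: "0 < c" and v: "v \<in> carrier_vec d"
  obtains u where "u \<in> carrier_vec d"
    "\<And>z. z \<in> carrier_vec d \<Longrightarrow> ereal c * g u + ereal ((vnorm (u - v))\<^sup>2 / 2) \<le> ereal c * g z + ereal ((vnorm (z - v))\<^sup>2 / 2)"
proof -
  define D where "D = dom_fun d g"
  define h where "h z = real_of_ereal (g z)" for z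
  have DC: "z \<in> carrier_vec d" if "z \<in> D" for z using that by (simp add: D_def dom_fun_def)
  have gh: "g z = ereal (h z)" if "z \<in> D" for z
    using that g(1) unfolding D_def dom_fun_def proper_fun_def h_def by (cases "g z") auto
  have gD: "g z = \<infinity>" if "z \<in> carrier_vec d" "z \<notin> D" for z
    using that by (simp add: D_def dom_fun_def)
  define \<phi> where "\<phi> z = c * h z + (vnorm (z - v))\<^sup>2 / 2" for z
  have zsD: "zs \<in> D" using zs by (simp add: D_def dom_fun_def)
  let ?e = "remb 0"
  \<comment> \<open>The subgradient inequality leaves c times the product of s and z - v, plus |z -
    v|^2 / 2; by Young's inequality this is at least - c^2 |s|^2 / 2, uniformly in z.\<close>
  have lower: "c * (r + inner (?e s) (?e v - ?e zs)) - c\<^sup>2 * (norm (?e s))\<^sup>2 / 2 \<le> \<phi> z" if "z \<in> D" for z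
  proof -
    have "ereal (r + s \<bullet> (z - zs)) \<le> ereal (h z)" using s(2)[OF DC[OF that]] gh[OF that] by simp
    then have "c * (r + s \<bullet> (z - zs)) \<le> c * h z" using c by simp
    moreover have "s \<bullet> (z - zs) = inner (?e s) (?e z - ?e zs)"
      using inner_remb[of s d "z - zs" 0 0] s DC[OF that] zs by (simp add: remb_linear[of _ d])
    moreover have "vnorm (z - v) = norm (?e z - ?e v)"
      using DC[OF that] v by (simp add: vnorm_remb remb_linear[of _ d])
    moreover have "2 * inner (- (c *\<^sub>R ?e s)) (?e z - ?e v) \<le> 1 * (norm (- (c *\<^sub>R ?e s)))\<^sup>2 + (norm (?e z - ?e v))\<^sup>2 / 1"
      by (rule young_inner) simp
    ultimately show ?thesis
      unfolding \<phi>_def by (simp add: inner_simps power_mult_distrib algebra_simps)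
  qed
  define m where "m = Inf (\<phi> ` D)"
  have bdd: "bdd_below (\<phi> ` D)" using lower by (auto simp: bdd_below_def)
  have m: "m \<le> \<phi> z" if "z \<in> D" for z unfolding m_def using bdd that by (intro cInf_lower) auto
  have "\<exists>z\<in>D. \<phi> z < m + 1 / real (Suc k)" for k
  proof -
    have "Inf (\<phi> ` D) < m + 1 / real (Suc k)" unfolding m_def by simp
    then show ?thesis using cInf_less_iff[OF _ bdd] zsD by auto
  qed
  then obtain X where X: "\<And>k. X k \<in> D" "\<And>k. \<phi> (X k) < m + 1 / real (Suc k)" by metis
  \<comment> \<open>Midpoint convexity of g, and the parallelogram law for the quadratic part; the
    factor 1/8 is 1/2 times 1/4.\<close>
  have mid: "(vnorm (x - y))\<^sup>2 / 8 \<le> (\<phi> x + \<phi> y) / 2 - m" if "x \<in> D" "y \<in> D" for x y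
  proof -
    define w where "w = (1 - 1 / 2) \<cdot>\<^sub>v x + (1 / 2) \<cdot>\<^sub>v y"
    have w: "w \<in> carrier_vec d" using DC[OF that(1)] DC[OF that(2)] by (simp add: w_def)
    have "g w \<le> ereal (1 - 1 / 2) * g x + ereal (1 / 2) * g y"
    proof -
      have "\<And>t. 0 < t \<and> t < 1 \<Longrightarrow> g ((1 - t) \<cdot>\<^sub>v x + t \<cdot>\<^sub>v y) \<le> ereal (1 - t) * g x + ereal t * g y"
        using g(3) DC[OF that(1)] DC[OF that(2)] unfolding convex_fun_def by blast
      from this[of "1 / 2"] show ?thesis unfolding w_def by simp
    qed
    then have gw: "g w \<le> ereal (h x / 2 + h y / 2)" by (simp add: gh that)
    then have wD: "w \<in> D" using w unfolding D_def dom_fun_def by (auto simp: less_top[symmetric] top_ereal_def)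
    then have "h w \<le> h x / 2 + h y / 2" using gw by (simp add: gh)
    then have "c * h w \<le> c * (h x / 2 + h y / 2)" using c by (intro mult_left_mono) auto
    moreover have "m \<le> \<phi> w" by (rule m[OF wD])
    ultimately have "2 * m \<le> c * h x + c * h y + (vnorm (w - v))\<^sup>2" unfolding \<phi>_def by (simp add: algebra_simps)
    define a b where "a = ?e x - ?e v" and "b = ?e y - ?e v"
    have eq: "vnorm (w - v) = norm ((1 / 2) *\<^sub>R (a + b))"
    proof -
      have "?e w - ?e v = (1 / 2) *\<^sub>R ?e x + (1 / 2) *\<^sub>R ?e y - ((1 / 2) *\<^sub>R ?e v + (1 / 2) *\<^sub>R ?e v)"
        using DC[OF that(1)] DC[OF that(2)]
        by (simp add: w_def remb_linear[of _ d] scaleR_add_left[symmetric])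
      also have "\<dots> = (1 / 2) *\<^sub>R (a + b)"
        unfolding a_def b_def scaleR_add_right scaleR_diff_right by simp
      finally show ?thesis using w v by (simp add: vnorm_remb remb_linear[of _ d])
    qed
    have sq: "(vnorm (w - v))\<^sup>2 = (norm (a + b))\<^sup>2 / 4" unfolding eq norm_scaleR by (simp add: power_divide)
    have n: "vnorm (x - y) = norm (a - b)" "vnorm (x - v) = norm a" "vnorm (y - v) = norm b"
      using DC[OF that(1)] DC[OF that(2)] v by (simp_all add: a_def b_def vnorm_remb remb_linear[of _ d])
    have par: "(norm (a + b))\<^sup>2 + (norm (a - b))\<^sup>2 = 2 * (norm a)\<^sup>2 + 2 * (norm b)\<^sup>2"
      by (simp add: power2_norm_eq_inner inner_simps inner_commute)
    have arith: "N / 8 \<le> (A + P / 2 + (B + Q / 2)) / 2 - m"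
      if "2 * m \<le> A + B + R" "R = T / 4" "T + N = 2 * P + 2 * Q" for A B N P Q R T m :: real
      using that by (simp add: field_simps)
    show ?thesis unfolding \<phi>_def n
      by (rule arith[OF \<open>2 * m \<le> c * h x + c * h y + (vnorm (w - v))\<^sup>2\<close> sq par])
  qed
  have cau: "(vnorm (X j - X k))\<^sup>2 \<le> 4 * (1 / real (Suc j) + 1 / real (Suc k))" for j k
  proof -
    have arith: "N \<le> 4 * (e + e')" if "N / 8 \<le> (P + Q) / 2 - m" "P < m + e" "Q < m + e'" for N P Q e e' :: real
      using that by (simp add: field_simps)
    show ?thesis by (rule arith[OF mid[OF X(1)[of j] X(1)[of k]] X(2)[of j] X(2)[of k]])
  qed
  obtain u where u: "u \<in> carrier_vec d" and lim: "(\<lambda>k. vnorm (X k - u)) \<longlonglongrightarrow> 0"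
  proof (rule cauchy_vec_converges[of X d])
    show "X k \<in> carrier_vec d" for k using DC X by blast
    fix e :: real assume e: "0 < e"
    obtain N where "8 / e\<^sup>2 < real N" using reals_Archimedean2 by blast
    then have N: "8 * (1 / real (Suc N)) < e\<^sup>2" using e by (simp add: field_simps) (smt (verit) zero_less_power)
    have "vnorm (X j - X k) < e" if "j \<ge> N" "k \<ge> N" for j k
    proof -
      have "1 / real (Suc j) \<le> 1 / real (Suc N)" "1 / real (Suc k) \<le> 1 / real (Suc N)"
        using that by (auto intro!: divide_left_mono)
      have arith: "V < E" if "V \<le> 4 * (p + q)" "p \<le> r" "q \<le> r" "8 * r < E" for V E p q r :: real
        using that by simp
      have "(vnorm (X j - X k))\<^sup>2 < e\<^sup>2"
        by (rule arith[OF cau[of j k]]) (use N \<open>1 / real (Suc j) \<le> 1 / real (Suc N)\<close> \<open>1 / real (Suc k) \<le> 1 / real (Suc N)\<close> in auto)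
      then show ?thesis using e by (simp add: power2_less_imp_less)
    qed
    then show "\<exists>N. \<forall>j\<ge>N. \<forall>k\<ge>N. vnorm (X j - X k) < e" by blast
  qed
  have limv: "(\<lambda>k. vnorm (X k - v)) \<longlonglongrightarrow> vnorm (u - v)"
  proof (rule LIM_zero_cancel, rule Lim_null_comparison[OF _ lim], intro always_eventually allI)
    fix k
    have "vnorm (X k - v) = norm (?e (X k) - ?e v)" "vnorm (u - v) = norm (?e u - ?e v)"
      "vnorm (X k - u) = norm (?e (X k) - ?e u)"
      using DC[OF X(1)] u v by (simp_all add: vnorm_remb remb_linear[of _ d])
    then show "norm (vnorm (X k - v) - vnorm (u - v)) \<le> vnorm (X k - u)"
      using norm_triangle_ineq3[of "?e (X k) - ?e v" "?e u - ?e v"] by simp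
  qed
  \<comment> \<open>Lower semicontinuity at the limit: a number t strictly between the bound and g u
    would eventually stay below g along the sequence, contradicting that the sequence is
    minimising.\<close>
  have bound: "g u \<le> ereal ((m - (vnorm (u - v))\<^sup>2 / 2) / c)"
  proof (rule ccontr)
    assume "\<not> ?thesis"
    then obtain t where t: "ereal ((m - (vnorm (u - v))\<^sup>2 / 2) / c) < ereal t" "ereal t < g u"
      using ereal_dense2 by (metis not_le)
    then obtain \<rho> where \<rho>: "0 < \<rho>" "\<And>y. y \<in> carrier_vec d \<Longrightarrow> vnorm (y - u) < \<rho> \<Longrightarrow> ereal t < g y"
      using g(2) u unfolding lsc_fun_def by blast
    have "eventually (\<lambda>k. vnorm (X k - u) < \<rho>) sequentially" using order_tendstoD(2)[OF lim \<rho>(1)] .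
    then have "eventually (\<lambda>k. t \<le> (m + 1 / real (Suc k) - (vnorm (X k - v))\<^sup>2 / 2) / c) sequentially"
    proof (rule eventually_mono)
      fix k assume "vnorm (X k - u) < \<rho>"
      then have "t < h (X k)" using \<rho>(2)[OF DC[OF X(1)[of k]]] gh[OF X(1)[of k]] by simp
      then have ct: "c * t \<le> c * h (X k)" using c by simp
      have "c * t \<le> m + 1 / real (Suc k) - (vnorm (X k - v))\<^sup>2 / 2"
        by (rule order_trans[OF ct]) (use X(2)[of k] in \<open>simp add: \<phi>_def\<close>)
      then show "t \<le> (m + 1 / real (Suc k) - (vnorm (X k - v))\<^sup>2 / 2) / c"
        using c by (simp add: pos_le_divide_eq mult.commute)
    qed
    moreover have "(\<lambda>k. (m + 1 / real (Suc k) - (vnorm (X k - v))\<^sup>2 / 2) / c) \<longlonglongrightarrow> (m + 0 - (vnorm (u - v))\<^sup>2 / 2) / c"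
      using c by (intro tendsto_intros limv LIMSEQ_Suc[OF lim_1_over_n]) auto
    ultimately have "t \<le> (m + 0 - (vnorm (u - v))\<^sup>2 / 2) / c"
      by (intro tendsto_lowerbound[of _ _ sequentially]) auto
    then show False using t(1) by simp
  qed
  then have uD: "u \<in> D" using u unfolding D_def dom_fun_def by (auto simp: less_top[symmetric] top_ereal_def)
  have "h u \<le> (m - (vnorm (u - v))\<^sup>2 / 2) / c" using bound by (simp add: gh[OF uD])
  then have min: "\<phi> u \<le> m" using c unfolding \<phi>_def by (simp add: pos_le_divide_eq mult.commute)
  show ?thesis
  proof (rule that[OF u])
    fix z :: "real vec" assume z: "z \<in> carrier_vec d"
    show "ereal c * g u + ereal ((vnorm (u - v))\<^sup>2 / 2) \<le> ereal c * g z + ereal ((vnorm (z - v))\<^sup>2 / 2)"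
    proof (cases "z \<in> D")
      case True
      have "\<phi> u \<le> \<phi> z" using min m[OF True] by linarith
      then show ?thesis by (simp add: gh uD True \<phi>_def)
    next
      case False
      then show ?thesis using gD[OF z] c by simp
    qed
  qed
qed

section \<open>The proximal step of the lifted problem\<close>

lemma ereal_mult_sum:
  assumes "0 < c"
  shows "ereal c * (\<Sum>i\<in>I. f i) = (\<Sum>i\<in>I. ereal c * f i)"
proof (induction I rule: infinite_finite_induct)
  case (insert i I)
  have "ereal c * (x + y) = ereal c * x + ereal c * y" for x y
    using assms by (cases x; cases y) (auto simp: algebra_simps)
  then show ?case using insert by simp
qed (simp_all add: zero_ereal_def)

text \<open>The objective separates over the rows, each with step \<eta> / M because
  \<open>lifted_fun\<close> is an average; so a lifted minimiser can be assembled from minimisers in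
  single blocks.\<close>

lemma prox_objective:
  assumes "U \<in> carrier_mat M d" "V \<in> carrier_mat M d" "0 < M" "0 < \<eta>"
  shows "ereal \<eta> * lifted_fun M g U + ereal ((mnorm (U - V))\<^sup>2 / 2)
    = (\<Sum>m<M. ereal (\<eta> / real M) * g (row U m) + ereal ((vnorm (row U m - row V m))\<^sup>2 / 2))"
proof -
  have "ereal \<eta> * lifted_fun M g U = ereal (\<eta> / real M) * (\<Sum>m<M. g (row U m))"
    by (simp add: lifted_fun_def mult.assoc[symmetric])
  also have "\<dots> = (\<Sum>m<M. ereal (\<eta> / real M) * g (row U m))"
    using assms by (intro ereal_mult_sum) simp
  finally have 1: "ereal \<eta> * lifted_fun M g U = (\<Sum>m<M. ereal (\<eta> / real M) * g (row U m))" .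
  have "(mnorm (U - V))\<^sup>2 = (norm (emb (U - V)))\<^sup>2" by (simp add: norm_emb)
  also have "emb (U - V) = (\<Sum>m<M. remb m (row U m - row V m))"
    unfolding emb_linear(2)[OF assms(1,2)] using assms(1,2)
    by (auto simp: emb_def sum_subtractf[symmetric] remb_linear[of _ d] intro!: sum.cong)
  also have "(norm \<dots>)\<^sup>2 = (\<Sum>m<M. (vnorm (row U m - row V m))\<^sup>2)"
    by (rule norm_sum_remb[of M _ d]) (use assms in auto)
  finally have "(mnorm (U - V))\<^sup>2 / 2 = (\<Sum>m<M. (vnorm (row U m - row V m))\<^sup>2 / 2)"
    by (simp add: sum_divide_distrib)
  then show ?thesis unfolding 1 by (simp add: sum.distrib)
qed

text \<open>Division by t and the limit t \<rightarrow> 0 turn minimality along a segment into a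
  first-order condition.\<close>

lemma le_of_le_plus_small:
  fixes A B K :: real
  assumes "\<And>t. 0 < t \<Longrightarrow> t < 1 \<Longrightarrow> t * A \<le> t * B + t\<^sup>2 * K"
  shows "A \<le> B"
proof (rule tendsto_lowerbound)
  have "((\<lambda>t. B + t * K) \<longlongrightarrow> B + 0 * K) (at_right 0)" by (intro tendsto_intros)
  then show "((\<lambda>t. B + t * K) \<longlongrightarrow> B) (at_right 0)" by simp
  have "A \<le> B + t * K" if "0 < t" "t < 1" for t
  proof -
    have "t * A \<le> t * (B + t * K)" using assms[OF that] by (simp add: power2_eq_square algebra_simps)
    then show ?thesis using that by simp
  qed
  then show "\<forall>\<^sub>F t in at_right 0. A \<le> B + t * K"
    by (intro eventually_at_rightI[of 0 1]) auto
qed simp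

text \<open>Minimality of U along the segment towards Zs gives a first-order condition involving the
  values of g on the rows of U and at zs; the subgradient s then replaces their differences by a
  linear term.\<close>

lemma prox_inequality:
  assumes g: "proper_fun d g" "lsc_fun d g" "convex_fun d g"
    and zs: "zs \<in> carrier_vec d" "g zs = ereal r"
    and s: "s \<in> carrier_vec d" "\<And>z. z \<in> carrier_vec d \<Longrightarrow> g z \<ge> ereal (r + s \<bullet> (z - zs))"
    and \<eta>: "0 < \<eta>" and M: "0 < M" and V: "V \<in> carrier_mat M d"
  defines "U \<equiv> prox d M \<eta> (lifted_fun M g) V"
    and "Zs \<equiv> mat\<^sub>r M d (\<lambda>_. zs)" and "S \<equiv> mat\<^sub>r M d (\<lambda>_. s)"
  shows "U \<in> carrier_mat M d"
    and "inner (emb U - emb V) (emb U - emb Zs) \<le> - (\<eta> / real M) * inner (emb S) (emb U - emb Zs)"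
proof -
  let ?J = "\<lambda>U. ereal \<eta> * lifted_fun M g U + ereal ((mnorm (U - V))\<^sup>2 / 2)"
  have c: "0 < \<eta> / real M" using \<eta> M by simp
  have "\<exists>u. u \<in> carrier_vec d \<and> (\<forall>z\<in>carrier_vec d. ereal (\<eta> / real M) * g u + ereal ((vnorm (u - row V m))\<^sup>2 / 2)
      \<le> ereal (\<eta> / real M) * g z + ereal ((vnorm (z - row V m))\<^sup>2 / 2))" if "m < M" for m
    using vec_prox_exists[OF g zs s c, of "row V m"] V that by (metis row_carrier_vec)
  then obtain u where u: "\<And>m. m < M \<Longrightarrow> u m \<in> carrier_vec d"
    "\<And>m z. m < M \<Longrightarrow> z \<in> carrier_vec d \<Longrightarrow> ereal (\<eta> / real M) * g (u m) + ereal ((vnorm (u m - row V m))\<^sup>2 / 2)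
      \<le> ereal (\<eta> / real M) * g z + ereal ((vnorm (z - row V m))\<^sup>2 / 2)" by metis
  define U0 where "U0 = mat\<^sub>r M d u"
  have U0: "U0 \<in> carrier_mat M d" by (simp add: U0_def)
  have U0_min: "?J U0 \<le> ?J Z" if Z: "Z \<in> carrier_mat M d" for Z
    unfolding prox_objective[OF U0 V M \<eta>] prox_objective[OF Z V M \<eta>]
  proof (rule sum_mono)
    fix m assume "m \<in> {..<M}"
    then have m: "m < M" by simp
    have "row U0 m = u m" using u(1)[OF m] m by (simp add: U0_def)
    then show "ereal (\<eta> / real M) * g (row U0 m) + ereal ((vnorm (row U0 m - row V m))\<^sup>2 / 2)
        \<le> ereal (\<eta> / real M) * g (row Z m) + ereal ((vnorm (row Z m - row V m))\<^sup>2 / 2)"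
      using u(2)[OF m, of "row Z m"] Z m by simp
  qed
  \<comment> \<open>\<open>arg_min_on\<close> is an arbitrary choice unless a minimiser exists; U0
    is one.\<close>
  have "U \<in> carrier_mat M d \<and> (\<forall>Z\<in>carrier_mat M d. ?J U \<le> ?J Z)"
    unfolding U_def prox_def arg_min_on_def
  proof (rule arg_minI[where P = "\<lambda>x. x \<in> carrier_mat M d" and f = ?J
        and Q = "\<lambda>U. U \<in> carrier_mat M d \<and> (\<forall>Z\<in>carrier_mat M d. ?J U \<le> ?J Z)"])
    show "U0 \<in> carrier_mat M d" by (rule U0)
    show "\<not> ?J y < ?J U0" if "y \<in> carrier_mat M d" for y
      using U0_min[OF that] by (simp only: not_less)
    show "x \<in> carrier_mat M d \<and> (\<forall>Z\<in>carrier_mat M d. ?J x \<le> ?J Z)"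
      if "x \<in> carrier_mat M d" "\<forall>y. y \<in> carrier_mat M d \<longrightarrow> \<not> ?J y < ?J x" for x
      using that unfolding not_less by blast
  qed
  then have U: "U \<in> carrier_mat M d" and min: "\<And>Z. Z \<in> carrier_mat M d \<Longrightarrow> ?J U \<le> ?J Z" by auto
  show "U \<in> carrier_mat M d" by (rule U)
  have Zs: "Zs \<in> carrier_mat M d" by (simp add: Zs_def)
  have rowZs: "row Zs m = zs" if "m < M" for m using that zs by (simp add: Zs_def)
  define h where "h z = real_of_ereal (g z)" for z
  have gh: "g z = ereal (h z)" if "z \<in> carrier_vec d" "g z \<noteq> \<infinity>" for z
    using that g(1) unfolding proper_fun_def h_def by (cases "g z") auto
  have real_J: "?J Z = ereal ((\<Sum>m<M. \<eta> / real M * h (row Z m)) + (norm (emb Z - emb V))\<^sup>2 / 2)"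
    if Z: "Z \<in> carrier_mat M d" "\<And>m. m < M \<Longrightarrow> g (row Z m) \<noteq> \<infinity>" for Z
  proof -
    have "g (row Z m) = ereal (h (row Z m))" if "m < M" for m using gh[of "row Z m"] Z that by simp
    then have "lifted_fun M g Z = ereal ((\<Sum>m<M. h (row Z m)) / real M)" by (simp add: lifted_fun_def)
    moreover have "mnorm (Z - V) = norm (emb Z - emb V)"
      by (simp add: norm_emb[symmetric] emb_linear(2)[OF Z(1) V])
    ultimately show ?thesis by (simp add: sum_distrib_left sum_divide_distrib)
  qed
  have JZs: "?J Zs \<noteq> \<infinity>" using real_J[OF Zs] rowZs zs by simp
  \<comment> \<open>The value at Zs is finite, hence so is the minimum, and each row of U lies in
    the domain of g.\<close>
  have fin: "g (row U m) \<noteq> \<infinity>" if m: "m < M" for m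
  proof
    assume inf: "g (row U m) = \<infinity>"
    have "ereal (\<eta> / real M) * g (row U m) + ereal ((vnorm (row U m - row V m))\<^sup>2 / 2) = \<infinity>"
      using inf c M \<eta> by simp
    then have "?J U = \<infinity>" unfolding prox_objective[OF U V M \<eta>] using m by (subst sum_Pinfty) auto
    then show False using min[OF Zs] JZs by (metis ereal_infty_less_eq(1))
  qed
  define A where "A = (\<Sum>m<M. \<eta> / real M * (h (row U m) - r))"
  define x q where "x = emb U - emb V" and "q = emb Zs - emb U"
  have "A \<le> inner x q"
  proof (rule le_of_le_plus_small)
    fix t :: real assume t: "0 < t" "t < 1"
    define Z where "Z = (1 - t) \<cdot>\<^sub>m U + t \<cdot>\<^sub>m Zs"
    have Z: "Z \<in> carrier_mat M d" using U Zs by (simp add: Z_def)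
    have rZ: "row Z m = (1 - t) \<cdot>\<^sub>v row U m + t \<cdot>\<^sub>v zs" if "m < M" for m
      using that U Zs rowZs[OF that] by (simp add: Z_def)
    have cv: "g (row Z m) \<le> ereal ((1 - t) * h (row U m) + t * r)" if "m < M" for m
    proof -
      have C: "row U m \<in> carrier_vec d" using U that by simp
      have "g ((1 - t) \<cdot>\<^sub>v row U m + t \<cdot>\<^sub>v zs) \<le> ereal (1 - t) * g (row U m) + ereal t * g zs"
        using g(3) C zs(1) t unfolding convex_fun_def by blast
      then show ?thesis using gh[OF C fin[OF that]] zs(2) rZ[OF that] by simp
    qed
    have finZ: "g (row Z m) \<noteq> \<infinity>" if "m < M" for m using cv[OF that] by auto
    have hZ: "h (row Z m) \<le> (1 - t) * h (row U m) + t * r" if "m < M" for m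
      using cv[OF that] gh[OF _ finZ[OF that]] Z that by simp
    have "(\<Sum>m<M. \<eta> / real M * h (row U m)) + (norm x)\<^sup>2 / 2 \<le> (\<Sum>m<M. \<eta> / real M * h (row Z m)) + (norm (emb Z - emb V))\<^sup>2 / 2"
    proof -
      have "?J U = ereal ((\<Sum>m<M. \<eta> / real M * h (row U m)) + (norm (emb U - emb V))\<^sup>2 / 2)"
        by (rule real_J[OF U fin])
      moreover have "?J Z = ereal ((\<Sum>m<M. \<eta> / real M * h (row Z m)) + (norm (emb Z - emb V))\<^sup>2 / 2)"
        by (rule real_J[OF Z finZ])
      ultimately show ?thesis using min[OF Z] unfolding x_def by (metis ereal_less_eq(3))
    qed
    also have "(\<Sum>m<M. \<eta> / real M * h (row Z m)) \<le> (\<Sum>m<M. \<eta> / real M * ((1 - t) * h (row U m) + t * r))"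
      using c by (intro sum_mono mult_left_mono hZ) auto
    also have "\<dots> = (\<Sum>m<M. \<eta> / real M * h (row U m)) - t * A"
      unfolding A_def by (simp add: sum_distrib_left sum_subtractf[symmetric] algebra_simps)
    also have "emb Z - emb V = x + t *\<^sub>R q"
      unfolding Z_def x_def q_def using U Zs by (simp add: emb_linear[of _ M d] algebra_simps)
    also have "(norm (x + t *\<^sub>R q))\<^sup>2 = (norm x)\<^sup>2 + 2 * t * inner x q + t\<^sup>2 * (norm q)\<^sup>2"
      unfolding power2_norm_eq_inner by (simp add: inner_simps inner_commute power2_eq_square)
    finally show "t * A \<le> t * inner x q + t\<^sup>2 * ((norm q)\<^sup>2 / 2)" by (simp add: add_divide_distrib)
  qed
  moreover have "\<eta> / real M * inner (emb S) (emb U - emb Zs) \<le> A"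
  proof -
    have "emb U - emb Zs = (\<Sum>m<M. remb m (row U m - zs))"
      using U Zs zs(1) rowZs
      by (auto simp: emb_def sum_subtractf[symmetric] remb_linear[of _ d] intro!: sum.cong)
    moreover have "emb S = (\<Sum>m<M. remb m s)" unfolding S_def by (rule emb_mat_of_rows) (rule s(1))
    ultimately have S: "inner (emb S) (emb U - emb Zs) = (\<Sum>m<M. s \<bullet> (row U m - zs))"
      using s(1) zs(1) U by (simp add: inner_sum_remb[of M _ d])
    have "s \<bullet> (row U m - zs) \<le> h (row U m) - r" if "m < M" for m
      using s(2)[of "row U m"] gh[OF _ fin[OF that]] U that by simp
    then show ?thesis
      unfolding A_def S sum_distrib_left using c by (intro sum_mono mult_left_mono) auto
  qed
  moreover have "inner x q = - inner (emb U - emb V) (emb U - emb Zs)"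
    by (simp add: x_def q_def inner_diff_right)
  ultimately show "inner (emb U - emb V) (emb U - emb Zs) \<le> - (\<eta> / real M) * inner (emb S) (emb U - emb Zs)"
    by simp
qed

section \<open>Parameters and Lyapunov function\<close>

text \<open>1 - \<alpha> is the minimum of three rates, so it suffices to bound their reciprocals:
  with q = 1 / (\<eta> \<mu>) they are 4 q, something at most 20 L / \<mu>, and 2 q + 1 / p. The
  constant 144 is 4 times the 36 in the bound on q.\<close>

lemma parameter_bounds:
  fixes \<chi> L Lb \<mu> p \<gamma> \<eta> \<beta> \<theta> \<alpha> :: real and b :: nat
  assumes \<chi>: "1 \<le> \<chi>" "\<chi> \<le> 5" and pos: "0 < L" "0 < Lb" "0 < \<mu>" and \<mu>L: "\<mu> \<le> L"
    and b: "1 \<le> b" and p: "0 < p" "p \<le> 1 / 8" and \<gamma>: "\<gamma> = p"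
    and \<eta>: "\<eta> = min (sqrt (\<gamma> * real b) / (4 * Lb)) (1 / (16 * L * sqrt \<chi>))"
    and \<beta>: "\<beta> = min (\<mu> / (4 * L\<^sup>2)) (real b * \<gamma> / (4 * \<eta> * Lb\<^sup>2))"
    and \<theta>: "\<theta> = min (1 / (2 * \<beta>)) (1 / (16 * \<eta>))"
    and \<alpha>: "\<alpha> = max (max (1 - \<mu> * \<eta> / 4) (1 - \<beta> * \<theta> * inverse \<chi>)) (1 - p * \<eta> * \<mu> / (2 * \<gamma> + \<eta> * \<mu>))"
  shows "0 < \<eta>" "0 < \<beta>" "0 < \<theta>" "\<eta> * L \<le> 1 / 16" "\<eta>\<^sup>2 * Lb\<^sup>2 \<le> \<gamma> * real b / 16"
    "\<beta> * L\<^sup>2 \<le> \<mu> / 4" "\<eta> * \<beta> * (Lb\<^sup>2 / real b) \<le> \<gamma> / 4" "\<theta> \<le> 1 / (2 * \<beta>)" "16 * \<eta> * \<theta> \<le> 1"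
    "1 - \<eta> * \<mu> / 4 \<le> \<alpha>" "1 - \<beta> * \<theta> / \<chi> \<le> \<alpha>" "1 - p * \<eta> * \<mu> / (2 * \<gamma> + \<eta> * \<mu>) \<le> \<alpha>" "63 / 64 \<le> \<alpha>" "\<alpha> < 1" "\<eta> * \<mu> \<le> 1"
    "1 / (1 - \<alpha>) \<le> 144 * (1 / p + 1 / sqrt (p * real b) * (Lb / \<mu>) + L / \<mu>)"
proof -
  have g: "0 < \<gamma>" "\<gamma> \<le> 1 / 8" and rb: "0 < real b" using p \<gamma> b by auto
  \<comment> \<open>(9/4)^2 = 81/16 > 5.\<close>
  have "sqrt \<chi> \<le> 9 / 4" by (rule real_le_lsqrt) (use \<chi> in \<open>simp_all add: power2_eq_square\<close>)
  then have sx: "1 \<le> sqrt \<chi>" "sqrt \<chi> \<le> 9 / 4" using \<chi> by simp_all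
  show \<eta>0: "0 < \<eta>" using g rb pos sx unfolding \<eta> by simp
  have \<eta>1: "\<eta> \<le> sqrt (\<gamma> * real b) / (4 * Lb)" and \<eta>2: "\<eta> \<le> 1 / (16 * L * sqrt \<chi>)" unfolding \<eta> by auto
  show \<beta>0: "0 < \<beta>" using g rb pos \<eta>0 unfolding \<beta> by simp
  show \<theta>0: "0 < \<theta>" using \<beta>0 \<eta>0 unfolding \<theta> by simp
  have "\<eta> * L * sqrt \<chi> \<le> 1 / 16" using \<eta>2 pos sx by (simp add: field_simps)
  moreover have "\<eta> * L * 1 \<le> \<eta> * L * sqrt \<chi>" using \<eta>0 pos sx by (intro mult_left_mono) auto
  ultimately show \<eta>L: "\<eta> * L \<le> 1 / 16" by simp
  have "\<eta> * Lb \<le> sqrt (\<gamma> * real b) / 4" using \<eta>1 pos by (simp add: field_simps)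
  then have "(\<eta> * Lb)\<^sup>2 \<le> (sqrt (\<gamma> * real b) / 4)\<^sup>2" using \<eta>0 pos by (intro power_mono) auto
  then show \<eta>Lb: "\<eta>\<^sup>2 * Lb\<^sup>2 \<le> \<gamma> * real b / 16" using g rb by (simp add: power_mult_distrib power_divide)
  have \<beta>1: "\<beta> \<le> \<mu> / (4 * L\<^sup>2)" and \<beta>2: "\<beta> \<le> real b * \<gamma> / (4 * \<eta> * Lb\<^sup>2)" unfolding \<beta> by auto
  show "\<beta> * L\<^sup>2 \<le> \<mu> / 4" using \<beta>1 pos by (simp add: field_simps)
  have "\<beta> * (4 * \<eta> * Lb\<^sup>2) \<le> real b * \<gamma>" using \<beta>2 pos \<eta>0 by (simp add: pos_le_divide_eq)
  then show "\<eta> * \<beta> * (Lb\<^sup>2 / real b) \<le> \<gamma> / 4" using rb by (simp add: field_simps)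
  show "\<theta> \<le> 1 / (2 * \<beta>)" unfolding \<theta> by simp
  have "\<theta> \<le> 1 / (16 * \<eta>)" unfolding \<theta> by simp
  then show "16 * \<eta> * \<theta> \<le> 1" using \<eta>0 by (simp add: field_simps)
  show \<alpha>1: "1 - \<eta> * \<mu> / 4 \<le> \<alpha>" unfolding \<alpha> mult.commute[of \<eta> \<mu>] by (rule order_trans[OF max.cobounded1 max.cobounded1])
  show "1 - \<beta> * \<theta> / \<chi> \<le> \<alpha>"
    unfolding \<alpha> divide_inverse[of "\<beta> * \<theta>" \<chi>] by (rule order_trans[OF max.cobounded2 max.cobounded1])
  show "1 - p * \<eta> * \<mu> / (2 * \<gamma> + \<eta> * \<mu>) \<le> \<alpha>" unfolding \<alpha> by (rule max.cobounded2)
  have "\<eta> * \<mu> \<le> \<eta> * L" using \<mu>L \<eta>0 by (intro mult_left_mono) auto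
  then have \<eta>\<mu>: "\<eta> * \<mu> \<le> 1 / 16" using \<eta>L by linarith
  then show "\<eta> * \<mu> \<le> 1" by simp
  \<comment> \<open>\<eta> \<mu> / 4 \<le> 1/64 because \<mu> \<le> L. The bound lets \<alpha>
    multiply terms whose constants have slack.\<close>
  show "63 / 64 \<le> \<alpha>" using \<alpha>1 \<eta>\<mu> by linarith
  have a0: "0 < \<eta> * \<mu>" using \<eta>0 pos by simp
  define u v w q where "u = 1 / p" and "v = 1 / sqrt (p * real b) * (Lb / \<mu>)" and "w = L / \<mu>"
    and "q = 1 / (\<eta> * \<mu>)"
  have Xparts: "0 < u" "0 < v" "0 < w" using p rb pos by (auto simp: u_def v_def w_def)
  define A1 where "A1 = \<mu> * \<eta> / 4"
  define A2 where "A2 = \<beta> * \<theta> * inverse \<chi>"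
  define A3 where "A3 = p * \<eta> * \<mu> / (2 * \<gamma> + \<eta> * \<mu>)"
  have A: "0 < A1" "0 < A2" "0 < A3"
    unfolding A1_def A2_def A3_def using \<beta>0 \<theta>0 \<chi>(1) p g(1) pos(3) \<eta>0
    by (simp_all add: add_pos_pos)
  have "1 - max (max (1 - u) (1 - v)) (1 - w) = min (min u v) w" for u v w :: real
    by (auto simp: min_def max_def)
  then have \<alpha>A: "1 - \<alpha> = min (min A1 A2) A3" unfolding \<alpha> A1_def A2_def A3_def .
  have "0 < min (min A1 A2) A3" using A by simp
  then show "\<alpha> < 1" unfolding \<alpha>A[symmetric] by simp
  have inv_eta: "q \<le> 36 * v + 36 * w"
  proof -
    \<comment> \<open>The reciprocal of a minimum is at most the sum of the reciprocals; 36 is 16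
      times 9/4.\<close>
    have "1 / \<eta> \<le> 4 * Lb / sqrt (p * real b) + 16 * L * sqrt \<chi>"
    proof -
      have pb: "0 < sqrt (p * real b)" using p rb by simp
      have "1 / \<eta> = 4 * Lb / sqrt (p * real b) \<or> 1 / \<eta> = 16 * L * sqrt \<chi>"
        unfolding \<eta> \<gamma> min_def by simp
      moreover have "0 < 4 * Lb / sqrt (p * real b)" "0 < 16 * L * sqrt \<chi>" using pos pb sx by simp_all
      ultimately show ?thesis by linarith
    qed
    also have "\<dots> \<le> 4 * Lb / sqrt (p * real b) + 16 * L * (9 / 4)" using pos sx by (intro add_left_mono mult_left_mono) auto
    finally have "1 / \<eta> / \<mu> \<le> (4 * Lb / sqrt (p * real b) + 16 * L * (9 / 4)) / \<mu>" using pos by (intro divide_right_mono) auto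
    also have "\<dots> = 4 * v + 36 * w" by (simp add: v_def w_def add_divide_distrib)
    finally have "q \<le> 4 * v + 36 * w" by (simp add: q_def)
    then show ?thesis using Xparts by linarith
  qed
  have "1 / A1 \<le> 144 * u + 144 * v + 144 * w"
  proof -
    have "1 / A1 = 4 * q" by (simp add: A1_def q_def mult.commute)
    then show ?thesis using inv_eta Xparts by linarith
  qed
  moreover have "1 / A3 \<le> 144 * u + 144 * v + 144 * w"
  proof -
    have "1 / A3 = (2 * p + \<eta> * \<mu>) / (p * (\<eta> * \<mu>))" unfolding A3_def \<gamma> by (simp add: mult.assoc)
    also have "\<dots> = 2 * q + u"
    proof -
      have "(2 * p + x) / (p * x) = 2 * (1 / x) + 1 / p" if "0 < x" for x
        using p that by (simp add: add_divide_distrib)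
      from this[OF a0] show ?thesis unfolding q_def u_def .
    qed
    finally show ?thesis using inv_eta Xparts by linarith
  qed
  moreover have "1 / A2 \<le> 144 * u + 144 * v + 144 * w"
  proof -
    have r: "\<mu> / L \<le> 1" using \<mu>L pos by simp
    \<comment> \<open>Both candidates for \<beta> are at least 4 \<eta> \<mu> / L, so \<beta>
      \<theta>, the minimum of 1/2 and \<beta> / (16 \<eta>), is at least \<mu> / (4 L).\<close>
    have "4 * \<eta> * (\<mu> / L) \<le> \<mu> / (4 * L\<^sup>2)"
    proof -
      have "(\<eta> * L) * (16 * \<mu>) \<le> 1 / 16 * (16 * \<mu>)" using \<eta>L pos by (intro mult_right_mono) auto
      then show ?thesis using pos by (simp add: field_simps power2_eq_square)
    qed
    moreover have "4 * \<eta> * (\<mu> / L) \<le> real b * \<gamma> / (4 * \<eta> * Lb\<^sup>2)"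
    proof -
      have "4 * \<eta> * (\<mu> / L) \<le> 4 * \<eta> * 1" using r \<eta>0 by (intro mult_left_mono) auto
      also have "\<dots> \<le> real b * \<gamma> / (4 * \<eta> * Lb\<^sup>2)"
      proof -
        have "4 * \<eta> * (4 * \<eta> * Lb\<^sup>2) \<le> real b * \<gamma>"
          using \<eta>Lb by (simp add: power2_eq_square algebra_simps)
        then show ?thesis using \<eta>0 pos by (simp add: pos_le_divide_eq)
      qed
      finally show ?thesis .
    qed
    ultimately have "4 * \<eta> * (\<mu> / L) \<le> \<beta>" unfolding \<beta> by simp
    then have "\<mu> / (4 * L) \<le> \<beta> / (16 * \<eta>)" using \<eta>0 by (simp add: field_simps)
    moreover have "\<mu> / (4 * L) \<le> 1 / 2" using r pos by (simp add: field_simps)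
    moreover have "\<beta> * \<theta> = min (1 / 2) (\<beta> / (16 * \<eta>))"
      unfolding \<theta> using \<beta>0 by (simp add: min_mult_distrib_left)
    ultimately have bt: "\<mu> / (4 * L) \<le> \<beta> * \<theta>" by simp
    have "1 / A2 = \<chi> * (1 / (\<beta> * \<theta>))" unfolding A2_def using \<chi> by (simp add: field_simps)
    also have "\<dots> \<le> 5 * (1 / (\<mu> / (4 * L)))"
      using bt \<chi> pos \<beta>0 \<theta>0 by (intro mult_mono divide_left_mono) auto
    also have "\<dots> = 20 * w" by (simp add: w_def)
    finally show ?thesis using Xparts by linarith
  qed
  ultimately show "1 / (1 - \<alpha>) \<le> 144 * (1 / p + 1 / sqrt (p * real b) * (Lb / \<mu>) + L / \<mu>)"
    unfolding \<alpha>A u_def[symmetric] v_def[symmetric] w_def[symmetric] distrib_left by (simp add: min_def)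
qed

text \<open>Coefficients are compared one by one. T carries the factor \<alpha> on both sides, so
  its sign does not matter; the other quantities are nonnegative.\<close>

lemma lyapunov_arith:
  fixes \<chi> p \<gamma> \<eta> \<mu> \<beta> \<theta> \<alpha> \<omega> Z2 W2 V2 X2 Yd Nd Ns T :: real
  assumes pos: "0 < \<eta>" "0 < \<mu>" "0 < \<theta>" "0 < p" "p \<le> 1 / 8" "\<gamma> = p"
    and th: "16 * \<eta> * \<theta> \<le> 1" and al: "1 - \<eta> * \<mu> / 4 \<le> \<alpha>" "1 - \<beta> * \<theta> / \<chi> \<le> \<alpha>"
      "1 - p * \<eta> * \<mu> / (2 * \<gamma> + \<eta> * \<mu>) \<le> \<alpha>" "63 / 64 \<le> \<alpha>" and a1: "\<eta> * \<mu> \<le> 1"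
    and \<omega>: "\<omega> = (\<gamma> + \<eta> * \<mu> / 2) / p"
    and nn: "0 \<le> Z2" "0 \<le> W2" "0 \<le> V2" "0 \<le> X2" "0 \<le> Yd" "Yd \<le> Nd" "0 \<le> Ns"
  shows "(1 - \<gamma>) * Z2 + \<gamma> * W2 + X2 / 16 + \<alpha> * T + 4 * \<eta>\<^sup>2 * Yd + \<eta> * ((1 - \<beta> * \<theta> / \<chi>) / \<theta> * Ns)
      + \<gamma> / 2 * (V2 + X2) + \<omega> * (p * Z2 + (1 - p) * W2)
    \<le> \<alpha> * ((1 + \<eta> * \<mu>) * Z2 + \<omega> * W2 + 3 * \<gamma> / 4 * V2 + 5 / 16 * X2 + \<eta> / (2 * \<theta>) * Nd + \<eta> / \<theta> * Ns + T)"
proof -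
  have a: "0 < \<eta> * \<mu>" using pos by simp
  \<comment> \<open>The left side is the total coefficient 1 - \<gamma> + \<omega> p of Z2. The
    bound is (1 - x/4) (1 + x) = 1 + x/2 + (x - x^2)/4 for x = \<eta> \<mu>.\<close>
  have "1 + \<eta> * \<mu> / 2 \<le> \<alpha> * (1 + \<eta> * \<mu>)"
  proof -
    have "x * x \<le> x * 1" if "0 < x" "x \<le> 1" for x :: real using that by (intro mult_left_mono) auto
    moreover have "(1 - x / 4) * (1 + x) = 1 + x / 2 + (x * 1 - x * x) / 4" for x :: real
      by (simp add: field_simps)
    ultimately have "1 + x / 2 \<le> (1 - x / 4) * (1 + x)" if "0 < x" "x \<le> 1" for x :: real
      using that by simp
    then have "1 + \<eta> * \<mu> / 2 \<le> (1 - \<eta> * \<mu> / 4) * (1 + \<eta> * \<mu>)" using a a1 by blast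
    also have "\<dots> \<le> \<alpha> * (1 + \<eta> * \<mu>)" using al a by (intro mult_right_mono) auto
    finally show ?thesis .
  qed
  then have 1: "(1 + \<eta> * \<mu> / 2) * Z2 \<le> \<alpha> * (1 + \<eta> * \<mu>) * Z2" using nn by (intro mult_right_mono) auto
  have \<omega>p: "\<omega> * p = \<gamma> + \<eta> * \<mu> / 2" using pos by (auto simp: \<omega>)
  have \<omega>0: "0 < \<omega>" unfolding \<omega> using pos a by (intro divide_pos_pos add_pos_pos) auto
  \<comment> \<open>Coefficient of W2. The third rate in \<alpha>, multiplied by \<omega>, is
    exactly \<eta> \<mu> / 2, so there is equality when \<alpha> is 1 minus that rate.\<close>
  have "\<gamma> + (1 - p) * \<omega> \<le> \<alpha> * \<omega>"
  proof -
    have "p * \<eta> * \<mu> / (2 * \<gamma> + \<eta> * \<mu>) * \<omega> = \<eta> * \<mu> / 2"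
    proof -
      define S where "S = 2 * \<gamma> + \<eta> * \<mu>"
      have "0 < S" unfolding S_def using pos(4,6) a by (intro add_pos_pos) auto
      then have "p * \<eta> * \<mu> / S * (S / 2 / p) = \<eta> * \<mu> / 2" using pos(4) by simp
      moreover have h: "\<gamma> + \<eta> * \<mu> / 2 = S / 2" by (simp add: S_def)
      ultimately show ?thesis unfolding \<omega> S_def[symmetric] h by simp
    qed
    then have "\<gamma> + (1 - p) * \<omega> = (1 - p * \<eta> * \<mu> / (2 * \<gamma> + \<eta> * \<mu>)) * \<omega>"
      using \<omega>p by (simp add: algebra_simps)
    also have "\<dots> \<le> \<alpha> * \<omega>" using al \<omega>0 by (intro mult_right_mono) auto
    finally show ?thesis .
  qed
  then have 2: "(\<gamma> + (1 - p) * \<omega>) * W2 \<le> \<alpha> * \<omega> * W2" using nn by (intro mult_right_mono) auto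
  have "\<gamma> / 2 \<le> 63 / 64 * (3 * \<gamma> / 4)" using pos by simp
  also have "\<dots> \<le> \<alpha> * (3 * \<gamma> / 4)" using al pos by (intro mult_right_mono) auto
  finally have 3: "\<gamma> / 2 * V2 \<le> \<alpha> * (3 * \<gamma> / 4) * V2" using nn by (intro mult_right_mono) auto
  have "63 / 64 * (5 / 16) \<le> \<alpha> * (5 / 16)" using al by (intro mult_right_mono) auto
  then have "1 / 16 + \<gamma> / 2 \<le> \<alpha> * (5 / 16)" using pos(5,6) by linarith
  then have 4: "(1 / 16 + \<gamma> / 2) * X2 \<le> \<alpha> * (5 / 16) * X2" using nn by (intro mult_right_mono) auto
  \<comment> \<open>By 16 \<eta> \<theta> \<le> 1 half of the weight \<eta> / (2 \<theta>) suffices,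
    and \<alpha> \<ge> 1/2.\<close>
  have 5: "4 * \<eta>\<^sup>2 * Yd \<le> \<alpha> * (\<eta> / (2 * \<theta>)) * Nd"
  proof -
    have "4 * \<eta>\<^sup>2 * (4 * \<theta>) = \<eta> * (16 * \<eta> * \<theta>)" by (simp add: power2_eq_square)
    also have "\<dots> \<le> \<eta> * 1" using th pos by (intro mult_left_mono) auto
    finally have "4 * \<eta>\<^sup>2 \<le> \<eta> / (4 * \<theta>)" using pos by (simp add: pos_le_divide_eq)
    also have "\<dots> = 1 / 2 * (\<eta> / (2 * \<theta>))" by simp
    also have "\<dots> \<le> \<alpha> * (\<eta> / (2 * \<theta>))" using al pos by (intro mult_right_mono) auto
    finally have c: "4 * \<eta>\<^sup>2 \<le> \<alpha> * (\<eta> / (2 * \<theta>))" .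
    show ?thesis by (rule mult_mono[OF c nn(6) _ nn(5)]) (use pos al in simp)
  qed
  have 6: "\<eta> * ((1 - \<beta> * \<theta> / \<chi>) / \<theta> * Ns) \<le> \<alpha> * (\<eta> / \<theta>) * Ns"
  proof -
    have "(1 - \<beta> * \<theta> / \<chi>) * (\<eta> / \<theta> * Ns) \<le> \<alpha> * (\<eta> / \<theta> * Ns)" using al pos nn by (intro mult_right_mono) auto
    then show ?thesis by (simp add: mult_ac)
  qed
  have "(1 - \<gamma>) * Z2 + \<gamma> * W2 + X2 / 16 + \<alpha> * T + 4 * \<eta>\<^sup>2 * Yd + \<eta> * ((1 - \<beta> * \<theta> / \<chi>) / \<theta> * Ns)
      + \<gamma> / 2 * (V2 + X2) + \<omega> * (p * Z2 + (1 - p) * W2)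
    = (1 - \<gamma> + \<omega> * p) * Z2 + (\<gamma> + (1 - p) * \<omega>) * W2 + \<gamma> / 2 * V2 + (1 / 16 + \<gamma> / 2) * X2 + 4 * \<eta>\<^sup>2 * Yd
      + \<eta> * ((1 - \<beta> * \<theta> / \<chi>) / \<theta> * Ns) + \<alpha> * T"
    by (simp add: algebra_simps)
  also have "\<dots> = (1 + \<eta> * \<mu> / 2) * Z2 + (\<gamma> + (1 - p) * \<omega>) * W2 + \<gamma> / 2 * V2 + (1 / 16 + \<gamma> / 2) * X2 + 4 * \<eta>\<^sup>2 * Yd
      + \<eta> * ((1 - \<beta> * \<theta> / \<chi>) / \<theta> * Ns) + \<alpha> * T" unfolding \<omega>p by simp
  also have "\<dots> \<le> \<alpha> * (1 + \<eta> * \<mu>) * Z2 + \<alpha> * \<omega> * W2 + \<alpha> * (3 * \<gamma> / 4) * V2 + \<alpha> * (5 / 16) * X2 + \<alpha> * (\<eta> / (2 * \<theta>)) * Nd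
      + \<alpha> * (\<eta> / \<theta>) * Ns + \<alpha> * T"
    by (intro add_mono 1 2 3 4 5 6 order_refl)
  also have "\<dots> = \<alpha> * ((1 + \<eta> * \<mu>) * Z2 + \<omega> * W2 + 3 * \<gamma> / 4 * V2 + 5 / 16 * X2 + \<eta> / (2 * \<theta>) * Nd + \<eta> / \<theta> * Ns + T)"
    by (simp add: distrib_left mult.assoc)
  finally show ?thesis .
qed

section \<open>The lifted operator and the solution\<close>

locale decentralized_vi =
  fixes d M n :: nat and F :: "nat \<Rightarrow> nat \<Rightarrow> real vec \<Rightarrow> real vec" and g :: "real vec \<Rightarrow> ereal"
    and zs :: "real vec" and L Lb \<mu> :: real and b :: nat
  assumes d: "0 < d" and M: "0 < M" and n: "0 < n" and b: "0 < b"
    and F: "\<And>m i. m < M \<Longrightarrow> i < n \<Longrightarrow> F m i \<in> carrier_vec d \<rightarrow> carrier_vec d"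
    and g: "proper_fun d g" "lsc_fun d g" "convex_fun d g"
    and pos: "0 < L" "0 < Lb" "0 < \<mu>"
    and lip: "\<And>m. m < M \<Longrightarrow> lipschitz_op d L (avg_op d n (F m))"
    and mono: "\<And>m. m < M \<Longrightarrow> strongly_monotone_op d \<mu> (avg_op d n (F m))"
    and avg: "\<And>m. m < M \<Longrightarrow> avg_lipschitz_op d n Lb (F m)"
    and sol: "vi_solution d M n F g zs"
begin

definition Fl :: "real mat \<Rightarrow> fin_fun" where "Fl Z = emb (lifted_op d M n F Z)"

definition Zs :: "real mat" where "Zs = mat\<^sub>r M d (\<lambda>_. zs)"

text \<open>By the variational inequality a subgradient of \<open>g\<close> at \<open>zs\<close>.\<close>
definition sub_zs :: "real vec" where "sub_zs = vec d (\<lambda>j. - (\<Sum>m<M. avg_op d n (F m) zs $ j))"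

text \<open>The dual solution: the projection of \<open>F(z*)\<close> onto the orthogonal complement of the
  consensus space.\<close>
definition dual_sol :: fin_fun where
  "dual_sol = Fl Zs + (1 / real M) *\<^sub>R emb (mat\<^sub>r M d (\<lambda>_. sub_zs))"

definition Fe :: "real mat \<Rightarrow> nat \<Rightarrow> nat \<Rightarrow> fin_fun" where
  "Fe Z m i = remb m (F m i (row Z m))"

lemma zs_carrier [simp]: "zs \<in> carrier_vec d"
  using sol by (simp add: vi_solution_def)

lemma Zs_carrier [simp]: "Zs \<in> carrier_mat M d"
  by (simp add: Zs_def)

lemma row_Zs: "m < M \<Longrightarrow> row Zs m = zs"
  by (simp add: Zs_def)

lemma sub_zs_carrier [simp]: "sub_zs \<in> carrier_vec d"
  by (simp add: sub_zs_def)

lemma F_carrier: "m < M \<Longrightarrow> i < n \<Longrightarrow> x \<in> carrier_vec d \<Longrightarrow> F m i x \<in> carrier_vec d"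
  using F by blast

lemma avg_op_carrier [simp]: "avg_op d n f x \<in> carrier_vec d"
  by (simp add: avg_op_def)

lemma lifted_op_carrier [simp]: "lifted_op d M n F Z \<in> carrier_mat M d"
  by (simp add: lifted_op_def)

lemma sampled_op_carrier [simp]: "sampled_op d M F J l Z \<in> carrier_mat M d"
  by (simp add: sampled_op_def)

lemma mat_sum_carrier [simp]: "mat_sum M d A I \<in> carrier_mat M d"
  by (simp add: mat_sum_def)

text \<open>Cauchy-Schwarz at two distinct points, which exist because d is positive.\<close>

lemma mu_le_L: "\<mu> \<le> L"
proof -
  define u v :: "real vec" where "u = vec d (\<lambda>_. 1)" and "v = vec d (\<lambda>_. 0)"
  have uv: "u \<in> carrier_vec d" "v \<in> carrier_vec d" by (auto simp: u_def v_def)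
  let ?f = "avg_op d n (F 0)"
  let ?x = "remb 0 (u - v)" and ?y = "remb 0 (?f u - ?f v)"
  have "fcoord ?x (0, 0) = 1" using d by (simp add: fcoord_remb u_def v_def)
  then have x: "?x \<noteq> 0" by auto
  have "\<mu> * (norm ?x)\<^sup>2 \<le> (?f u - ?f v) \<bullet> (u - v)"
    using mono[OF M] uv unfolding strongly_monotone_op_def norm_remb by blast
  also have "\<dots> = inner ?y ?x" using inner_remb[of "?f u - ?f v" d "u - v" 0 0] uv by simp
  also have "\<dots> \<le> norm ?y * norm ?x" by (rule norm_cauchy_schwarz)
  also have "\<dots> \<le> L * norm ?x * norm ?x"
    using lip[OF M] uv unfolding lipschitz_op_def norm_remb by (intro mult_right_mono) (auto simp: vnorm_remb)
  finally have "\<mu> * (norm ?x)\<^sup>2 \<le> L * (norm ?x)\<^sup>2" by (simp add: power2_eq_square)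
  then show ?thesis using x by simp
qed

lemma remb_avg_op:
  assumes "m < M" "x \<in> carrier_vec d"
  shows "remb m (avg_op d n (F m) x) = (1 / real n) *\<^sub>R (\<Sum>i<n. remb m (F m i x))"
proof (rule fin_fun_eqI)
  fix a
  have "dim_vec (F m i x) = d" if "i < n" for i using F_carrier[OF assms(1) that assms(2)] by simp
  then show "fcoord (remb m (avg_op d n (F m) x)) a = fcoord ((1 / real n) *\<^sub>R (\<Sum>i<n. remb m (F m i x))) a"
    by (auto simp: fcoord_remb avg_op_def)
qed

lemma Fl_rows: "Fl Z = (\<Sum>m<M. remb m (avg_op d n (F m) (row Z m)))"
  unfolding Fl_def lifted_op_def by (rule emb_mat_of_rows) simp

lemma emb_rows: "Z \<in> carrier_mat M d \<Longrightarrow> emb Z = (\<Sum>m<M. remb m (row Z m))"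
  by (auto simp: emb_def)

lemma emb_diff_rows:
  assumes "Z \<in> carrier_mat M d" "Z' \<in> carrier_mat M d"
  shows "emb Z - emb Z' = (\<Sum>m<M. remb m (row Z m - row Z' m))"
  unfolding emb_rows[OF assms(1)] emb_rows[OF assms(2)] sum_subtractf[symmetric]
  using assms by (intro sum.cong refl) (auto simp: remb_linear[of _ d])

lemma Fl_diff_rows:
  "Fl Z - Fl Z' = (\<Sum>m<M. remb m (avg_op d n (F m) (row Z m) - avg_op d n (F m) (row Z' m)))"
  unfolding Fl_rows sum_subtractf[symmetric] by (intro sum.cong refl) (simp add: remb_linear[of _ d])

lemma norm_emb_diff_sq:
  assumes "Z \<in> carrier_mat M d" "Z' \<in> carrier_mat M d"
  shows "(norm (emb Z - emb Z'))\<^sup>2 = (\<Sum>m<M. (vnorm (row Z m - row Z' m))\<^sup>2)"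
  unfolding emb_diff_rows[OF assms] by (rule norm_sum_remb[of M _ d]) (use assms in auto)

lemma Fl_lipschitz:
  assumes "Z \<in> carrier_mat M d" "Z' \<in> carrier_mat M d"
  shows "norm (Fl Z - Fl Z') \<le> L * norm (emb Z - emb Z')"
proof (rule power2_le_imp_le)
  let ?f = "\<lambda>m. avg_op d n (F m)"
  have "(norm (Fl Z - Fl Z'))\<^sup>2 = (\<Sum>m<M. (vnorm (?f m (row Z m) - ?f m (row Z' m)))\<^sup>2)"
    unfolding Fl_diff_rows by (rule norm_sum_remb[of M _ d]) simp
  also have "\<dots> \<le> (\<Sum>m<M. (L * vnorm (row Z m - row Z' m))\<^sup>2)"
  proof (intro sum_mono power_mono)
    fix m assume "m \<in> {..<M}"
    then have m: "m < M" by simp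
    show "vnorm (?f m (row Z m) - ?f m (row Z' m)) \<le> L * vnorm (row Z m - row Z' m)"
      using lip[OF m] assms m unfolding lipschitz_op_def by simp
  qed (simp add: vnorm_remb)
  also have "\<dots> = (L * norm (emb Z - emb Z'))\<^sup>2"
    by (simp add: power_mult_distrib norm_emb_diff_sq[OF assms] sum_distrib_left)
  finally show "(norm (Fl Z - Fl Z'))\<^sup>2 \<le> (L * norm (emb Z - emb Z'))\<^sup>2" .
qed (use pos in simp)

lemma Fl_strongly_monotone:
  assumes "Z \<in> carrier_mat M d" "Z' \<in> carrier_mat M d"
  shows "\<mu> * (norm (emb Z - emb Z'))\<^sup>2 \<le> inner (Fl Z - Fl Z') (emb Z - emb Z')"
proof -
  let ?f = "\<lambda>m. avg_op d n (F m)"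
  have "\<mu> * (norm (emb Z - emb Z'))\<^sup>2 = (\<Sum>m<M. \<mu> * (vnorm (row Z m - row Z' m))\<^sup>2)"
    by (simp add: norm_emb_diff_sq[OF assms] sum_distrib_left)
  also have "\<dots> \<le> (\<Sum>m<M. (?f m (row Z m) - ?f m (row Z' m)) \<bullet> (row Z m - row Z' m))"
    using mono assms unfolding strongly_monotone_op_def by (intro sum_mono) simp
  also have "\<dots> = inner (Fl Z - Fl Z') (emb Z - emb Z')"
    unfolding Fl_diff_rows emb_diff_rows[OF assms]
    by (rule inner_sum_remb[of M _ d, symmetric]) (use assms in auto)
  finally show ?thesis .
qed

lemma avg_lipschitz_Fe:
  assumes "Z \<in> carrier_mat M d" "Z' \<in> carrier_mat M d"
  shows "(\<Sum>m<M. (1 / real n) * (\<Sum>i<n. (norm (Fe Z m i - Fe Z' m i))\<^sup>2))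
    \<le> Lb\<^sup>2 * (norm (emb Z - emb Z'))\<^sup>2"
proof -
  have "(1 / real n) * (\<Sum>i<n. (norm (Fe Z m i - Fe Z' m i))\<^sup>2)
      \<le> Lb\<^sup>2 * (vnorm (row Z m - row Z' m))\<^sup>2" if m: "m < M" for m
  proof -
    have r: "row Z m \<in> carrier_vec d" "row Z' m \<in> carrier_vec d" using assms m by auto
    have "Fe Z m i - Fe Z' m i = remb m (F m i (row Z m) - F m i (row Z' m))"
      if "i < n" for i
      using F_carrier[OF m that r(1)] F_carrier[OF m that r(2)] by (simp add: Fe_def remb_linear[of _ d])
    then show ?thesis using avg[OF m] r unfolding avg_lipschitz_op_def by (simp add: norm_remb)
  qed
  then show ?thesis
    unfolding norm_emb_diff_sq[OF assms] sum_distrib_left[of "Lb\<^sup>2"] by (intro sum_mono) simp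
qed

text \<open>Rearranged, the variational inequality is the subgradient inequality for
  \<open>sub_zs\<close>. The value at zs is finite, since testing with a point of the domain would
  otherwise give - \<infinity> \<ge> 0.\<close>

lemma sub_zs_subgradient:
  obtains r where "g zs = ereal r" "\<And>z. z \<in> carrier_vec d \<Longrightarrow> g z \<ge> ereal (r + sub_zs \<bullet> (z - zs))"
proof -
  define G where "G = vec d (\<lambda>j. \<Sum>m<M. avg_op d n (F m) zs $ j)"
  have vi: "ereal (G \<bullet> (z - zs)) + g z - g zs \<ge> 0" if "z \<in> carrier_vec d" for z
    using sol that unfolding vi_solution_def G_def by blast
  obtain x where x: "x \<in> carrier_vec d" "g x \<noteq> \<infinity>" "g x \<noteq> - \<infinity>"
    using g(1) unfolding proper_fun_def by auto
  have fin: "g zs \<noteq> \<infinity>"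
  proof
    assume "g zs = \<infinity>"
    then show False using vi[OF x(1)] x by (cases "g x") auto
  qed
  moreover have "g zs \<noteq> - \<infinity>" using g(1) by (simp add: proper_fun_def)
  ultimately obtain r where r: "g zs = ereal r" by (cases "g zs") auto
  have "g z \<ge> ereal (r + sub_zs \<bullet> (z - zs))" if z: "z \<in> carrier_vec d" for z
  proof -
    have "sub_zs \<bullet> (z - zs) = - (G \<bullet> (z - zs))"
    proof -
      have dz: "dim_vec (z - zs) = d"
        using carrier_vecD[OF zs_carrier] by (simp only: index_minus_vec(2))
      show ?thesis
        unfolding scalar_prod_def dz sum_negf[symmetric] by (intro sum.cong) (simp_all add: sub_zs_def G_def)
    qed
    then show ?thesis using vi[OF z] by (cases "g z") (simp_all add: r)
  qed
  then show ?thesis using that r by blast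
qed

text \<open>Column by column the entries sum to zero over the workers: \<open>sub_zs\<close> is
  minus the sum of the F_m at zs and enters M times with weight 1 / M. A consensus point pairs only
  with these column sums.\<close>

lemma dual_sol_orth: "\<exists>Ys\<in>orth_complement M d (consensus M d). emb Ys = dual_sol"
proof
  define S where "S = mat\<^sub>r M d (\<lambda>_. sub_zs)"
  define Ys where "Ys = lifted_op d M n F Zs + (1 / real M) \<cdot>\<^sub>m S"
  have S: "S \<in> carrier_mat M d" by (simp add: S_def)
  then have Ys: "Ys \<in> carrier_mat M d" by (simp add: Ys_def)
  show "emb Ys = dual_sol"
    unfolding Ys_def dual_sol_def Fl_def S_def[symmetric] using S by (simp add: emb_linear[of _ M d])
  have ent: "row Ys m $ j = avg_op d n (F m) zs $ j + sub_zs $ j / real M" if "m < M" "j < d" for m j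
    using that S by (simp add: Ys_def S_def lifted_op_def row_Zs carrier_vecD[OF sub_zs_carrier])
  have "mat_inner Ys Z = 0" if Z: "Z \<in> consensus M d" for Z
  proof -
    have ZC: "Z \<in> carrier_mat M d" using Z unfolding consensus_def by blast
    have Z0: "row Z m = row Z 0" if "m < M" for m using Z M that unfolding consensus_def by blast
    have "row Ys m \<bullet> row Z m = (\<Sum>j<d. (avg_op d n (F m) zs $ j + sub_zs $ j / real M) * row Z 0 $ j)"
      if m: "m < M" for m
    proof -
      have "row Ys m \<bullet> row Z m = (\<Sum>j<d. row Ys m $ j * row Z 0 $ j)"
        unfolding Z0[OF m] using ZC M by (simp add: scalar_prod_def lessThan_atLeast0)
      then show ?thesis using ent[OF m] by simp
    qed
    then have "mat_inner Ys Z = (\<Sum>m<M. \<Sum>j<d. (avg_op d n (F m) zs $ j + sub_zs $ j / real M) * row Z 0 $ j)"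
      using Ys by (simp add: mat_inner_def)
    also have "\<dots> = (\<Sum>j<d. \<Sum>m<M. (avg_op d n (F m) zs $ j + sub_zs $ j / real M) * row Z 0 $ j)"
      by (rule sum.swap)
    also have "\<dots> = (\<Sum>j<d. 0)"
    proof (rule sum.cong)
      fix j assume "j \<in> {..<d}"
      then have "(\<Sum>m<M. avg_op d n (F m) zs $ j + sub_zs $ j / real M) = 0"
        using M by (simp add: sum_subtractf sub_zs_def)
      then show "(\<Sum>m<M. (avg_op d n (F m) zs $ j + sub_zs $ j / real M) * row Z 0 $ j) = 0"
        unfolding sum_distrib_right[symmetric] by simp
    qed simp
    finally show ?thesis by simp
  qed
  then show "Ys \<in> orth_complement M d (consensus M d)" using Ys by (simp add: orth_complement_def)
qed

lemma emb_sampled_op: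
  assumes "J \<in> set_pmf (index_pmf M n b)" "l < b" "Z \<in> carrier_mat M d"
  shows "emb (sampled_op d M F J l Z) = (\<Sum>m<M. Fe Z m (J (m, l)))"
  unfolding sampled_op_def Fe_def
  by (rule emb_mat_of_rows) (use assms index_pmf_bound[OF n assms(1)] in \<open>auto intro!: F_carrier\<close>)

definition sample_mean :: "(nat \<Rightarrow> nat \<Rightarrow> fin_fun) \<Rightarrow> fin_fun" where
  "sample_mean v = (\<Sum>m<M. (1 / real n) *\<^sub>R (\<Sum>i<n. v m i))"

definition batch_mean :: "(nat \<times> nat \<Rightarrow> nat) \<Rightarrow> (nat \<Rightarrow> nat \<Rightarrow> fin_fun) \<Rightarrow> fin_fun" where
  "batch_mean J v = (1 / real b) *\<^sub>R (\<Sum>l<b. \<Sum>m<M. v m (J (m, l)))"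

lemma sample_mean_linear:
  "sample_mean (\<lambda>m i. u m i + v m i) = sample_mean u + sample_mean v"
  "sample_mean (\<lambda>m i. u m i - v m i) = sample_mean u - sample_mean v"
  "sample_mean (\<lambda>m i. c *\<^sub>R u m i) = c *\<^sub>R sample_mean u"
  by (simp_all add: sample_mean_def sum.distrib sum_subtractf scaleR_add_right scaleR_diff_right
      scaleR_sum_right mult.commute)

lemma Fl_sample_mean: "Z \<in> carrier_mat M d \<Longrightarrow> Fl Z = sample_mean (Fe Z)"
  unfolding Fl_rows sample_mean_def Fe_def by (intro sum.cong refl remb_avg_op) auto

lemma sum_emb_sampled_op:
  assumes "J \<in> set_pmf (index_pmf M n b)" "Z \<in> carrier_mat M d"
  shows "(1 / real b) *\<^sub>R (\<Sum>l<b. emb (sampled_op d M F J l Z)) = batch_mean J (Fe Z)"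
  unfolding batch_mean_def using assms
  by (intro arg_cong[of _ _ "scaleR (1 / real b)"] sum.cong refl emb_sampled_op) auto

lemma batch_noise:
  shows batch_unbiased: "expect (index_pmf M n b)
      (\<lambda>J. inner (batch_mean J v - sample_mean v) u) = 0"
    and batch_variance: "expect (index_pmf M n b) (\<lambda>J. (norm (batch_mean J v - sample_mean v))\<^sup>2)
      \<le> (1 / real b) * (\<Sum>m<M. (1 / real n) * (\<Sum>i<n. (norm (v m i))\<^sup>2))"
  unfolding batch_mean_def sample_mean_def using index_pmf_noise[OF n b, where v = v] by auto

end

section \<open>The Lyapunov function\<close>

text \<open>The explicit formulas for the step sizes and \<alpha> are replaced by the inequalities
  that \<open>parameter_bounds\<close> derives from them.\<close>

locale decentralized_vi_algorithm = decentralized_vi d M n F g zs L Lb \<mu> b + gossip_dual M d A \<chi> B Y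
  for d M n :: nat and F :: "nat \<Rightarrow> nat \<Rightarrow> real vec \<Rightarrow> real vec" and g :: "real vec \<Rightarrow> ereal"
    and zs :: "real vec" and L Lb \<mu> :: real and b :: nat and A :: "real mat" and \<chi> :: real
    and B :: "fin_fun \<Rightarrow> fin_fun" and Y :: "fin_fun set" +
  fixes p \<gamma> \<eta> \<beta> \<theta> \<alpha> :: real
  assumes A: "A \<in> carrier_mat M M"
    and \<chi>: "1 \<le> \<chi>" and p: "0 < p" "p \<le> 1 / 8" and \<gamma>: "\<gamma> = p"
    and step: "0 < \<eta>" "0 < \<beta>" "0 < \<theta>" "\<eta> * L \<le> 1 / 16" "\<eta>\<^sup>2 * Lb\<^sup>2 \<le> \<gamma> * real b / 16"
      "\<beta> * L\<^sup>2 \<le> \<mu> / 4" "\<eta> * \<beta> * (Lb\<^sup>2 / real b) \<le> \<gamma> / 4" "\<theta> \<le> 1 / (2 * \<beta>)" "16 * \<eta> * \<theta> \<le> 1"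
    and \<alpha>: "1 - \<eta> * \<mu> / 4 \<le> \<alpha>" "1 - \<beta> * \<theta> / \<chi> \<le> \<alpha>" "1 - p * \<eta> * \<mu> / (2 * \<gamma> + \<eta> * \<mu>) \<le> \<alpha>"
      "63 / 64 \<le> \<alpha>" "\<alpha> < 1" and \<eta>\<mu>: "\<eta> * \<mu> \<le> 1"
begin

definition params :: alg_params where
  "params = \<lparr> par_eta = \<eta>, par_theta = \<theta>, par_alpha = \<alpha>, par_beta = \<beta>, par_gamma = \<gamma>,
              par_batch = b, par_prob = p \<rparr>"

lemma params_sel [simp]:
  "par_eta params = \<eta>" "par_theta params = \<theta>" "par_alpha params = \<alpha>" "par_beta params = \<beta>"
  "par_gamma params = \<gamma>" "par_batch params = b" "par_prob params = p"
  by (simp_all add: params_def)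

definition NB :: "fin_fun \<Rightarrow> real" where "NB v = inner v (B v)"

text \<open>Invariant of the Markov chain. Membership in Y is what makes the B-norm of dual
  differences comparable with the Euclidean norm.\<close>

definition good :: "alg_state \<Rightarrow> bool" where
  "good s \<longleftrightarrow> z_cur s \<in> carrier_mat M d \<and> z_prev s \<in> carrier_mat M d \<and> w_cur s \<in> carrier_mat M d
    \<and> w_prev s \<in> carrier_mat M d \<and> y_cur s \<in> carrier_mat M d \<and> y_prev s \<in> carrier_mat M d
    \<and> emb (y_cur s) \<in> Y \<and> emb (y_prev s) \<in> Y"

text \<open>The weight is chosen so that refreshing \<open>w\<close> with probability \<open>p\<close> balances the coupling
  term \<open>\<gamma> (w - z)\<close> of the primal step.\<close>
definition w_weight :: real where "w_weight = (\<gamma> + \<eta> * \<mu> / 2) / p"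

text \<open>Everything except the term in \<open>w_cur\<close>, the only one that the coin changes.
  The arguments are embedded points, so that it applies to the next iterates directly.\<close>

definition lyap_rest :: "fin_fun \<Rightarrow> fin_fun \<Rightarrow> fin_fun \<Rightarrow> fin_fun \<Rightarrow> fin_fun \<Rightarrow> fin_fun \<Rightarrow> fin_fun \<Rightarrow> real" where
  "lyap_rest z zm wm Fz Fzm y ym = (1 + \<eta> * \<mu>) * (norm (z - emb Zs))\<^sup>2 + 3 * \<gamma> / 4 * (norm (z - wm))\<^sup>2
    + 5 / 16 * (norm (z - zm))\<^sup>2 + \<eta> / (2 * \<theta>) * NB (y - ym) + \<eta> / \<theta> * NB (y - dual_sol)
    + (2 * \<eta> * inner (y - ym) (z - emb Zs) - 2 * \<eta> * inner (Fz - Fzm) (z - emb Zs))"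

definition lyap :: "alg_state \<Rightarrow> real" where
  "lyap s = lyap_rest (emb (z_cur s)) (emb (z_prev s)) (emb (w_prev s)) (Fl (z_cur s)) (Fl (z_prev s))
      (emb (y_cur s)) (emb (y_prev s)) + w_weight * (norm (emb (w_cur s) - emb Zs))\<^sup>2"

lemma dual_sol_Y: "dual_sol \<in> Y"
  using dual_sol_orth orthY by metis

lemma const_consensus: "mat\<^sub>r M d (\<lambda>_. v) \<in> consensus M d" if "v \<in> carrier_vec d"
  using that by (simp add: consensus_def)

lemma Zs_orth: "v \<in> Y \<Longrightarrow> inner (emb Zs) v = 0"
  unfolding Zs_def by (intro consY const_consensus) simp

lemma FlZs_orth: "v \<in> Y \<Longrightarrow> inner (Fl Zs) v = inner dual_sol v"
  using consY[OF const_consensus[OF sub_zs_carrier], of v] by (simp add: dual_sol_def inner_add_left)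

lemma Y_diff: "u \<in> Y \<Longrightarrow> v \<in> Y \<Longrightarrow> u - v \<in> Y"
  using subY by (rule real_vector.subspace_diff)

text \<open>With Z2 the squared distance of z, the product with the operator difference costs Z2 /
  16 and part of |z - zm|^2, by \<eta> L \<le> 1/16; the product with the dual difference costs Z2 /
  4 and at most the B-norm term, by 16 \<eta> \<theta> \<le> 1. At least 11/16 of Z2
  remains.\<close>

lemma lyap_ge:
  assumes "good s"
  shows "(norm (emb (z_cur s) - emb Zs))\<^sup>2 / 2 \<le> lyap s"
proof -
  let ?z = "emb (z_cur s)" and ?zm = "emb (z_prev s)" and ?y = "emb (y_cur s)" and ?ym = "emb (y_prev s)"
  define Z2 X2 Yd where "Z2 = (norm (?z - emb Zs))\<^sup>2" and "X2 = (norm (?z - ?zm))\<^sup>2" and "Yd = (norm (?y - ?ym))\<^sup>2"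
  have nn: "0 \<le> Z2" "0 \<le> X2" "0 \<le> Yd" by (simp_all add: Z2_def X2_def Yd_def)
  have Fz: "2 * \<eta> * inner (Fl (z_cur s) - Fl (z_prev s)) (?z - emb Zs) \<le> X2 / 16 + Z2 / 16"
  proof -
    have "2 * \<bar>inner (Fl (z_cur s) - Fl (z_prev s)) (?z - emb Zs)\<bar> \<le> L * (X2 + Z2)"
      unfolding X2_def Z2_def
      by (rule inner_le_of_norm_le[OF Fl_lipschitz]) (use assms pos in \<open>auto simp: good_def\<close>)
    then have "\<eta> * (2 * inner (Fl (z_cur s) - Fl (z_prev s)) (?z - emb Zs)) \<le> \<eta> * (L * (X2 + Z2))"
      using step(1) by (intro mult_left_mono) auto
    also have "\<dots> = \<eta> * L * (X2 + Z2)" by simp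
    also have "\<dots> \<le> 1 / 16 * (X2 + Z2)" using step nn by (intro mult_right_mono) auto
    finally show ?thesis by simp
  qed
  have Yz: "- (2 * \<eta> * inner (?y - ?ym) (?z - emb Zs)) \<le> 4 * \<eta>\<^sup>2 * Yd + Z2 / 4"
  proof -
    have "2 * inner ((2 * \<eta>) *\<^sub>R (?y - ?ym)) (- ((1 / 2) *\<^sub>R (?z - emb Zs)))
      \<le> 1 * (norm ((2 * \<eta>) *\<^sub>R (?y - ?ym)))\<^sup>2 + (norm (- ((1 / 2) *\<^sub>R (?z - emb Zs))))\<^sup>2 / 1"
      by (rule young_inner) simp
    then show ?thesis by (simp add: Yd_def Z2_def power_mult_distrib power_divide)
  qed
  have "?y - ?ym \<in> Y" using assms Y_diff by (simp add: good_def)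
  then have Nd: "Yd \<le> NB (?y - ?ym)" unfolding Yd_def NB_def by (rule B_ge)
  have c: "4 * \<eta>\<^sup>2 \<le> \<eta> / (2 * \<theta>)"
  proof -
    have "4 * \<eta>\<^sup>2 * (2 * \<theta>) = \<eta> * (16 * \<eta> * \<theta> / 2)" by (simp add: power2_eq_square)
    also have "\<dots> \<le> \<eta> * 1" using step by (intro mult_left_mono) auto
    finally have "4 * \<eta>\<^sup>2 * (2 * \<theta>) \<le> \<eta>" by simp
    then show ?thesis using step by (simp add: pos_le_divide_eq)
  qed
  have Nd': "4 * \<eta>\<^sup>2 * Yd \<le> \<eta> / (2 * \<theta>) * NB (?y - ?ym)"
    by (rule mult_mono[OF c Nd _ nn(3)]) (use step in simp)
  have "0 \<le> NB (?y - dual_sol)"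
  proof -
    have "?y - dual_sol \<in> Y" using assms Y_diff dual_sol_Y by (simp add: good_def)
    then show ?thesis unfolding NB_def using B_ge order_trans zero_le_power2 by blast
  qed
  then have Ns: "0 \<le> \<eta> / \<theta> * NB (?y - dual_sol)" using step by simp
  have "0 \<le> w_weight"
    unfolding w_weight_def using step(1) pos(3) p \<gamma> by (intro divide_nonneg_nonneg add_nonneg_nonneg) auto
  then have "0 \<le> \<eta> * \<mu> * Z2" "0 \<le> 3 * \<gamma> / 4 * (norm (?z - emb (w_prev s)))\<^sup>2"
    "0 \<le> w_weight * (norm (emb (w_cur s) - emb Zs))\<^sup>2"
    using step(1) pos(3) p nn \<gamma> by simp_all
  with Fz Yz Nd' Ns nn show ?thesis
    unfolding lyap_def lyap_rest_def Z2_def[symmetric] X2_def[symmetric] by (simp add: algebra_simps)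
qed

abbreviation IP :: "(nat \<times> nat \<Rightarrow> nat) pmf" where "IP \<equiv> index_pmf M n b"

lemma finite_IP: "finite (set_pmf IP)"
  by (rule finite_set_index_pmf[OF n])

section \<open>One step from a fixed state\<close>

context
  fixes s :: alg_state
  assumes s: "good s"
begin

abbreviation zc where "zc \<equiv> emb (z_cur s)"
abbreviation zm where "zm \<equiv> emb (z_prev s)"
abbreviation wc where "wc \<equiv> emb (w_cur s)"
abbreviation wm where "wm \<equiv> emb (w_prev s)"
abbreviation yc where "yc \<equiv> emb (y_cur s)"
abbreviation ym where "ym \<equiv> emb (y_prev s)"
abbreviation Fz where "Fz \<equiv> Fl (z_cur s)"
abbreviation Fzm where "Fzm \<equiv> Fl (z_prev s)"

definition z_new :: "(nat \<times> nat \<Rightarrow> nat) \<Rightarrow> real mat" where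
  "z_new J = alg_z_next d M n F g params J s"

definition D_new :: "(nat \<times> nat \<Rightarrow> nat) \<Rightarrow> (nat \<times> nat \<Rightarrow> nat) \<Rightarrow> real mat" where
  "D_new J J' = alg_Delta_half d M n F params J' (z_new J) s"

definition y_new :: "(nat \<times> nat \<Rightarrow> nat) \<Rightarrow> (nat \<times> nat \<Rightarrow> nat) \<Rightarrow> real mat" where
  "y_new J J' = y_cur s - \<theta> \<cdot>\<^sub>m (A * (z_new J - \<beta> \<cdot>\<^sub>m (D_new J J' - y_cur s)))"

text \<open>The subtracted vector is the conditional mean of the extrapolated estimate: the control
  variate at \<open>w_prev s\<close> averages out.\<close>

definition noise :: "(nat \<times> nat \<Rightarrow> nat) \<Rightarrow> fin_fun" where
  "noise J = emb (alg_delta d M n F params J s) - (Fz + \<alpha> *\<^sub>R (Fz - Fzm))"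

lemma state_carriers [simp]:
  "z_cur s \<in> carrier_mat M d" "z_prev s \<in> carrier_mat M d" "w_cur s \<in> carrier_mat M d"
  "w_prev s \<in> carrier_mat M d" "y_cur s \<in> carrier_mat M d" "y_prev s \<in> carrier_mat M d"
  and state_Y: "yc \<in> Y" "ym \<in> Y"
  using s by (auto simp: good_def)

lemma alg_delta_carrier [simp]: "alg_delta d M n F params J s \<in> carrier_mat M d"
  by (simp add: alg_delta_def)

lemma alg_update_eq:
  "alg_update d M n F g A params J J' c s = \<lparr> z_cur = z_new J, z_prev = z_cur s,
     w_cur = (if c then z_cur s else w_cur s), w_prev = w_cur s, y_cur = y_new J J', y_prev = y_cur s \<rparr>"
  by (simp add: alg_update_def Let_def z_new_def D_new_def y_new_def)

text \<open>\<open>Fl Zs - dual_sol\<close> is - 1 / M times the lifted subgradient, so this is the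
  proximal inequality in the form that \<open>primal_step\<close> expects.\<close>

lemma z_new_prox:
  shows z_new_carrier [simp]: "z_new J \<in> carrier_mat M d"
    and "inner (emb (z_new J) - (zc + \<gamma> *\<^sub>R (wc - zc)
      - \<eta> *\<^sub>R ((Fz + \<alpha> *\<^sub>R (Fz - Fzm) + noise J)
        - (yc + \<alpha> *\<^sub>R (yc - ym))))) (emb (z_new J) - emb Zs)
      \<le> \<eta> * inner (Fl Zs - dual_sol) (emb (z_new J) - emb Zs)" (is ?ineq)
proof -
  obtain r where r: "g zs = ereal r" "\<And>z. z \<in> carrier_vec d \<Longrightarrow> g z \<ge> ereal (r + sub_zs \<bullet> (z - zs))"
    using sub_zs_subgradient by blast
  define V where "V = z_cur s + \<gamma> \<cdot>\<^sub>m (w_cur s - z_cur s) - \<eta> \<cdot>\<^sub>m alg_Delta d M n F params J s"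
  have V: "V \<in> carrier_mat M d" by (simp add: V_def alg_Delta_def minus_carrier_mat)
  have zV: "z_new J = prox d M \<eta> (lifted_fun M g) V" by (simp add: z_new_def alg_z_next_def V_def)
  note P = prox_inequality[OF g zs_carrier r(1) sub_zs_carrier r(2) step(1) M V, folded zV Zs_def]
  show "z_new J \<in> carrier_mat M d" by (rule P(1))
  have "emb V = zc + \<gamma> *\<^sub>R (wc - zc)
      - \<eta> *\<^sub>R ((Fz + \<alpha> *\<^sub>R (Fz - Fzm) + noise J)
        - (yc + \<alpha> *\<^sub>R (yc - ym)))"
    unfolding V_def alg_Delta_def noise_def by (simp add: emb_linear[of _ M d] minus_carrier_mat)
  moreover have "Fl Zs - dual_sol = - ((1 / real M) *\<^sub>R emb (mat\<^sub>r M d (\<lambda>_. sub_zs)))"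
    by (simp add: dual_sol_def)
  ultimately show ?ineq
    using P(2) by simp
qed

lemma D_new_carrier [simp]: "D_new J J' \<in> carrier_mat M d"
  by (simp add: D_new_def alg_Delta_half_def)

lemma y_new:
  shows y_new_carrier [simp]: "y_new J J' \<in> carrier_mat M d"
    and emb_y_new: "emb (y_new J J') = yc
      - \<theta> *\<^sub>R mat_op M d A (emb (z_new J) - \<beta> *\<^sub>R (emb (D_new J J') - yc))" (is ?eq)
proof -
  have C: "z_new J - \<beta> \<cdot>\<^sub>m (D_new J J' - y_cur s) \<in> carrier_mat M d" by (simp add: minus_carrier_mat)
  have AC: "A * (z_new J - \<beta> \<cdot>\<^sub>m (D_new J J' - y_cur s)) \<in> carrier_mat M d" using A C by (rule mult_carrier_mat)
  show "y_new J J' \<in> carrier_mat M d" unfolding y_new_def using AC by (simp add: minus_carrier_mat)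
  show ?eq
    unfolding y_new_def using AC by (simp add: emb_linear[of _ M d] emb_mult[OF A C] minus_carrier_mat)
qed

lemma y_new_Y: "emb (y_new J J') \<in> Y" "emb (y_new J J') - yc \<in> Y"
proof -
  show "emb (y_new J J') \<in> Y"
    unfolding emb_y_new using AY state_Y(1) by (intro Y_diff real_vector.subspace_scale[OF subY]) auto
  then show "emb (y_new J J') - yc \<in> Y" using state_Y(1) by (rule Y_diff)
qed

lemma good_update: "good (alg_update d M n F g A params J J' c s)"
  unfolding alg_update_eq good_def using y_new_Y state_Y by auto

text \<open>Primal step plus \<eta> times the dual step; the products of yp - ys with zp - zs
  cancel. Of the weights 2 \<eta> \<mu> and \<gamma> in the primal step, \<eta> \<mu> and 3 \<gamma>
  / 4 go into the Lyapunov function, and the rest stays on the left to pay for the half-step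
  error.\<close>

lemma step_deterministic:
  "lyap_rest (emb (z_new J)) (zc) (wc) (Fl (z_new J)) (Fz) (emb (y_new J J')) (yc)
      + \<eta> * \<mu> * (norm (emb (z_new J) - emb Zs))\<^sup>2 + \<gamma> / 4 * (norm (emb (z_new J) - wc))\<^sup>2
    \<le> (1 - \<gamma>) * (norm (zc - emb Zs))\<^sup>2 + \<gamma> * (norm (wc - emb Zs))\<^sup>2
      + (norm (zc - zm))\<^sup>2 / 16
      + \<alpha> * (2 * \<eta> * inner (yc - ym) (zc - emb Zs)
          - 2 * \<eta> * inner (Fz - Fzm) (zc - emb Zs))
      + 4 * \<eta>\<^sup>2 * (norm (yc - ym))\<^sup>2
      + \<eta> * ((1 - \<beta> * \<theta> / \<chi>) / \<theta> * NB (yc - dual_sol))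
      + (4 * \<eta>\<^sup>2 * (norm (noise J))\<^sup>2 - 2 * \<eta> * inner (noise J) (zc - emb Zs))
      + \<eta> * \<beta> * (norm (emb (D_new J J') - Fl Zs))\<^sup>2"
proof -
  let ?zp = "emb (z_new J)" and ?yp = "emb (y_new J J')" and ?y = "yc"
  have "0 \<le> L" "0 \<le> \<alpha>" "\<alpha> \<le> 1" using pos \<alpha> by auto
  note prim = primal_step[OF z_new_prox(2) Fl_strongly_monotone[OF z_new_carrier Zs_carrier]
      Fl_lipschitz[OF state_carriers(1,2)] step(1,4) this, of J ?yp]
  have "2 * inner (?yp - dual_sol) (?zp - emb Zs) + NB (?yp - dual_sol) / \<theta> + NB (?yp - ?y) / (2 * \<theta>)
    \<le> (1 - \<beta> * \<theta> / \<chi>) / \<theta> * NB (?y - dual_sol) + \<beta> * (norm (emb (D_new J J') - Fl Zs))\<^sup>2"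
    unfolding NB_def
    by (rule dual_step[OF linear_mat_op linB adjB BA B_ge B_le subY _ y_new_Y(2) Zs_orth FlZs_orth emb_y_new step(3,2,8)])
      (use \<chi> Y_diff[OF state_Y(1) dual_sol_Y] in auto)
  from mult_left_mono[OF this, of \<eta>] step(1)
  have dual: "2 * \<eta> * inner (?yp - dual_sol) (?zp - emb Zs) + \<eta> / \<theta> * NB (?yp - dual_sol) + \<eta> / (2 * \<theta>) * NB (?yp - ?y)
    \<le> \<eta> * ((1 - \<beta> * \<theta> / \<chi>) / \<theta> * NB (?y - dual_sol)) + \<eta> * \<beta> * (norm (emb (D_new J J') - Fl Zs))\<^sup>2"
    by (simp add: distrib_left mult.assoc)
  have w: "5 / 16 * (norm (?zp - zc))\<^sup>2 \<le> (7 / 16 - \<gamma>) * (norm (?zp - zc))\<^sup>2"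
    using p \<gamma> by (intro mult_right_mono) auto
  show ?thesis
    using prim dual w unfolding lyap_rest_def by (simp add: algebra_simps)
qed

lemmas carriers = state_carriers z_new_carrier

definition v_noise :: "nat \<Rightarrow> nat \<Rightarrow> fin_fun" where
  "v_noise m i = (Fe (z_cur s) m i - Fe (w_prev s) m i) + \<alpha> *\<^sub>R (Fe (z_cur s) m i - Fe (z_prev s) m i)"

text \<open>On the support the sampled indices are below n, so the embedded batch operators are sums
  of the terms \<open>Fe\<close>; the full evaluation at \<open>w_prev s\<close> cancels.\<close>

lemma noise_eq:
  assumes J: "J \<in> set_pmf IP"
  shows "noise J = batch_mean J v_noise - sample_mean v_noise"
proof -
  have "emb (alg_delta d M n F params J s) = (1 / real b) *\<^sub>R
      (\<Sum>l<b. (emb (sampled_op d M F J l (z_cur s)) - emb (sampled_op d M F J l (w_prev s)))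
        + \<alpha> *\<^sub>R (emb (sampled_op d M F J l (z_cur s)) - emb (sampled_op d M F J l (z_prev s)))) + Fl (w_prev s)"
    unfolding alg_delta_def Fl_def by (simp add: emb_linear[of _ M d] emb_mat_sum[of _ _ M d] minus_carrier_mat)
  also have "\<dots> = (batch_mean J (Fe (z_cur s)) - batch_mean J (Fe (w_prev s)))
        + \<alpha> *\<^sub>R (batch_mean J (Fe (z_cur s)) - batch_mean J (Fe (z_prev s))) + Fl (w_prev s)"
    unfolding sum_emb_sampled_op[OF J carriers(1), symmetric] sum_emb_sampled_op[OF J carriers(2), symmetric]
      sum_emb_sampled_op[OF J carriers(4), symmetric]
    by (simp add: sum.distrib sum_subtractf scaleR_add_right scaleR_diff_right scaleR_sum_right mult.commute)
  also have "\<dots> = batch_mean J v_noise + Fl (w_prev s)"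
    unfolding batch_mean_def v_noise_def
    by (simp add: sum.distrib sum_subtractf scaleR_add_right scaleR_diff_right scaleR_sum_right mult.commute)
  finally have 1: "emb (alg_delta d M n F params J s) = batch_mean J v_noise + Fl (w_prev s)" .
  have "sample_mean v_noise = (Fz - Fl (w_prev s)) + \<alpha> *\<^sub>R (Fz - Fzm)"
    unfolding v_noise_def sample_mean_linear Fl_sample_mean[OF carriers(1)] Fl_sample_mean[OF carriers(2)]
      Fl_sample_mean[OF carriers(4)] by simp
  then show ?thesis unfolding noise_def 1 by simp
qed

lemma noise_unbiased: "expect IP (\<lambda>J. inner (noise J) u) = 0"
  using expectation_cong_set_pmf[of IP "\<lambda>J. inner (noise J) u" "\<lambda>J. inner (batch_mean J v_noise - sample_mean v_noise) u"]
  by (simp only: noise_eq batch_unbiased)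

text \<open>Splitting \<open>v_noise\<close> into its two differences costs a factor 2, so the total
  factor is 8 \<eta>^2 Lb^2 / b \<le> \<gamma> / 2.\<close>

lemma noise_variance:
  "4 * \<eta>\<^sup>2 * expect IP (\<lambda>J. (norm (noise J))\<^sup>2)
    \<le> \<gamma> / 2 * ((norm (zc - wm))\<^sup>2 + (norm (zc - zm))\<^sup>2)"
proof -
  let ?V = "(norm (zc - wm))\<^sup>2" and ?X = "(norm (zc - zm))\<^sup>2"
  have rb: "0 < real b" using b by simp
  have \<alpha>2: "\<alpha>\<^sup>2 \<le> 1" using \<alpha>(4,5) by (simp add: power_le_one)
  have pt: "(norm (v_noise m i))\<^sup>2
      \<le> 2 * (norm (Fe (z_cur s) m i - Fe (w_prev s) m i))\<^sup>2 + 2 * (norm (Fe (z_cur s) m i - Fe (z_prev s) m i))\<^sup>2" for m i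
  proof -
    have "(norm (v_noise m i))\<^sup>2 \<le> 2 * (norm (Fe (z_cur s) m i - Fe (w_prev s) m i))\<^sup>2
        + 2 * (norm (\<alpha> *\<^sub>R (Fe (z_cur s) m i - Fe (z_prev s) m i)))\<^sup>2"
      unfolding v_noise_def by (rule norm_add_sq_le)
    moreover have "(norm (\<alpha> *\<^sub>R (Fe (z_cur s) m i - Fe (z_prev s) m i)))\<^sup>2 \<le> 1 * (norm (Fe (z_cur s) m i - Fe (z_prev s) m i))\<^sup>2"
      unfolding norm_scaleR power_mult_distrib power2_abs using \<alpha>2 by (intro mult_right_mono) auto
    ultimately show ?thesis by linarith
  qed
  have "expect IP (\<lambda>J. (norm (noise J))\<^sup>2)
      = expect IP (\<lambda>J. (norm (batch_mean J v_noise - sample_mean v_noise))\<^sup>2)"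
    by (rule expectation_cong_set_pmf) (simp only: noise_eq)
  also have "\<dots> \<le> (1 / real b) * (\<Sum>m<M. (1 / real n) * (\<Sum>i<n. (norm (v_noise m i))\<^sup>2))"
    by (rule batch_variance)
  also have "\<dots> \<le> (1 / real b) * (\<Sum>m<M. (1 / real n) * (\<Sum>i<n. 2 * (norm (Fe (z_cur s) m i - Fe (w_prev s) m i))\<^sup>2
        + 2 * (norm (Fe (z_cur s) m i - Fe (z_prev s) m i))\<^sup>2))"
    by (intro mult_left_mono sum_mono pt) auto
  also have "\<dots> = (2 / real b) * ((\<Sum>m<M. (1 / real n) * (\<Sum>i<n. (norm (Fe (z_cur s) m i - Fe (w_prev s) m i))\<^sup>2))
        + (\<Sum>m<M. (1 / real n) * (\<Sum>i<n. (norm (Fe (z_cur s) m i - Fe (z_prev s) m i))\<^sup>2)))"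
    by (simp add: sum.distrib sum_distrib_left distrib_left mult_ac)
  also have "\<dots> \<le> (2 / real b) * (Lb\<^sup>2 * ?V + Lb\<^sup>2 * ?X)"
    by (intro mult_left_mono add_mono avg_lipschitz_Fe carriers) simp
  finally have "4 * \<eta>\<^sup>2 * expect IP (\<lambda>J. (norm (noise J))\<^sup>2)
      \<le> 4 * \<eta>\<^sup>2 * ((2 / real b) * (Lb\<^sup>2 * ?V + Lb\<^sup>2 * ?X))"
    by (intro mult_left_mono) simp_all
  also have "\<dots> = (\<eta>\<^sup>2 * Lb\<^sup>2) * (8 / real b * (?V + ?X))" by (simp add: algebra_simps)
  also have "\<dots> \<le> (\<gamma> * real b / 16) * (8 / real b * (?V + ?X))"
    by (rule mult_right_mono[OF step(5)]) simp
  also have "\<dots> = \<gamma> / 2 * (?V + ?X)" using rb by simp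
  finally show ?thesis .
qed

text \<open>With J fixed, \<open>z_new J\<close> is a constant and the fresh sample J' is unbiased,
  so bias and variance separate. Lipschitz continuity bounds the bias, average Lipschitz continuity
  the variance.\<close>

lemma half_step_error:
  "expect IP (\<lambda>J'. (norm (emb (D_new J J') - Fl Zs))\<^sup>2)
    \<le> Lb\<^sup>2 / real b * (norm (emb (z_new J) - wc))\<^sup>2 + L\<^sup>2 * (norm (emb (z_new J) - emb Zs))\<^sup>2"
proof -
  define v where "v m i = Fe (z_new J) m i - Fe (w_cur s) m i" for m i
  define u where "u = Fl (z_new J) - Fl Zs"
  have D: "emb (D_new J J') - Fl Zs = (batch_mean J' v - sample_mean v) + u" if J': "J' \<in> set_pmf IP" for J'
  proof -
    have "emb (D_new J J') = (1 / real b) *\<^sub>R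
      (\<Sum>l<b. emb (sampled_op d M F J' l (z_new J)) - emb (sampled_op d M F J' l (w_cur s))) + Fl (w_cur s)"
      unfolding D_new_def alg_Delta_half_def Fl_def by (simp add: emb_linear[of _ M d] emb_mat_sum[of _ _ M d] minus_carrier_mat)
    also have "\<dots> = batch_mean J' (Fe (z_new J)) - batch_mean J' (Fe (w_cur s)) + Fl (w_cur s)"
      unfolding sum_emb_sampled_op[OF J' carriers(7), symmetric] sum_emb_sampled_op[OF J' carriers(3), symmetric]
      by (simp add: sum_subtractf scaleR_diff_right)
    also have "\<dots> = batch_mean J' v + Fl (w_cur s)"
      unfolding batch_mean_def v_def by (simp add: sum_subtractf scaleR_diff_right)
    finally have "emb (D_new J J') = batch_mean J' v + Fl (w_cur s)" .
    moreover have "sample_mean v = Fl (z_new J) - Fl (w_cur s)"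
      unfolding v_def sample_mean_linear Fl_sample_mean[OF carriers(7)] Fl_sample_mean[OF carriers(3)] by simp
    ultimately show ?thesis by (simp add: u_def)
  qed
  have "expect IP (\<lambda>J'. (norm (emb (D_new J J') - Fl Zs))\<^sup>2)
      = expect IP (\<lambda>J'. ((norm (batch_mean J' v - sample_mean v))\<^sup>2
          + 2 * inner (batch_mean J' v - sample_mean v) u) + (norm u)\<^sup>2)"
  proof (rule expectation_cong_set_pmf)
    fix J' assume "J' \<in> set_pmf IP"
    then show "(norm (emb (D_new J J') - Fl Zs))\<^sup>2 = ((norm (batch_mean J' v - sample_mean v))\<^sup>2
          + 2 * inner (batch_mean J' v - sample_mean v) u) + (norm u)\<^sup>2"
      unfolding D[OF \<open>J' \<in> set_pmf IP\<close>]
      by (simp add: power2_norm_eq_inner inner_add_left inner_add_right inner_commute)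
  qed
  also have "\<dots> = expect IP (\<lambda>J'. (norm (batch_mean J' v - sample_mean v))\<^sup>2) + (norm u)\<^sup>2"
    unfolding expectation_add_finite[OF finite_IP] integral_mult_right_zero batch_unbiased by simp
  also have "\<dots> \<le> (1 / real b) * (\<Sum>m<M. (1 / real n) * (\<Sum>i<n. (norm (v m i))\<^sup>2)) + (norm u)\<^sup>2"
    by (intro add_right_mono batch_variance)
  also have "\<dots> \<le> (1 / real b) * (Lb\<^sup>2 * (norm (emb (z_new J) - wc))\<^sup>2) + (L * norm (emb (z_new J) - emb Zs))\<^sup>2"
    unfolding v_def u_def
    by (intro add_mono mult_left_mono avg_lipschitz_Fe power_mono Fl_lipschitz carriers Zs_carrier) simp_all
  finally show ?thesis by (simp add: power_mult_distrib)
qed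

lemma lyap_update:
  "lyap (alg_update d M n F g A params J J' c s) =
    lyap_rest (emb (z_new J)) (zc) (wc) (Fl (z_new J)) (Fz) (emb (y_new J J')) (yc)
      + w_weight * (if c then (norm (zc - emb Zs))\<^sup>2 else (norm (wc - emb Zs))\<^sup>2)"
  unfolding lyap_def alg_update_eq by simp

lemma expected_decrease:
  "expect (alg_step d M n F g A params s) lyap \<le> \<alpha> * lyap s"
proof -
  define R where "R J J' = lyap_rest (emb (z_new J)) (zc) (wc) (Fl (z_new J)) (Fz)
      (emb (y_new J J')) (yc)" for J J'
  define Z2 W2 V2 X2 Yd Nd Ns T where "Z2 = (norm (zc - emb Zs))\<^sup>2"
    and "W2 = (norm (wc - emb Zs))\<^sup>2" and "V2 = (norm (zc - wm))\<^sup>2"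
    and "X2 = (norm (zc - zm))\<^sup>2" and "Yd = (norm (yc - ym))\<^sup>2"
    and "Nd = NB (yc - ym)" and "Ns = NB (yc - dual_sol)"
    and "T = 2 * \<eta> * inner (yc - ym) (zc - emb Zs)
          - 2 * \<eta> * inner (Fz - Fzm) (zc - emb Zs)"
  define K where "K = (1 - \<gamma>) * Z2 + \<gamma> * W2 + X2 / 16 + \<alpha> * T + 4 * \<eta>\<^sup>2 * Yd + \<eta> * ((1 - \<beta> * \<theta> / \<chi>) / \<theta> * Ns)"
  define \<Xi> where "\<Xi> J = 4 * \<eta>\<^sup>2 * (norm (noise J))\<^sup>2 - 2 * \<eta> * inner (noise J) (zc - emb Zs)" for J
  \<comment> \<open>Integration over J' comes first: the new primal point and the noise depend on J
    alone, so in the deterministic bound only the half-step error is random.\<close>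
  have inner_le: "expect IP (R J) \<le> K + \<Xi> J" for J
  proof -
    define P Q where "P = (norm (emb (z_new J) - emb Zs))\<^sup>2" and "Q = (norm (emb (z_new J) - wc))\<^sup>2"
    define G where "G J' = (norm (emb (D_new J J') - Fl Zs))\<^sup>2" for J'
    have PQ: "0 \<le> P" "0 \<le> Q" by (simp_all add: P_def Q_def)
    have "R J J' \<le> (K + \<Xi> J - \<eta> * \<mu> * P - \<gamma> / 4 * Q) + \<eta> * \<beta> * G J'" for J'
      using step_deterministic[of J J']
      unfolding R_def[symmetric] K_def \<Xi>_def G_def P_def[symmetric] Q_def[symmetric] Z2_def[symmetric] W2_def[symmetric]
        X2_def[symmetric] Yd_def[symmetric] Ns_def[symmetric] T_def[symmetric] by linarith
    then have "expect IP (R J)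
        \<le> expect IP (\<lambda>J'. (K + \<Xi> J - \<eta> * \<mu> * P - \<gamma> / 4 * Q) + \<eta> * \<beta> * G J')"
      by (intro expectation_mono_finite finite_IP)
    also have "\<dots> = (K + \<Xi> J - \<eta> * \<mu> * P - \<gamma> / 4 * Q) + \<eta> * \<beta> * expect IP G"
      unfolding expectation_add_finite[OF finite_IP] by simp
    also have "\<eta> * \<beta> * expect IP G \<le> \<eta> * \<beta> * (Lb\<^sup>2 / real b * Q + L\<^sup>2 * P)"
      using half_step_error[of J] step(1,2) unfolding G_def P_def Q_def by (intro mult_left_mono) auto
    also have "\<eta> * \<beta> * (Lb\<^sup>2 / real b * Q + L\<^sup>2 * P) = \<eta> * \<beta> * (Lb\<^sup>2 / real b) * Q + \<eta> * (\<beta> * L\<^sup>2) * P"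
      by (simp add: distrib_left mult.assoc)
    also have "\<dots> \<le> \<gamma> / 4 * Q + \<eta> * (\<mu> / 4) * P"
      using step PQ by (intro add_mono mult_right_mono mult_left_mono) auto
    also have "\<dots> \<le> \<gamma> / 4 * Q + \<eta> * \<mu> * P"
      using step(1) pos PQ by (intro add_left_mono mult_right_mono mult_left_mono) auto
    finally show ?thesis by simp
  qed
  \<comment> \<open>zc and the solution are fixed before J is drawn, so the cross term with the
    noise vanishes.\<close>
  have "expect IP \<Xi> = 4 * \<eta>\<^sup>2 * expect IP (\<lambda>J. (norm (noise J))\<^sup>2)"
    unfolding \<Xi>_def expectation_diff_finite[OF finite_IP] integral_mult_right_zero noise_unbiased by simp
  then have \<Xi>: "expect IP \<Xi> \<le> \<gamma> / 2 * (V2 + X2)"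
    using noise_variance unfolding V2_def X2_def by simp
  \<comment> \<open>The coin affects only the weighted distance of w, whose mean is p Z2 + (1 - p)
    W2.\<close>
  have "expect (alg_step d M n F g A params s) lyap
      = expect IP (\<lambda>J. expect IP (\<lambda>J'. R J J' + w_weight * (p * Z2 + (1 - p) * W2)))"
    unfolding alg_step_def using p finite_IP
    by (simp add: expectation_bind_finite set_bind_pmf lyap_update R_def Z2_def W2_def algebra_simps)
  also have "\<dots> = expect IP (\<lambda>J. expect IP (R J) + w_weight * (p * Z2 + (1 - p) * W2))"
    by (simp add: expectation_add_finite[OF finite_IP])
  also have "\<dots> \<le> expect IP (\<lambda>J. (K + w_weight * (p * Z2 + (1 - p) * W2)) + \<Xi> J)"
    using inner_le by (intro expectation_mono_finite finite_IP) (simp add: algebra_simps)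
  also have "\<dots> = (K + w_weight * (p * Z2 + (1 - p) * W2)) + expect IP \<Xi>"
    unfolding expectation_add_finite[OF finite_IP] by simp
  also have "\<dots> \<le> K + \<gamma> / 2 * (V2 + X2) + w_weight * (p * Z2 + (1 - p) * W2)" using \<Xi> by simp
  also have "\<dots> \<le> \<alpha> * ((1 + \<eta> * \<mu>) * Z2 + w_weight * W2 + 3 * \<gamma> / 4 * V2 + 5 / 16 * X2 + \<eta> / (2 * \<theta>) * Nd + \<eta> / \<theta> * Ns + T)"
    unfolding K_def
  proof (rule lyapunov_arith[OF step(1) pos(3) step(3) p \<gamma> step(9) \<alpha>(1-4) \<eta>\<mu> w_weight_def])
    have "yc - ym \<in> Y" "yc - dual_sol \<in> Y"
      using state_Y dual_sol_Y by (auto intro: Y_diff)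
    then show "Yd \<le> Nd" "0 \<le> Ns"
      unfolding Yd_def Nd_def Ns_def NB_def using B_ge order_trans[OF zero_le_power2 B_ge] by auto
  qed (simp_all add: Z2_def W2_def V2_def X2_def Yd_def)
  also have "\<dots> = \<alpha> * lyap s"
    unfolding lyap_def lyap_rest_def Z2_def W2_def V2_def X2_def Nd_def Ns_def T_def by (simp add: algebra_simps)
  finally show ?thesis .
qed

lemma alg_step_support:
  "finite (set_pmf (alg_step d M n F g A params s))" "\<And>t. t \<in> set_pmf (alg_step d M n F g A params s) \<Longrightarrow> good t"
  using finite_IP good_update by (auto simp: alg_step_def set_bind_pmf)

end

section \<open>Iteration of the one-step estimate\<close>

lemma alg_law_support:
  assumes "good s"
  shows "finite (set_pmf (alg_law d M n F g A params s k))
    \<and> (\<forall>t\<in>set_pmf (alg_law d M n F g A params s k). good t)"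
  by (induction k) (auto simp: assms set_bind_pmf dest: alg_step_support)

lemma expected_lyap:
  assumes "good s"
  shows "expect (alg_law d M n F g A params s k) lyap \<le> \<alpha> ^ k * lyap s"
proof (induction k)
  case (Suc k)
  let ?law = "alg_law d M n F g A params s k"
  have fin: "finite (set_pmf ?law)" and good: "\<And>t. t \<in> set_pmf ?law \<Longrightarrow> good t"
    using alg_law_support[OF assms] by auto
  have "expect (alg_law d M n F g A params s (Suc k)) lyap
      = expect ?law (\<lambda>t. expect (alg_step d M n F g A params t) lyap)"
    using fin good alg_step_support(1) by (simp add: expectation_bind_finite)
  also have "\<dots> \<le> expect ?law (\<lambda>t. \<alpha> * lyap t)"
    by (intro expectation_mono_finite fin expected_decrease good)
  also have "\<dots> = \<alpha> * expect ?law lyap" by simp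
  also have "\<dots> \<le> \<alpha> * (\<alpha> ^ k * lyap s)" using Suc \<alpha>(4) by (intro mult_left_mono) auto
  finally show ?case by (simp add: mult.assoc)
qed simp

lemma expected_distance:
  assumes "good s"
  shows "expect (alg_law d M n F g A params s k) (\<lambda>t. (mnorm (z_cur t - Zs))\<^sup>2) \<le> 2 * \<alpha> ^ k * lyap s"
proof -
  let ?law = "alg_law d M n F g A params s k"
  have fin: "finite (set_pmf ?law)" and good: "\<And>t. t \<in> set_pmf ?law \<Longrightarrow> good t"
    using alg_law_support[OF assms] by auto
  have "(mnorm (z_cur t - Zs))\<^sup>2 \<le> 2 * lyap t" if "t \<in> set_pmf ?law" for t
    using lyap_ge[OF good[OF that]] state_carriers(1)[OF good[OF that]]
    by (simp add: norm_emb[symmetric] emb_linear[of _ M d])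
  then have "expect ?law (\<lambda>t. (mnorm (z_cur t - Zs))\<^sup>2) \<le> expect ?law (\<lambda>t. 2 * lyap t)"
    by (intro expectation_mono_finite fin)
  also have "\<dots> = 2 * expect ?law lyap" by simp
  also have "\<dots> \<le> 2 * \<alpha> ^ k * lyap s" using expected_lyap[OF assms, of k] by simp
  finally show ?thesis .
qed

end

text \<open>ln \<alpha> \<le> \<alpha> - 1 turns the bound on 1 / (1 - \<alpha>) into decay. The 1
  added to C keeps the argument of the logarithm positive when C = 0.\<close>

lemma geometric_decay:
  fixes \<alpha> X C :: real
  assumes \<alpha>: "0 < \<alpha>" "\<alpha> < 1" and X: "1 / (1 - \<alpha>) \<le> X" and C: "0 \<le> C" and e: "0 < \<epsilon>"
    and k: "X * ln ((C + 1) / \<epsilon>) \<le> real k"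
  shows "C * \<alpha> ^ k \<le> \<epsilon>"
proof (cases "C + 1 \<le> \<epsilon>")
  \<comment> \<open>Here the logarithm is not positive, so enlarging 1 / (1 - \<alpha>) to X would
    go in the wrong direction; bounding the power of \<alpha> by 1 suffices.\<close>
  case True
  have "C * \<alpha> ^ k \<le> C * 1" using C \<alpha> by (intro mult_left_mono power_le_one) auto
  then show ?thesis using True by simp
next
  case False
  then have l: "0 < ln ((C + 1) / \<epsilon>)" using e by (intro ln_gt_zero) simp
  have "1 / (1 - \<alpha>) * ln ((C + 1) / \<epsilon>) \<le> X * ln ((C + 1) / \<epsilon>)" using X l by (intro mult_right_mono) auto
  then have "ln ((C + 1) / \<epsilon>) / (1 - \<alpha>) \<le> real k" using k by simp
  then have "ln ((C + 1) / \<epsilon>) \<le> real k * (1 - \<alpha>)" using \<alpha> by (simp add: pos_divide_le_eq)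
  moreover have "real k * ln \<alpha> \<le> real k * (\<alpha> - 1)" using \<alpha> by (intro mult_left_mono ln_le_minus_one) auto
  ultimately have "real k * ln \<alpha> + ln ((C + 1) / \<epsilon>) \<le> 0" by (simp add: algebra_simps)
  then have "ln (\<alpha> ^ k * ((C + 1) / \<epsilon>)) \<le> 0"
    using \<alpha> C e by (subst ln_mult_pos) (simp_all add: ln_realpow)
  then have "\<alpha> ^ k * ((C + 1) / \<epsilon>) \<le> 1" using \<alpha> C e by (subst (asm) ln_le_zero_iff) simp_all
  then have "\<alpha> ^ k * (C + 1) \<le> \<epsilon>" using e by (simp add: pos_divide_le_eq)
  moreover have "C * \<alpha> ^ k \<le> \<alpha> ^ k * (C + 1)" using \<alpha> by (simp add: algebra_simps)
  ultimately show ?thesis by linarith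
qed

section \<open>Linear convergence\<close>

text \<open>C0 is one plus twice the Lyapunov value of the initial state, hence independent of
  \<epsilon> and k. The initial state satisfies the invariant because y0 is orthogonal to the
  consensus space.\<close>

lemma linear_rate:
  assumes "0 < d" "0 < M" "0 < n"
    and F: "\<forall>m<M. \<forall>i<n. F m i \<in> carrier_vec d \<rightarrow> carrier_vec d"
    and g: "proper_fun d g" "lsc_fun d g" "convex_fun d g"
    and pos: "0 < L" "0 < Lb" "0 < \<mu>"
    and lip: "\<forall>m<M. lipschitz_op d L (avg_op d n (F m))"
    and mono: "\<forall>m<M. strongly_monotone_op d \<mu> (avg_op d n (F m))"
    and avg: "\<forall>m<M. avg_lipschitz_op d n Lb (F m)"
    and W: "gossip_matrix M E W" and sol: "vi_solution d M n F g zs"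
    and b: "b \<in> {1..n}" and p: "0 < p" "p \<le> 1 / 8" and \<gamma>: "\<gamma> = p"
    and \<eta>: "\<eta> = min (sqrt (\<gamma> * real b) / (4 * Lb)) (1 / (16 * L * sqrt (cond_number (cheb_gossip W))))"
    and \<beta>: "\<beta> = min (\<mu> / (4 * L\<^sup>2)) (real b * \<gamma> / (4 * \<eta> * Lb\<^sup>2))"
    and \<theta>: "\<theta> = min (1 / (2 * \<beta>)) (1 / (16 * \<eta>))"
    and \<alpha>: "\<alpha> = max (max (1 - \<mu> * \<eta> / 4) (1 - \<beta> * \<theta> * inverse (cond_number (cheb_gossip W))))
              (1 - p * \<eta> * \<mu> / (2 * \<gamma> + \<eta> * \<mu>))"
    and z0: "z0 \<in> carrier_mat M d" and y0: "y0 \<in> orth_complement M d (consensus M d)"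
  shows "\<exists>C0>0. \<forall>\<epsilon>>0. \<forall>k::nat.
       real k \<ge> 144 * (1 / p + 1 / sqrt (p * real b) * (Lb / \<mu>) + L / \<mu>) * ln (C0 / \<epsilon>) \<longrightarrow>
       expect
         (alg_law d M n F g (cheb_gossip W)
            \<lparr> par_eta = \<eta>, par_theta = \<theta>, par_alpha = \<alpha>, par_beta = \<beta>, par_gamma = \<gamma>,
              par_batch = b, par_prob = p \<rparr>
            (alg_init z0 y0) k)
         (\<lambda>s. (mnorm (z_cur s - mat\<^sub>r M d (\<lambda>_. zs)))\<^sup>2) \<le> \<epsilon>"
proof -
  define \<chi> where "\<chi> = cond_number (cheb_gossip W)"
  define A where "A = cheb_gossip W"
  have b1: "1 \<le> b" using b by simp
  note \<chi>5 = cond_number_cheb_gossip(1,2)[OF W assms(2), folded \<chi>_def]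
  have A: "A \<in> carrier_mat M M" using W unfolding A_def gossip_matrix_def by (intro cheb_gossip_carrier) simp
  obtain B Y where "gossip_dual M d A \<chi> B Y"
    unfolding A_def \<chi>_def by (rule gossip_dual_exists[OF W assms(2,1)])
  then interpret gossip_dual M d A \<chi> B Y .
  interpret decentralized_vi d M n F g zs L Lb \<mu> b
    by (rule decentralized_vi.intro[OF assms(1,2,3) _ _ g pos _ _ _ sol])
      (use b1 F lip mono avg in simp_all)
  note par = parameter_bounds[OF \<chi>5 pos mu_le_L b1 p \<gamma> \<eta>[folded \<chi>_def] \<beta> \<theta> \<alpha>[folded \<chi>_def]]
  interpret decentralized_vi_algorithm d M n F g zs L Lb \<mu> b A \<chi> B Y p \<gamma> \<eta> \<beta> \<theta> \<alpha>
    by unfold_locales (fact A \<chi>5 p \<gamma> par)+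
  let ?s = "alg_init z0 y0"
  have "y0 \<in> carrier_mat M d" using y0 by (simp add: orth_complement_def)
  then have good: "good ?s" using z0 orthY[OF y0] by (simp add: good_def alg_init_def)
  define C where "C = 2 * lyap ?s"
  have "0 \<le> lyap ?s" by (rule order_trans[OF _ lyap_ge[OF good]]) simp
  then have C: "0 \<le> C" by (simp add: C_def)
  show ?thesis
  proof (intro exI[of _ "C + 1"] conjI allI impI)
    show "0 < C + 1" using C by simp
    fix \<epsilon> :: real and k :: nat
    assume e: "0 < \<epsilon>" and k: "real k \<ge> 144 * (1 / p + 1 / sqrt (p * real b) * (Lb / \<mu>) + L / \<mu>) * ln ((C + 1) / \<epsilon>)"
    have "0 < \<alpha>" using par(13) by simp
    note bound = order_trans[OF expected_distance[OF good, of k]]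
    show "expect
         (alg_law d M n F g (cheb_gossip W)
            \<lparr> par_eta = \<eta>, par_theta = \<theta>, par_alpha = \<alpha>, par_beta = \<beta>, par_gamma = \<gamma>,
              par_batch = b, par_prob = p \<rparr>
            (alg_init z0 y0) k)
         (\<lambda>s. (mnorm (z_cur s - mat\<^sub>r M d (\<lambda>_. zs)))\<^sup>2) \<le> \<epsilon>"
      unfolding A_def[symmetric] params_def[symmetric] Zs_def[symmetric]
    proof (rule bound)
      have "C * \<alpha> ^ k \<le> \<epsilon>" by (rule geometric_decay[OF \<open>0 < \<alpha>\<close> par(14) par(16) C e k])
      then show "2 * \<alpha> ^ k * lyap ?s \<le> \<epsilon>" by (simp only: C_def mult_ac)
    qed
  qed
qed

theorem theorem4p2:
  shows "\<exists>C>0. \<forall>(d::nat) (M::nat) (n::nat)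
      (F :: nat \<Rightarrow> nat \<Rightarrow> real vec \<Rightarrow> real vec) (g :: real vec \<Rightarrow> ereal)
      (E :: (nat \<times> nat) set) (W :: real mat) (zs :: real vec)
      (L::real) (Lb::real) (\<mu>::real) (b::nat) (p::real)
      (\<gamma>::real) (\<eta>::real) (\<beta>::real) (\<theta>::real) (\<alpha>::real) (z0 :: real mat) (y0 :: real mat).
    0 < d \<longrightarrow> 0 < M \<longrightarrow> 0 < n \<longrightarrow>
    (\<forall>m<M. \<forall>i<n. F m i \<in> carrier_vec d \<rightarrow> carrier_vec d) \<longrightarrow>
    proper_fun d g \<longrightarrow> lsc_fun d g \<longrightarrow> convex_fun d g \<longrightarrow>
    0 < L \<longrightarrow> 0 < Lb \<longrightarrow> 0 < \<mu> \<longrightarrow>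
    (\<forall>m<M. lipschitz_op d L (avg_op d n (F m))) \<longrightarrow>
    (\<forall>m<M. strongly_monotone_op d \<mu> (avg_op d n (F m))) \<longrightarrow>
    (\<forall>m<M. avg_lipschitz_op d n Lb (F m)) \<longrightarrow>
    undirected_connected M E \<longrightarrow> gossip_matrix M E W \<longrightarrow>
    vi_solution d M n F g zs \<longrightarrow>
    b \<in> {1..n} \<longrightarrow> 0 < p \<longrightarrow> p < 1 \<longrightarrow>
    \<gamma> = p \<longrightarrow> p \<le> 1 / 8 \<longrightarrow>
    \<eta> = min (sqrt (\<gamma> * real b) / (4 * Lb)) (1 / (16 * L * sqrt (cond_number (cheb_gossip W)))) \<longrightarrow>
    \<beta> = min (\<mu> / (4 * L\<^sup>2)) (real b * \<gamma> / (4 * \<eta> * Lb\<^sup>2)) \<longrightarrow>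
    \<theta> = min (1 / (2 * \<beta>)) (1 / (16 * \<eta>)) \<longrightarrow>
    \<alpha> = max (max (1 - \<mu> * \<eta> / 4) (1 - \<beta> * \<theta> * inverse (cond_number (cheb_gossip W))))
              (1 - p * \<eta> * \<mu> / (2 * \<gamma> + \<eta> * \<mu>)) \<longrightarrow>
    z0 \<in> carrier_mat M d \<longrightarrow> (\<forall>m<M. row z0 m \<in> dom_fun d g) \<longrightarrow>
    y0 \<in> orth_complement M d (consensus M d) \<longrightarrow>
    (\<exists>C0>0. \<forall>\<epsilon>>0. \<forall>k::nat.
       real k \<ge> C * (1 / p + 1 / sqrt (p * real b) * (Lb / \<mu>) + L / \<mu>) * ln (C0 / \<epsilon>) \<longrightarrow>
       measure_pmf.expectation
         (alg_law d M n F g (cheb_gossip W)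
            \<lparr> par_eta = \<eta>, par_theta = \<theta>, par_alpha = \<alpha>, par_beta = \<beta>, par_gamma = \<gamma>,
              par_batch = b, par_prob = p \<rparr>
            (alg_init z0 y0) k)
         (\<lambda>s. (mnorm (z_cur s - mat\<^sub>r M d (\<lambda>_. zs)))\<^sup>2) \<le> \<epsilon>)"
  \<comment> \<open>144 is the constant in the bound on 1 / (1 - \<alpha>) from
    \<open>parameter_bounds\<close>.\<close>
  by (rule exI[of _ 144], intro conjI allI impI, simp, rule linear_rate; assumption)

end
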